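(* Let $\kappa\in(-1,1)$, and let the unit disk $M$ be equipped with the metric $g_\kappa$. (a) The SVD of the operator $P_-\colon\mathcal{V}_-\to\mathcal{V}_+$ is given as follows, in terms of the complete orthogonal system $\{v'_{p,q}: (p,q)\in\mathbb{Z}^2,\ p\le 2q+1\}$ of $\mathcal{V}_-$ and the complete orthogonal system $\{u'_{p,q}:(p,q)\in\mathbb{Z}^2,\ p<2q+1\}$ of $\mathcal{V}_+$: for any $(p,q)\in\mathbb{Z}^2$ with $p\le2q+1$, $$P_-v'_{p,q}=\begin{cases}-2i\,u'_{p,q}&\text{if }q>-\tfrac12\text{ and }p<q+\tfrac12,\\0&\text{otherwise.}\end{cases}$$ (b) The eigendecomposition of $C_-\colon\mathcal{V}_+\to\mathcal{V}_+$ is given as follows, in terms of the same complete orthogonal system $\{u'_{p,q}\}_{p<2q+1}$ of $\mathcal{V}_+$: for any $(p,q)\in\mathbb{Z}^2$ with $p<2q+1$, $$C_-u'_{p,q}=\begin{cases}i\,u'_{p,q}&\text{if }q<-\tfrac12\text{ and }p<q+\tfrac12,\\-i\,u'_{p,q}&\text{if }q>-\tfrac12\text{ and }p>q+\tfrac12,\\0&\text{otherwise.}\end{cases}$$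
   Context: Setting. $M=\{z\in\mathbb{C}:|z|\le1\}$ with metric $g_\kappa(z)=(1+\kappa|z|^2)^{-2}|dz|^2$. The boundary $\partial SM$ of the unit circle bundle is parameterized by fan-beam coordinates $(\beta,\alpha)\in(\mathbb{R}/2\pi\mathbb{Z})^2$: base point $e^{i\beta}$, unit vector $(1+\kappa)e^{i(\beta+\pi+\alpha)}$. $\partial_+SM=\{\alpha\in[-\pi/2,\pi/2]\}$, $\partial_-SM=\{\alpha\in[\pi/2,3\pi/2]\}$, $d\Sigma^2=(1+\kappa)^{-1}d\beta\,d\alpha$. Scattering: $\mathfrak{s}=\mathfrak{s}_\kappa$ is given by $\mathfrak{s}(\alpha)=\tan^{-1}\left(\frac{1-\kappa}{1+\kappa}\tan\alpha\right)$ on $(-\pi/2,\pi/2)$, extended smoothly to $\mathbb{R}$ by $\mathfrak{s}(\alpha+\pi)=\mathfrak{s}(\alpha)+\pi$. The scattering relation is $\mathcal{S}(\beta,\alpha)=(\beta+\pi+2\mathfrak{s}(\alpha),\pi-\alpha)$ and the antipodal scattering relation is $\mathcal{S}_A(\beta,\alpha)=(\beta+\pi+2\mathfrak{s}(\alpha),-\alpha)$. $\mathcal{S}^*$, $\mathcal{S}_A^*$ denote pullbacks. Operators: for $u$ on $\partial_+SM$, $A_\pm u$ equals $u$ on $\partial_+SM$ and $\pm u\circ\mathcal{S}$ on $\partial_-SM$. For $u$ on $\partial SM$, $A_-^*u=(u-u\circ\mathcal{S})|_{\partial_+SM}$. The fiberwise Hilbert transform is $Hu=\sum_k-i\,\mathrm{sign}(k)u_k(\beta)e^{ik\alpha}$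 for $u=\sum_ku_k(\beta)e^{ik\alpha}$, $\mathrm{sign}(0)=0$, and $H_-$ is its restriction to odd modes (zero on even modes). $P_-=A_-^*H_-A_+$ and $C_-=\frac12A_-^*H_-A_-$, viewed as bounded operators on $L^2(\partial_+SM,d\Sigma^2)$. The orthogonal splitting is $L^2(\partial_+SM,d\Sigma^2)=\mathcal{V}_+\oplus\mathcal{V}_-$ with $\mathcal{V}_\pm=L^2(\partial_+SM,d\Sigma^2)\cap\ker(id\mp\mathcal{S}_A^* )$. Bases: for $(p,q)\in\mathbb{Z}^2$, $\phi'_{p,q}(\beta,\alpha)=\sqrt{\mathfrak{s}'(\alpha)}\,e^{i(p\beta+(2q+1)\mathfrak{s}(\alpha))}$, $$u'_{p,q}=(id+\mathcal{S}_A^* )\phi'_{p,q}=\phi'_{p,q}+(-1)^p\phi'_{p,p-q-1},\qquad v'_{p,q}=(id-\mathcal{S}_A^* )\phi'_{p,q}=\phi'_{p,q}-(-1)^p\phi'_{p,p-q-1},$$ (restricted to $\partial_+SM$). *)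

theory Defs
  imports "HOL-Analysis.Analysis"
begin

subsection \<open>Fan-beam coordinates\<close>

text \<open>
  Norm of a tangent vector \<open>v\<close> at \<open>z\<close> for the metric
  \<open>(1 + \<kappa> |z|^2)^{-2} |dz|^2\<close> on the unit disk, and the
  fan-beam parameterization (base point, tangent vector) of the unit circle bundle over
  the boundary.
\<close>

definition metric_norm :: "real \<Rightarrow> complex \<Rightarrow> complex \<Rightarrow> real" where
  "metric_norm \<kappa> z v = norm v / (1 + \<kappa> * (norm z)\<^sup>2)"

definition fan_beam :: "real \<Rightarrow> real \<times> real \<Rightarrow> complex \<times> complex" where
  "fan_beam \<kappa> = (\<lambda>(\<beta>, \<alpha>). (cis \<beta>, of_real (1 + \<kappa>) * cis (\<beta> + pi + \<alpha>)))"

text \<open>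
  Everything below is expressed in the coordinates \<open>(\<beta>, \<alpha>)\<close>. A point of
  \<open>(\<real>/2\<pi>\<int>)^2\<close> is represented by any of its lifts to
  \<open>\<real>^2\<close>, and a function on a subset of the torus by a function on
  \<open>\<real> \<times> \<real>\<close> that is \<open>2\<pi>\<close>-periodic in both
  variables on the lift of that subset; its values elsewhere are irrelevant.
\<close>

definition bdry :: "(real \<times> real) set" where
  "bdry = UNIV"

definition bdry_plus :: "(real \<times> real) set" where
  "bdry_plus = {(\<beta>, \<alpha>). \<exists>n::int. \<alpha> - 2 * pi * of_int n \<in> {- pi / 2 .. pi / 2}}"

definition periodic_on :: "(real \<times> real) set \<Rightarrow> (real \<times> real \<Rightarrow> complex) \<Rightarrow> bool" where
  "periodic_on A u \<longleftrightarrow>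
     (\<forall>(\<beta>, \<alpha>) \<in> A. u (\<beta> + 2 * pi, \<alpha>) = u (\<beta>, \<alpha>) \<and> u (\<beta>, \<alpha> + 2 * pi) = u (\<beta>, \<alpha>))"

text \<open>One representative of each point of the torus.\<close>

definition fundamental_domain :: "(real \<times> real) set" where
  "fundamental_domain = {0 ..< 2 * pi} \<times> {- pi / 2 ..< 3 * pi / 2}"

definition dSigma :: "real \<Rightarrow> (real \<times> real) set \<Rightarrow> (real \<times> real) measure" where
  "dSigma \<kappa> A =
     density (restrict_space lborel (A \<inter> fundamental_domain)) (\<lambda>_. ennreal (1 / (1 + \<kappa>)))"


subsection \<open>Square-integrable functions\<close>

text \<open>
  Elements of \<open>L^2\<close> are represented by functions, with almost-everywhere equality
  as the notion of equality.
\<close>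

definition L2 :: "real \<Rightarrow> (real \<times> real) set \<Rightarrow> (real \<times> real \<Rightarrow> complex) set" where
  "L2 \<kappa> A = {u. periodic_on A u \<and> u \<in> borel_measurable (dSigma \<kappa> A) \<and>
                  integrable (dSigma \<kappa> A) (\<lambda>x. (norm (u x))\<^sup>2)}"

definition eq_L2 ::
  "real \<Rightarrow> (real \<times> real) set \<Rightarrow> (real \<times> real \<Rightarrow> complex) \<Rightarrow> (real \<times> real \<Rightarrow> complex) \<Rightarrow> bool" where
  "eq_L2 \<kappa> A u v \<longleftrightarrow> (AE x in dSigma \<kappa> A. u x = v x)"

definition inner_L2 ::
  "real \<Rightarrow> (real \<times> real) set \<Rightarrow> (real \<times> real \<Rightarrow> complex) \<Rightarrow> (real \<times> real \<Rightarrow> complex) \<Rightarrow> complex" where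
  "inner_L2 \<kappa> A u v = (LINT x|dSigma \<kappa> A. u x * cnj (v x))"

definition norm_L2 :: "real \<Rightarrow> (real \<times> real) set \<Rightarrow> (real \<times> real \<Rightarrow> complex) \<Rightarrow> real" where
  "norm_L2 \<kappa> A u = sqrt (LINT x|dSigma \<kappa> A. (norm (u x))\<^sup>2)"

text \<open>Bounded linear operators between subspaces of \<open>L^2(\<partial>_+SM)\<close>.\<close>

definition bounded_operator ::
  "real \<Rightarrow> (real \<times> real \<Rightarrow> complex) set \<Rightarrow> (real \<times> real \<Rightarrow> complex) set \<Rightarrow>
   ((real \<times> real \<Rightarrow> complex) \<Rightarrow> (real \<times> real \<Rightarrow> complex)) \<Rightarrow> bool" where
  "bounded_operator \<kappa> X Y T \<longleftrightarrow>
     (\<forall>u\<in>X. T u \<in> Y) \<and>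
     (\<forall>u\<in>X. \<forall>v\<in>X. eq_L2 \<kappa> bdry_plus u v \<longrightarrow> eq_L2 \<kappa> bdry_plus (T u) (T v)) \<and>
     (\<forall>u\<in>X. \<forall>v\<in>X. \<forall>a b. eq_L2 \<kappa> bdry_plus
        (T (\<lambda>x. a * u x + b * v x)) (\<lambda>x. a * T u x + b * T v x)) \<and>
     (\<exists>C. \<forall>u\<in>X. norm_L2 \<kappa> bdry_plus (T u) \<le> C * norm_L2 \<kappa> bdry_plus u)"

definition complete_orthogonal_system ::
  "real \<Rightarrow> (real \<times> real \<Rightarrow> complex) set \<Rightarrow> 'i set \<Rightarrow> ('i \<Rightarrow> real \<times> real \<Rightarrow> complex) \<Rightarrow> bool" where
  "complete_orthogonal_system \<kappa> V I e \<longleftrightarrow>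
     (\<forall>i\<in>I. e i \<in> V \<and> norm_L2 \<kappa> bdry_plus (e i) \<noteq> 0) \<and>
     (\<forall>i\<in>I. \<forall>j\<in>I. i \<noteq> j \<longrightarrow> inner_L2 \<kappa> bdry_plus (e i) (e j) = 0) \<and>
     (\<forall>f\<in>V. \<forall>\<epsilon>>0. \<exists>F c. finite F \<and> F \<subseteq> I \<and>
        norm_L2 \<kappa> bdry_plus (\<lambda>x. f x - (\<Sum>i\<in>F. c i * e i x)) < \<epsilon>)"


subsection \<open>Scattering relations\<close>

text \<open>
  The integer part selects the branch \<open>scat(\<alpha> + \<pi>) = scat(\<alpha>) + \<pi>\<close>.
  Odd multiples of \<open>\<pi>/2\<close>, where \<open>tan\<close> has its poles, are fixed
  points of the continuous extension.
\<close>

definition scat :: "real \<Rightarrow> real \<Rightarrow> real" where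
  "scat \<kappa> \<alpha> =
     (if cos \<alpha> = 0 then \<alpha>
      else arctan ((1 - \<kappa>) / (1 + \<kappa>) * tan \<alpha>) + pi * of_int \<lfloor>\<alpha> / pi + 1 / 2\<rfloor>)"

definition scattering :: "real \<Rightarrow> real \<times> real \<Rightarrow> real \<times> real" where
  "scattering \<kappa> = (\<lambda>(\<beta>, \<alpha>). (\<beta> + pi + 2 * scat \<kappa> \<alpha>, pi - \<alpha>))"

definition antipodal_scattering :: "real \<Rightarrow> real \<times> real \<Rightarrow> real \<times> real" where
  "antipodal_scattering \<kappa> = (\<lambda>(\<beta>, \<alpha>). (\<beta> + pi + 2 * scat \<kappa> \<alpha>, - \<alpha>))"

definition V_plus :: "real \<Rightarrow> (real \<times> real \<Rightarrow> complex) set" where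
  "V_plus \<kappa> = {u \<in> L2 \<kappa> bdry_plus. eq_L2 \<kappa> bdry_plus (u \<circ> antipodal_scattering \<kappa>) u}"

definition V_minus :: "real \<Rightarrow> (real \<times> real \<Rightarrow> complex) set" where
  "V_minus \<kappa> = {u \<in> L2 \<kappa> bdry_plus. eq_L2 \<kappa> bdry_plus (u \<circ> antipodal_scattering \<kappa>) (\<lambda>x. - u x)}"


subsection \<open>Operators\<close>

definition A_plus :: "real \<Rightarrow> (real \<times> real \<Rightarrow> complex) \<Rightarrow> (real \<times> real \<Rightarrow> complex)" where
  "A_plus \<kappa> u = (\<lambda>x. if x \<in> bdry_plus then u x else u (scattering \<kappa> x))"

definition A_minus :: "real \<Rightarrow> (real \<times> real \<Rightarrow> complex) \<Rightarrow> (real \<times> real \<Rightarrow> complex)" where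
  "A_minus \<kappa> u = (\<lambda>x. if x \<in> bdry_plus then u x else - u (scattering \<kappa> x))"

text \<open>Only the values on \<open>\<partial>_+SM\<close> are meaningful.\<close>

definition A_minus_adj :: "real \<Rightarrow> (real \<times> real \<Rightarrow> complex) \<Rightarrow> (real \<times> real \<Rightarrow> complex)" where
  "A_minus_adj \<kappa> u = (\<lambda>x. u x - u (scattering \<kappa> x))"

definition fiber_coeff :: "(real \<times> real \<Rightarrow> complex) \<Rightarrow> int \<Rightarrow> real \<Rightarrow> complex" where
  "fiber_coeff u k \<beta> =
     (LINT \<alpha>:{- pi / 2 ..< 3 * pi / 2}|lborel. u (\<beta>, \<alpha>) * cis (- (of_int k * \<alpha>))) / of_real (2 * pi)"

text \<open>
  The sum of the series \<open>\<Sum>k. m k * u_k(\<beta>) * e^{ik\<alpha>}\<close> in the sense of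
  \<open>L^2(\<partial>SM)\<close> convergence; it is determined up to almost-everywhere equality.
\<close>

definition fiber_multiplier ::
  "real \<Rightarrow> (int \<Rightarrow> complex) \<Rightarrow> (real \<times> real \<Rightarrow> complex) \<Rightarrow> (real \<times> real \<Rightarrow> complex)" where
  "fiber_multiplier \<kappa> m u =
     (SOME w. w \<in> L2 \<kappa> bdry \<and>
        (\<lambda>N::nat. norm_L2 \<kappa> bdry (\<lambda>(\<beta>, \<alpha>).
            w (\<beta>, \<alpha>) - (\<Sum>k = - int N..int N. m k * fiber_coeff u k \<beta> * cis (of_int k * \<alpha>))))
          \<longlonglongrightarrow> 0)"

definition hilbert_symbol :: "int \<Rightarrow> complex" where
  "hilbert_symbol k = - \<i> * of_int (sgn k)"

definition fiber_hilbert :: "real \<Rightarrow> (real \<times> real \<Rightarrow> complex) \<Rightarrow> (real \<times> real \<Rightarrow> complex)" where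
  "fiber_hilbert \<kappa> = fiber_multiplier \<kappa> hilbert_symbol"

definition H_minus :: "real \<Rightarrow> (real \<times> real \<Rightarrow> complex) \<Rightarrow> (real \<times> real \<Rightarrow> complex)" where
  "H_minus \<kappa> = fiber_multiplier \<kappa> (\<lambda>k. if odd k then hilbert_symbol k else 0)"

definition P_minus :: "real \<Rightarrow> (real \<times> real \<Rightarrow> complex) \<Rightarrow> (real \<times> real \<Rightarrow> complex)" where
  "P_minus \<kappa> u = A_minus_adj \<kappa> (H_minus \<kappa> (A_plus \<kappa> u))"

definition C_minus :: "real \<Rightarrow> (real \<times> real \<Rightarrow> complex) \<Rightarrow> (real \<times> real \<Rightarrow> complex)" where
  "C_minus \<kappa> u = (\<lambda>x. 1 / 2 * A_minus_adj \<kappa> (H_minus \<kappa> (A_minus \<kappa> u)) x)"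


subsection \<open>Bases\<close>

definition phi' :: "real \<Rightarrow> int \<Rightarrow> int \<Rightarrow> real \<times> real \<Rightarrow> complex" where
  "phi' \<kappa> p q = (\<lambda>(\<beta>, \<alpha>).
     of_real (sqrt (deriv (scat \<kappa>) \<alpha>)) * cis (of_int p * \<beta> + of_int (2 * q + 1) * scat \<kappa> \<alpha>))"

definition u' :: "real \<Rightarrow> int \<Rightarrow> int \<Rightarrow> real \<times> real \<Rightarrow> complex" where
  "u' \<kappa> p q = (\<lambda>x. phi' \<kappa> p q x + phi' \<kappa> p q (antipodal_scattering \<kappa> x))"

definition v' :: "real \<Rightarrow> int \<Rightarrow> int \<Rightarrow> real \<times> real \<Rightarrow> complex" where
  "v' \<kappa> p q = (\<lambda>x. phi' \<kappa> p q x - phi' \<kappa> p q (antipodal_scattering \<kappa> x))"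


subsection \<open>Consistency of the conventions\<close>

lemma metric_norm_fan_beam:
  assumes "- 1 < \<kappa>" "fan_beam \<kappa> (\<beta>, \<alpha>) = (z, v)"
  shows "norm z = 1" "metric_norm \<kappa> z v = 1"
  using assms by (auto simp: fan_beam_def metric_norm_def norm_mult simp del: of_real_add)

lemma bdry_plus_iff_cos: "(\<beta>, \<alpha>) \<in> bdry_plus \<longleftrightarrow> 0 \<le> cos \<alpha>"
proof
  assume "(\<beta>, \<alpha>) \<in> bdry_plus"
  then obtain n :: int where n: "\<alpha> - 2 * pi * of_int n \<in> {- pi / 2 .. pi / 2}"
    by (auto simp: bdry_plus_def)
  then have "0 \<le> cos (\<alpha> - 2 * pi * of_int n)"
    by (intro cos_ge_zero) auto
  also have "cos (\<alpha> - 2 * pi * of_int n) = cos \<alpha>"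
    by (simp add: cos_diff cos_int_2pin sin_int_2pin)
  finally show "0 \<le> cos \<alpha>" .
next
  assume pos: "0 \<le> cos \<alpha>"
  define n where "n = \<lfloor>\<alpha> / (2 * pi) + 1 / 2\<rfloor>"
  define a where "a = \<alpha> - 2 * pi * of_int n"
  have "of_int n \<le> \<alpha> / (2 * pi) + 1 / 2" "\<alpha> / (2 * pi) + 1 / 2 < of_int n + 1"
    unfolding n_def by linarith+
  then have a: "- pi \<le> a" "a < pi"
    unfolding a_def using pi_gt_zero by (auto simp: field_simps)
  have cosa: "cos a = cos \<alpha>"
    unfolding a_def by (simp add: cos_diff cos_int_2pin sin_int_2pin)
  have "\<bar>a\<bar> \<le> pi / 2"
  proof (rule ccontr)
    assume "\<not> \<bar>a\<bar> \<le> pi / 2"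
    then have "cos \<bar>a\<bar> < cos (pi / 2)"
      using a by (intro cos_monotone_0_pi) auto
    then show False using pos cosa by simp
  qed
  then have "a \<in> {- pi / 2 .. pi / 2}" unfolding atLeastAtMost_iff by linarith
  then show "(\<beta>, \<alpha>) \<in> bdry_plus"
    unfolding bdry_plus_def a_def by blast
qed

lemma inward_iff_bdry_plus:
  assumes "- 1 < \<kappa>" "fan_beam \<kappa> (\<beta>, \<alpha>) = (z, v)"
  shows "inner z v \<le> 0 \<longleftrightarrow> (\<beta>, \<alpha>) \<in> bdry_plus"
proof -
  have "inner z v = (1 + \<kappa>) * cos ((\<beta> + pi + \<alpha>) - \<beta>)"
    using assms(2) unfolding cos_diff
    by (auto simp: fan_beam_def inner_complex_def distrib_left mult_ac)
  also have "cos ((\<beta> + pi + \<alpha>) - \<beta>) = - cos \<alpha>" by simp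
  finally show ?thesis
    using assms(1) by (simp add: bdry_plus_iff_cos zero_le_mult_iff)
qed

lemma scat_eq_arctan:
  assumes "\<alpha> \<in> {- pi / 2 <..< pi / 2}"
  shows "scat \<kappa> \<alpha> = arctan ((1 - \<kappa>) / (1 + \<kappa>) * tan \<alpha>)"
proof -
  have "\<lfloor>\<alpha> / pi + 1 / 2\<rfloor> = 0"
    using assms pi_gt_zero by (intro floor_unique) (auto simp: field_simps)
  moreover have "cos \<alpha> > 0" using assms by (intro cos_gt_zero_pi) auto
  ultimately show ?thesis by (simp add: scat_def)
qed

lemma scat_add_pi: "scat \<kappa> (\<alpha> + pi) = scat \<kappa> \<alpha> + pi"
proof -
  have "(\<alpha> + pi) / pi + 1 / 2 = (\<alpha> / pi + 1 / 2) + of_int 1"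
    by (simp add: field_simps)
  then have "\<lfloor>(\<alpha> + pi) / pi + 1 / 2\<rfloor> = \<lfloor>\<alpha> / pi + 1 / 2\<rfloor> + 1"
    by (metis floor_add_int)
  moreover have "tan (\<alpha> + pi) = tan \<alpha>" by (rule tan_periodic_pi)
  ultimately show ?thesis
    unfolding scat_def by (auto simp only: cos_periodic_pi of_int_add of_int_1 distrib_left mult_1_right
        neg_equal_0_iff_equal add.assoc split: if_splits)
qed

lemma scat_smooth_formula:
  assumes k: "- 1 < \<kappa>" "\<kappa> < 1"
  shows "scat \<kappa> \<alpha> = \<alpha> - arctan (\<kappa> * sin (2 * \<alpha>) / (1 + \<kappa> * cos (2 * \<alpha>)))"
proof (cases "cos \<alpha> = 0")
  case True
  then show ?thesis by (simp add: scat_def sin_double)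
next
  case False
  define n where "n = \<lfloor>\<alpha> / pi + 1 / 2\<rfloor>"
  define a where "a = \<alpha> - pi * of_int n"
  define c where "c = (1 - \<kappa>) / (1 + \<kappa>)"
  define b where "b = arctan (c * tan a)"
  have c: "c > 0" using k by (simp add: c_def)
  have sn: "sin (pi * of_int n) = 0" by (simp add: sin_zero_iff_int2)
  have cn: "(cos (pi * of_int n))\<^sup>2 = 1"
    using sn sin_cos_squared_add[of "pi * of_int n"] by simp
  then have cn0: "cos (pi * of_int n) \<noteq> 0" by auto
  have cosa: "cos a = cos \<alpha> * cos (pi * of_int n)" and sina: "sin a = sin \<alpha> * cos (pi * of_int n)"
    unfolding a_def cos_diff sin_diff sn by simp_all
  have tana: "tan a = tan \<alpha>" using cn0 by (simp add: tan_def cosa sina)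
  have ca0: "cos a \<noteq> 0" using False cn0 by (simp add: cosa)
  have "of_int n \<le> \<alpha> / pi + 1 / 2" "\<alpha> / pi + 1 / 2 < of_int n + 1"
    unfolding n_def by linarith+
  then have "- pi / 2 \<le> a" "a < pi / 2"
    unfolding a_def using pi_gt_zero by (auto simp: field_simps)
  moreover have "a \<noteq> - pi / 2" using ca0 by auto
  ultimately have a: "- pi / 2 < a" "a < pi / 2" by auto
  have b: "- pi / 2 < b" "b < pi / 2"
    using arctan_bounded[of "c * tan a"] by (auto simp: b_def)
  have tanb: "tan b = c * tan a" by (simp add: b_def tan_arctan)
  have cb0: "cos b \<noteq> 0" using b cos_gt_zero_pi[of b] by auto
  have ab: "- pi / 2 < a - b" "a - b < pi / 2"
  proof -
    consider "a = 0" | "a > 0" | "a < 0" by linarith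
    then have "- pi / 2 < a - b \<and> a - b < pi / 2"
    proof cases
      case 1 then show ?thesis by (simp add: b_def)
    next
      case 2
      then have "tan a > 0" using a by (intro tan_gt_zero) auto
      then have "b > 0" using c by (simp add: b_def zero_less_arctan_iff)
      then show ?thesis using 2 a b by linarith
    next
      case 3
      then have "tan a < 0" using a by (intro tan_less_zero) auto
      then have "b < 0" using c by (simp add: b_def arctan_less_zero_iff mult_pos_neg)
      then show ?thesis using 3 a b by linarith
    qed
    then show "- pi / 2 < a - b" "a - b < pi / 2" by auto
  qed
  then have cab: "cos (a - b) \<noteq> 0" using cos_gt_zero_pi[of "a - b"] by auto
  have s1: "(sin \<alpha>)\<^sup>2 = 1 - (cos \<alpha>)\<^sup>2" by (simp add: sin_squared_eq)
  have "\<bar>\<kappa> * cos (2 * \<alpha>)\<bar> < 1"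
    using k mult_left_mono[OF abs_cos_le_one[of "2 * \<alpha>"], of "\<bar>\<kappa>\<bar>"]
    unfolding abs_mult by linarith
  then have d0: "1 + \<kappa> * cos (2 * \<alpha>) > 0" by linarith
  have "tan (a - b) = (tan a - c * tan a) / (1 + c * (tan a)\<^sup>2)"
    using tan_diff[OF ca0 cb0 cab] by (simp add: tanb power2_eq_square algebra_simps)
  also have "\<dots> = \<kappa> * sin (2 * \<alpha>) / (1 + \<kappa> * cos (2 * \<alpha>))"
  proof -
    let ?S = "sin \<alpha>" and ?C = "cos \<alpha>"
    have e: "1 + \<kappa> * cos (2 * \<alpha>) = (1 + \<kappa>) * ?C\<^sup>2 + (1 - \<kappa>) * ?S\<^sup>2"
      unfolding cos_double s1 by algebra
    have t: "tan a = ?S / ?C" using tana by (simp add: tan_def[THEN fun_cong, of \<alpha>])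
    have k0: "1 + \<kappa> \<noteq> 0" using k by simp
    have cC: "(1 - \<kappa>) = c * (1 + \<kappa>)" using k0 by (simp add: c_def)
    have S: "?S = tan a * ?C" using False by (simp add: t)
    have num: "2 * \<kappa> * ?S * ?C = (tan a - c * tan a) * ((1 + \<kappa>) * ?C\<^sup>2)"
      using cC unfolding S by algebra
    have den: "(1 + \<kappa>) * ?C\<^sup>2 + (1 - \<kappa>) * ?S\<^sup>2 = (1 + c * (tan a)\<^sup>2) * ((1 + \<kappa>) * ?C\<^sup>2)"
      unfolding S cC by algebra
    have "\<kappa> * sin (2 * \<alpha>) = 2 * \<kappa> * ?S * ?C" by (simp add: sin_double)
    then show ?thesis
      unfolding e den num using False k0 by simp
  qed
  finally have "a - b = arctan (\<kappa> * sin (2 * \<alpha>) / (1 + \<kappa> * cos (2 * \<alpha>)))"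
    using ab by (metis arctan_unique minus_divide_left)
  moreover have "scat \<kappa> \<alpha> = b + pi * of_int n"
    using False by (simp add: scat_def b_def c_def n_def tana)
  ultimately show ?thesis by (simp add: a_def)
qed

lemma scat_uminus:
  assumes "- 1 < \<kappa>" "\<kappa> < 1"
  shows "scat \<kappa> (- \<alpha>) = - scat \<kappa> \<alpha>"
  by (simp add: scat_smooth_formula[OF assms] arctan_minus)

lemma scat_has_derivative:
  assumes k: "- 1 < \<kappa>" "\<kappa> < 1"
  shows "(scat \<kappa> has_real_derivative (1 - \<kappa>\<^sup>2) / (1 + 2 * \<kappa> * cos (2 * \<alpha>) + \<kappa>\<^sup>2)) (at \<alpha>)"
proof -
  have "\<bar>\<kappa> * cos (2 * \<alpha>)\<bar> < 1"
    using k mult_left_mono[OF abs_cos_le_one[of "2 * \<alpha>"], of "\<bar>\<kappa>\<bar>"]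
    unfolding abs_mult by linarith
  then have d0: "1 + \<kappa> * cos (2 * \<alpha>) > 0" by linarith
  let ?S = "sin (2 * \<alpha>)" and ?C = "cos (2 * \<alpha>)"
  let ?D = "1 + \<kappa> * ?C"
  have sc: "?S\<^sup>2 = 1 - ?C\<^sup>2" by (simp add: sin_squared_eq)
  have eq: "?D\<^sup>2 + (\<kappa> * ?S)\<^sup>2 = 1 + 2 * \<kappa> * ?C + \<kappa>\<^sup>2"
    by (simp add: power_mult_distrib sc) (simp add: power2_eq_square algebra_simps)
  have "?D\<^sup>2 + (\<kappa> * ?S)\<^sup>2 > 0" using d0 by (intro add_pos_nonneg) auto
  then have E0: "1 + 2 * \<kappa> * ?C + \<kappa>\<^sup>2 \<noteq> 0" by (simp add: eq)
  have inv: "inverse (1 + (\<kappa> * ?S / ?D)\<^sup>2) = ?D\<^sup>2 / (1 + 2 * \<kappa> * ?C + \<kappa>\<^sup>2)"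
    unfolding eq[symmetric] power_divide using d0 by (simp add: divide_simps)
  have der: "((\<lambda>x. \<kappa> * sin (2 * x) / (1 + \<kappa> * cos (2 * x))) has_real_derivative
      (2 * \<kappa> * ?C * ?D + 2 * (\<kappa> * ?S)\<^sup>2) / ?D\<^sup>2) (at \<alpha>)"
    using d0 by (auto intro!: derivative_eq_intros simp: power2_eq_square algebra_simps)
  have "((\<lambda>x. x - arctan (\<kappa> * sin (2 * x) / (1 + \<kappa> * cos (2 * x)))) has_real_derivative
      1 - inverse (1 + (\<kappa> * ?S / ?D)\<^sup>2) * ((2 * \<kappa> * ?C * ?D + 2 * (\<kappa> * ?S)\<^sup>2) / ?D\<^sup>2)) (at \<alpha>)"
    by (intro DERIV_diff DERIV_ident DERIV_chain2[OF DERIV_arctan der])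
  also have "1 - inverse (1 + (\<kappa> * ?S / ?D)\<^sup>2) * ((2 * \<kappa> * ?C * ?D + 2 * (\<kappa> * ?S)\<^sup>2) / ?D\<^sup>2)
      = 1 - (2 * \<kappa> * ?C * ?D + 2 * (\<kappa> * ?S)\<^sup>2) / (1 + 2 * \<kappa> * ?C + \<kappa>\<^sup>2)"
    unfolding inv using d0 by simp
  also have "\<dots> = (1 - \<kappa>\<^sup>2) / (1 + 2 * \<kappa> * ?C + \<kappa>\<^sup>2)"
  proof -
    have "1 + 2 * \<kappa> * ?C + \<kappa>\<^sup>2 - (2 * \<kappa> * ?C * ?D + 2 * (\<kappa> * ?S)\<^sup>2) = 1 - \<kappa>\<^sup>2"
      unfolding power_mult_distrib sc by algebra
    then show ?thesis using E0 by (metis diff_divide_distrib divide_self)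
  qed
  finally show ?thesis
    by (subst scat_smooth_formula[OF k, abs_def])
qed

lemma phi'_antipodal_scattering:
  assumes k: "- 1 < \<kappa>" "\<kappa> < 1"
  shows "phi' \<kappa> p q (antipodal_scattering \<kappa> x) = (- 1) powi p * phi' \<kappa> p (p - q - 1) x"
proof (cases x)
  case (Pair \<beta> \<alpha>)
  have d: "deriv (scat \<kappa>) (- \<alpha>) = deriv (scat \<kappa>) \<alpha>"
    using scat_has_derivative[OF k, of \<alpha>] scat_has_derivative[OF k, of "- \<alpha>"]
    by (simp add: DERIV_imp_deriv)
  have c: "cis (of_int p * pi) = (- 1) powi p"
    by (metis cis_pi cis_power_int)
  have "cis (of_int p * (\<beta> + pi + 2 * scat \<kappa> \<alpha>) + of_int (2 * q + 1) * scat \<kappa> (- \<alpha>))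
      = cis (of_int p * pi + (of_int p * \<beta> + of_int (2 * (p - q - 1) + 1) * scat \<kappa> \<alpha>))"
    by (simp add: scat_uminus[OF k] algebra_simps)
  also have "\<dots> = (- 1) powi p * cis (of_int p * \<beta> + of_int (2 * (p - q - 1) + 1) * scat \<kappa> \<alpha>)"
    by (simp only: cis_mult[symmetric] c)
  finally show ?thesis
    by (simp add: Pair phi'_def antipodal_scattering_def d)
qed

lemma u'_eq:
  assumes "- 1 < \<kappa>" "\<kappa> < 1"
  shows "u' \<kappa> p q = (\<lambda>x. phi' \<kappa> p q x + (- 1) powi p * phi' \<kappa> p (p - q - 1) x)"
  by (simp add: u'_def phi'_antipodal_scattering[OF assms])

lemma v'_eq:
  assumes "- 1 < \<kappa>" "\<kappa> < 1"
  shows "v' \<kappa> p q = (\<lambda>x. phi' \<kappa> p q x - (- 1) powi p * phi' \<kappa> p (p - q - 1) x)"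
  by (simp add: v'_def phi'_antipodal_scattering[OF assms])

end

theory Submission
  imports Defs
begin

text \<open>
  Since exp(2is) is the Blaschke factor (z + \<kappa>)/(1 + \<kappa>z) of z = exp(2i\<alpha>), and \<surd>s' exp(is) is a
  constant multiple of exp(i\<alpha>)/(1 + \<kappa>z), the function phi' p q has only positive odd fibre
  frequencies if q \<ge> 0 and, by conjugation, only negative odd ones if q < 0; so H_minus acts on it
  as \<mp>i. On the other hand phi' p q \<circ> scattering = - (-1)^p phi' p (p - q - 1). Hence v' and u' are
  their own extensions under A_plus and A_minus, and A_minus_adj maps phi' p q to u' p q.
  Completeness comes from the homeomorphism (\<beta>, \<alpha>) \<mapsto> (exp(i\<beta>), exp(2is)) of tori, which turns the
  phi' p q into monomials times phi' 0 0.
\<close>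

text \<open>The operators act on functions, not on classes: \<open>H_minus\<close> is a choice among
  almost-everywhere equal functions, and every identity about it must survive restriction to
  \<open>bdry_plus\<close> and composition with the scattering relations. The device used is a norm
  bound: a bounded linear map sends functions of norm 0 to functions of norm 0. The bounds
  themselves come from Fubini, since both scattering relations rotate \<beta> by an amount depending
  on \<alpha> and then reflect \<alpha>.

  Two difficulties lie outside the computation on basis functions. Boundedness concerns arbitrary
  inputs, whose fibre series are controlled only in norm; this is supplied by Bessel's inequality on
  single fibres, integrated over \<beta>. And the range of both operators must lie in
  \<open>V_plus\<close>, which rests on the oddness of \<open>H_minus\<close> outputs under \<alpha>
  \<mapsto> \<alpha> + pi.

  Completeness on the half range of \<alpha> is possible because 2s already runs through a full
  circle there: apart from one common factor, only powers of exp(2is) occur.\<close>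

type_synonym bfun = "real \<times> real \<Rightarrow> complex"

section \<open>Square-integrable functions over an arbitrary measure\<close>

definition sq_int :: "'a measure \<Rightarrow> ('a \<Rightarrow> complex) \<Rightarrow> bool" where
  "sq_int M f \<longleftrightarrow> f \<in> borel_measurable M \<and> integrable M (\<lambda>x. (norm (f x))\<^sup>2)"

text \<open>Bochner integrals of non-integrable functions default to 0, so this is a seminorm only
  among \<open>sq_int\<close> functions; the triangle inequality and the null criterion carry that
  hypothesis.\<close>

definition l2 :: "'a measure \<Rightarrow> ('a \<Rightarrow> complex) \<Rightarrow> real" where
  "l2 M f = sqrt (LINT x|M. (norm (f x))\<^sup>2)"

lemma sq_int_measurable: "sq_int M f \<Longrightarrow> f \<in> borel_measurable M"
  by (simp add: sq_int_def)

lemma sq_int_integrable: "sq_int M f \<Longrightarrow> integrable M (\<lambda>x. (norm (f x))\<^sup>2)"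
  by (simp add: sq_int_def)

lemma l2_nonneg [simp]: "0 \<le> l2 M f"
  by (simp add: l2_def)

lemma l2_squared: "(l2 M f)\<^sup>2 = (LINT x|M. (norm (f x))\<^sup>2)"
  by (simp add: l2_def)

text \<open>Young's inequality with a free weight t. The choice t = 1 gives integrability of sums,
  and t equal to the ratio of the two norms gives Minkowski's inequality.\<close>

lemma norm_add_sq_le:
  fixes a b :: "'a::real_normed_vector"
  assumes "0 < t"
  shows "(norm (a + b))\<^sup>2 \<le> (1 + t) * (norm a)\<^sup>2 + (1 + 1 / t) * (norm b)\<^sup>2"
proof -
  have "0 \<le> (t * norm a - norm b)\<^sup>2 / t" using assms by simp
  also have "\<dots> = t * (norm a)\<^sup>2 - 2 * norm a * norm b + (norm b)\<^sup>2 / t"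
    using assms unfolding power2_diff add_divide_distrib diff_divide_distrib
    by (simp add: power_mult_distrib) (simp add: power2_eq_square)
  finally have "2 * norm a * norm b \<le> t * (norm a)\<^sup>2 + (norm b)\<^sup>2 / t" by simp
  moreover have "(norm (a + b))\<^sup>2 \<le> (norm a + norm b)\<^sup>2"
    by (intro power_mono norm_triangle_ineq) auto
  ultimately show ?thesis by (simp add: power2_eq_square algebra_simps)
qed

lemma sq_int_add:
  assumes "sq_int M f" "sq_int M g"
  shows "sq_int M (\<lambda>x. f x + g x)"
  unfolding sq_int_def
proof
  note [measurable] = assms[THEN sq_int_measurable]
  show "(\<lambda>x. f x + g x) \<in> borel_measurable M" by measurable
  show "integrable M (\<lambda>x. (norm (f x + g x))\<^sup>2)"
  proof (rule Bochner_Integration.integrable_bound)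
    show "integrable M (\<lambda>x. 2 * (norm (f x))\<^sup>2 + 2 * (norm (g x))\<^sup>2)"
      using assms by (auto simp: sq_int_def)
    show "AE x in M. norm ((norm (f x + g x))\<^sup>2) \<le> norm (2 * (norm (f x))\<^sup>2 + 2 * (norm (g x))\<^sup>2)"
      using norm_add_sq_le[of 1] by (intro AE_I2) simp
  qed measurable
qed

lemma sq_int_cmult: "sq_int M f \<Longrightarrow> sq_int M (\<lambda>x. c * f x)"
  by (auto simp: sq_int_def norm_mult power_mult_distrib)

lemma sq_int_zero [simp]: "sq_int M (\<lambda>x. 0)"
  by (simp add: sq_int_def)

lemma sq_int_uminus: "sq_int M f \<Longrightarrow> sq_int M (\<lambda>x. - f x)"
  using sq_int_cmult[of M f "-1"] by simp

lemma sq_int_diff: "sq_int M f \<Longrightarrow> sq_int M g \<Longrightarrow> sq_int M (\<lambda>x. f x - g x)"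
  using sq_int_add[OF _ sq_int_uminus, of M f g] by simp

lemma sq_int_sum: "(\<And>i. i \<in> I \<Longrightarrow> sq_int M (f i)) \<Longrightarrow> sq_int M (\<lambda>x. \<Sum>i\<in>I. f i x)"
  by (induction I rule: infinite_finite_induct) (auto intro!: sq_int_add)

lemma sq_int_cong_AE:
  assumes "sq_int M f" "g \<in> borel_measurable M" "AE x in M. f x = g x"
  shows "sq_int M g"
  unfolding sq_int_def
proof
  note [measurable] = sq_int_measurable[OF assms(1)] assms(2)
  show "integrable M (\<lambda>x. (norm (g x))\<^sup>2)"
    by (rule integrable_cong_AE_imp[OF sq_int_integrable[OF assms(1)]])
      (use assms(3) in \<open>auto elim: AE_mp\<close>)
qed fact

lemma l2_cong_AE:
  assumes "f \<in> borel_measurable M" "g \<in> borel_measurable M" "AE x in M. f x = g x"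
  shows "l2 M f = l2 M g"
proof -
  note [measurable] = assms(1,2)
  show ?thesis unfolding l2_def
    by (intro arg_cong[where f=sqrt] integral_cong_AE) (use assms(3) in \<open>auto elim: AE_mp\<close>)
qed

lemma l2_cmult: "l2 M (\<lambda>x. c * f x) = norm c * l2 M f"
  by (simp add: l2_def norm_mult power_mult_distrib real_sqrt_mult)

lemma l2_uminus: "l2 M (\<lambda>x. - f x) = l2 M f"
  by (simp add: l2_def)

lemma l2_eq_0_iff:
  assumes "sq_int M f"
  shows "l2 M f = 0 \<longleftrightarrow> (AE x in M. f x = 0)"
  using integral_nonneg_eq_0_iff_AE[OF sq_int_integrable[OF assms]] by (simp add: l2_def)

text \<open>Integrating the weighted pointwise inequality and choosing t = b / a, with a and b the
  two norms, makes the right side exactly (a + b)^2. The quotient requires nonzero norms, so null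
  functions are treated separately.\<close>

lemma l2_triangle:
  assumes "sq_int M f" "sq_int M g"
  shows "l2 M (\<lambda>x. f x + g x) \<le> l2 M f + l2 M g"
proof (cases "l2 M f = 0 \<or> l2 M g = 0")
  case True
  then show ?thesis
  proof
    assume f: "l2 M f = 0"
    then have "AE x in M. f x + g x = g x" using l2_eq_0_iff[OF assms(1)] by simp
    then have "l2 M (\<lambda>x. f x + g x) = l2 M g"
      using assms[THEN sq_int_measurable] by (intro l2_cong_AE) auto
    then show ?thesis by simp
  next
    assume f: "l2 M g = 0"
    then have "AE x in M. f x + g x = f x" using l2_eq_0_iff[OF assms(2)] by simp
    then have "l2 M (\<lambda>x. f x + g x) = l2 M f"
      using assms[THEN sq_int_measurable] by (intro l2_cong_AE) auto
    then show ?thesis by simp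
  qed
next
  case False
  define a b where "a = l2 M f" and "b = l2 M g"
  have ab: "a > 0" "b > 0"
    using False l2_nonneg[of M f] l2_nonneg[of M g] unfolding a_def b_def by linarith+
  define t where "t = b / a"
  have t: "t > 0" using ab by (simp add: t_def)
  have "(l2 M (\<lambda>x. f x + g x))\<^sup>2 \<le> (LINT x|M. (1 + t) * (norm (f x))\<^sup>2 + (1 + 1 / t) * (norm (g x))\<^sup>2)"
    unfolding l2_squared
    by (intro integral_mono norm_add_sq_le t sq_int_integrable sq_int_add assms
        Bochner_Integration.integrable_add integrable_mult_right)
  also have "\<dots> = (1 + t) * a\<^sup>2 + (1 + 1 / t) * b\<^sup>2"
    unfolding a_def b_def l2_squared using assms[THEN sq_int_integrable] by simp
  also have "\<dots> = (a + b)\<^sup>2"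
    using ab unfolding t_def power2_sum by (simp add: distrib_right) (simp add: power2_eq_square)
  finally show ?thesis
    unfolding a_def[symmetric] b_def[symmetric] by (rule power2_le_imp_le) (use ab in simp)
qed

lemma l2_diff_triangle:
  assumes "sq_int M f" "sq_int M g"
  shows "l2 M (\<lambda>x. f x - g x) \<le> l2 M f + l2 M g"
  using l2_triangle[OF assms(1) sq_int_uminus[OF assms(2)]] by (simp add: l2_uminus)

lemma l2_minus_commute: "l2 M (\<lambda>x. f x - g x) = l2 M (\<lambda>x. g x - f x)"
  by (simp add: l2_def norm_minus_commute)

lemma integrable_mult_cnj:
  assumes "sq_int M f" "sq_int M g"
  shows "integrable M (\<lambda>x. f x * cnj (g x))"
proof (rule Bochner_Integration.integrable_bound)
  show "integrable M (\<lambda>x. (norm (f x))\<^sup>2 + (norm (g x))\<^sup>2)"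
    using assms by (auto simp: sq_int_def)
  show "(\<lambda>x. f x * cnj (g x)) \<in> borel_measurable M"
    using assms[THEN sq_int_measurable]
    by (auto intro!: borel_measurable_times borel_measurable_continuous_on[of cnj] continuous_intros)
  show "AE x in M. norm (f x * cnj (g x)) \<le> norm ((norm (f x))\<^sup>2 + (norm (g x))\<^sup>2)"
  proof (intro AE_I2)
    fix x
    have "0 \<le> (norm (f x) - norm (g x))\<^sup>2 + (norm (f x))\<^sup>2 + (norm (g x))\<^sup>2" by simp
    then have "2 * (norm (f x) * norm (g x)) \<le> 2 * ((norm (f x))\<^sup>2 + (norm (g x))\<^sup>2)"
      unfolding power2_eq_square by (simp add: algebra_simps)
    then show "norm (f x * cnj (g x)) \<le> norm ((norm (f x))\<^sup>2 + (norm (g x))\<^sup>2)"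
      by (simp add: norm_mult)
  qed
qed

lemma nn_integral_norm_sq:
  assumes "sq_int M f"
  shows "(\<integral>\<^sup>+x. ennreal ((norm (f x))\<^sup>2) \<partial>M) = ennreal ((l2 M f)\<^sup>2)"
  unfolding l2_squared by (rule nn_integral_eq_integral[OF sq_int_integrable[OF assms]]) simp

text \<open>The usual way into \<open>sq_int\<close>: a bound on a nonnegative integral, which can
  be computed without knowing integrability, yields membership and the norm bound together.\<close>

lemma sq_int_I_nn_integral:
  assumes "f \<in> borel_measurable M" "(\<integral>\<^sup>+x. ennreal ((norm (f x))\<^sup>2) \<partial>M) \<le> ennreal (c\<^sup>2)" "0 \<le> c"
  shows "sq_int M f" "l2 M f \<le> c"
proof -
  note [measurable] = assms(1)
  show f: "sq_int M f"
    unfolding sq_int_def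
    by (intro conjI assms(1) integrableI_bounded) (use assms(2) in \<open>auto simp: le_less_trans\<close>)
  have "(l2 M f)\<^sup>2 \<le> c\<^sup>2"
    using assms(2) unfolding nn_integral_norm_sq[OF f] by (simp add: ennreal_le_iff)
  then show "l2 M f \<le> c" using assms(3) by (rule power2_le_imp_le)
qed

lemma sq_int_bounded:
  assumes "finite_measure M" "f \<in> borel_measurable M" "\<And>x. x \<in> space M \<Longrightarrow> norm (f x) \<le> C"
  shows "sq_int M f" "0 \<le> C \<Longrightarrow> l2 M f \<le> C * sqrt (measure M (space M))"
proof -
  interpret finite_measure M by fact
  note [measurable] = assms(2)
  have sq: "(norm (f x))\<^sup>2 \<le> C\<^sup>2" if "x \<in> space M" for x
    using assms(3)[OF that] by (intro power_mono) auto
  show f: "sq_int M f"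
    unfolding sq_int_def
    by (intro conjI assms(2) integrable_const_bound[where B="C\<^sup>2"]) (use sq in auto)
  assume C: "0 \<le> C"
  have "(LINT x|M. (norm (f x))\<^sup>2) \<le> (LINT x|M. C\<^sup>2)"
    using sq by (intro integral_mono sq_int_integrable[OF f]) auto
  also have "\<dots> = (C * sqrt (measure M (space M)))\<^sup>2"
    by (simp add: power_mult_distrib)
  finally show "l2 M f \<le> C * sqrt (measure M (space M))"
    using C unfolding l2_def by (intro real_le_lsqrt) auto
qed

text \<open>The squared increments have integrals at most 4^(-n), so they stay summable after
  multiplication by 2^n. Almost everywhere the weighted sum is finite, which forces increments of
  order 2^(-n/2) and hence an absolutely convergent telescoping series.\<close>

lemma AE_convergent_if_summable_l2:
  fixes f :: "nat \<Rightarrow> 'a \<Rightarrow> complex"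
  assumes f: "\<And>n. sq_int M (f n)" and d: "\<And>n. l2 M (\<lambda>x. f (Suc n) x - f n x) \<le> (1 / 2) ^ n"
  shows "AE x in M. convergent (\<lambda>n. f n x)"
proof -
  have [measurable]: "f n \<in> borel_measurable M" for n using f by (rule sq_int_measurable)
  define g where "g n x = 2 ^ n * (norm (f (Suc n) x - f n x))\<^sup>2" for n x
  have [measurable]: "g n \<in> borel_measurable M" for n unfolding g_def by measurable
  have dd: "sq_int M (\<lambda>x. f (Suc n) x - f n x)" for n by (intro sq_int_diff f)
  have "(\<integral>\<^sup>+x. ennreal (g n x) \<partial>M) = 2 ^ n * ennreal ((l2 M (\<lambda>x. f (Suc n) x - f n x))\<^sup>2)" for n
  proof -
    have "(\<integral>\<^sup>+x. ennreal (g n x) \<partial>M) = (\<integral>\<^sup>+x. 2 ^ n * ennreal ((norm (f (Suc n) x - f n x))\<^sup>2) \<partial>M)"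
      unfolding g_def by (simp add: ennreal_mult ennreal_power[symmetric])
    also have "\<dots> = 2 ^ n * (\<integral>\<^sup>+x. ennreal ((norm (f (Suc n) x - f n x))\<^sup>2) \<partial>M)"
      by (rule nn_integral_cmult) measurable
    finally show ?thesis by (simp add: nn_integral_norm_sq[OF dd])
  qed
  also have "2 ^ n * ennreal ((l2 M (\<lambda>x. f (Suc n) x - f n x))\<^sup>2) \<le> ennreal ((1 / 2) ^ n)" for n
  proof -
    have "2 ^ n * ennreal ((l2 M (\<lambda>x. f (Suc n) x - f n x))\<^sup>2)
        = ennreal (2 ^ n * (l2 M (\<lambda>x. f (Suc n) x - f n x))\<^sup>2)"
      by (simp add: ennreal_mult ennreal_power[symmetric])
    also have "\<dots> \<le> ennreal (2 ^ n * ((1 / 2) ^ n)\<^sup>2)"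
      by (intro ennreal_leI mult_left_mono power_mono d) auto
    also have "(2 ^ n * ((1 / 2) ^ n)\<^sup>2 :: real) = (1 / 2) ^ n"
      by (simp add: power2_eq_square power_divide)
    finally show ?thesis .
  qed
  finally have gn: "(\<integral>\<^sup>+x. ennreal (g n x) \<partial>M) \<le> ennreal ((1 / 2) ^ n)" for n .
  have "(\<integral>\<^sup>+x. (\<Sum>n. ennreal (g n x)) \<partial>M) = (\<Sum>n. \<integral>\<^sup>+x. ennreal (g n x) \<partial>M)"
    by (intro nn_integral_suminf) measurable
  also have "\<dots> \<le> (\<Sum>n. ennreal ((1 / 2) ^ n))" by (intro suminf_le gn) auto
  also have "\<dots> = ennreal (\<Sum>n. (1 / 2) ^ n)"
    by (intro suminf_ennreal2) (auto intro: summable_geometric)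
  also have "\<dots> < \<infinity>" by simp
  finally have "(\<integral>\<^sup>+x. (\<Sum>n. ennreal (g n x)) \<partial>M) \<noteq> \<infinity>" by simp
  then have "AE x in M. (\<Sum>n. ennreal (g n x)) \<noteq> \<infinity>"
    by (intro nn_integral_PInf_AE) measurable
  then show ?thesis
  proof (rule AE_mp, intro AE_I2 impI)
    fix x assume fin: "(\<Sum>n. ennreal (g n x)) \<noteq> \<infinity>"
    define C where "C = enn2real (\<Sum>n. ennreal (g n x))"
    have C: "(\<Sum>n. ennreal (g n x)) = ennreal C"
      using fin by (simp add: C_def top.not_eq_extremum)
    have "g n x \<le> C" for n
    proof -
      have "ennreal (g n x) \<le> (\<Sum>n. ennreal (g n x))"
        using sum_le_suminf[of "\<lambda>n. ennreal (g n x)" "{n}"] by simp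
      then show ?thesis unfolding C by (simp add: C_def)
    qed
    then have "(norm (f (Suc n) x - f n x))\<^sup>2 \<le> C * (1 / 2) ^ n" for n
      unfolding g_def by (simp add: power_divide field_simps)
    then have "norm (f (Suc n) x - f n x) \<le> sqrt (C * (1 / 2) ^ n)" for n
      by (rule real_le_rsqrt)
    then have le: "norm (f (Suc n) x - f n x) \<le> sqrt C * (sqrt (1 / 2)) ^ n" for n
      by (simp add: real_sqrt_mult real_sqrt_power)
    have "summable (\<lambda>n. sqrt C * (sqrt (1 / 2)) ^ n)"
      by (intro summable_mult summable_geometric) simp
    then have "summable (\<lambda>n. f (Suc n) x - f n x)"
      by (rule summable_comparison_test') (use le in auto)
    then have "convergent (\<lambda>n. \<Sum>k<n. f (Suc k) x - f k x)"
      by (simp add: summable_iff_convergent)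
    moreover have "(\<Sum>k<n. f (Suc k) x - f k x) = f n x - f 0 x" for n
      by (induction n) auto
    ultimately have "convergent (\<lambda>n. f n x - f 0 x)" by simp
    then show "convergent (\<lambda>n. f n x)"
      using convergent_add[OF _ convergent_const[of "f 0 x"], of "\<lambda>n. f n x - f 0 x"] by simp
  qed
qed

text \<open>
  The limit is given as a pointwise limit, so that it inherits the symmetries of the sequence
  (periodicity, oddness) everywhere and not just almost everywhere.
\<close>

lemma l2_complete:
  fixes f :: "nat \<Rightarrow> 'a \<Rightarrow> complex"
  assumes f: "\<And>n. sq_int M (f n)"
    and cauchy: "\<And>e. e > 0 \<Longrightarrow> \<exists>N. \<forall>m\<ge>N. \<forall>n\<ge>N. l2 M (\<lambda>x. f m x - f n x) \<le> e"
  obtains r :: "nat \<Rightarrow> nat" and w where "sq_int M w" "(\<lambda>n. l2 M (\<lambda>x. w x - f n x)) \<longlonglongrightarrow> 0"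
    "w = (\<lambda>x. if convergent (\<lambda>n. f (r n) x) then lim (\<lambda>n. f (r n) x) else 0)"
proof -
  have [measurable]: "f n \<in> borel_measurable M" for n using f by (rule sq_int_measurable)
  have "\<exists>N. \<forall>m\<ge>N. \<forall>n\<ge>N. l2 M (\<lambda>x. f m x - f n x) \<le> (1 / 2) ^ k" for k
    by (rule cauchy) simp
  then obtain K where K: "\<And>k m n. m \<ge> K k \<Longrightarrow> n \<ge> K k \<Longrightarrow> l2 M (\<lambda>x. f m x - f n x) \<le> (1 / 2) ^ k"
    by metis
  \<comment> \<open>Summing the thresholds gives indices that are nondecreasing and still at least
    \<open>K n\<close>.\<close>
  define r where "r n = (\<Sum>k\<le>n. K k)" for n
  have r_ge: "r n \<ge> K n" and r_Suc: "r (Suc n) \<ge> r n" for n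
    by (auto simp: r_def intro: member_le_sum)
  have AEc: "AE x in M. convergent (\<lambda>n. f (r n) x)"
  proof (rule AE_convergent_if_summable_l2[OF f])
    show "l2 M (\<lambda>x. f (r (Suc n)) x - f (r n) x) \<le> (1 / 2) ^ n" for n
      using order_trans[OF r_ge[of n] r_Suc[of n]] r_ge[of n] by (rule K)
  qed
  define w where "w = (\<lambda>x. if convergent (\<lambda>n. f (r n) x) then lim (\<lambda>n. f (r n) x) else 0)"
  have [measurable]: "w \<in> borel_measurable M"
    unfolding w_def Cauchy_convergent_iff[symmetric] by measurable
  have w: "AE x in M. (\<lambda>n. f (r n) x) \<longlonglongrightarrow> w x"
    using AEc by (rule AE_mp) (auto simp: w_def convergent_LIMSEQ_iff intro!: AE_I2)
  \<comment> \<open>Fatou's lemma passes the Cauchy estimate along the subsequence to the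
    limit.\<close>
  have bound: "(\<integral>\<^sup>+x. ennreal ((norm (w x - f n x))\<^sup>2) \<partial>M) \<le> ennreal (((1 / 2) ^ k)\<^sup>2)"
    if n: "n \<ge> K k" for n k
  proof -
    have "(\<integral>\<^sup>+x. ennreal ((norm (w x - f n x))\<^sup>2) \<partial>M)
        = (\<integral>\<^sup>+x. liminf (\<lambda>m. ennreal ((norm (f (r m) x - f n x))\<^sup>2)) \<partial>M)"
    proof (rule nn_integral_cong_AE, use w in eventually_elim)
      case (elim x)
      have "(\<lambda>m. ennreal ((norm (f (r m) x - f n x))\<^sup>2)) \<longlonglongrightarrow> ennreal ((norm (w x - f n x))\<^sup>2)"
        using elim by (intro tendsto_intros tendsto_ennrealI)
      then show ?case by (intro lim_imp_Liminf[symmetric]) simp_all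
    qed
    also have "\<dots> \<le> liminf (\<lambda>m. \<integral>\<^sup>+x. ennreal ((norm (f (r m) x - f n x))\<^sup>2) \<partial>M)"
      by (rule nn_integral_liminf) measurable
    also have "\<dots> \<le> ennreal (((1 / 2) ^ k)\<^sup>2)"
    proof (rule Liminf_le, simp, unfold eventually_sequentially, intro exI allI impI)
      fix m assume m: "k \<le> m"
      have "r m \<ge> r k" using lift_Suc_mono_le[of r k m] r_Suc m by auto
      then have "r m \<ge> K k" using r_ge[of k] by simp
      then have "l2 M (\<lambda>x. f (r m) x - f n x) \<le> (1 / 2) ^ k" using n by (rule K)
      then show "(\<integral>\<^sup>+x. ennreal ((norm (f (r m) x - f n x))\<^sup>2) \<partial>M) \<le> ennreal (((1 / 2) ^ k)\<^sup>2)"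
        unfolding nn_integral_norm_sq[OF sq_int_diff[OF f f]]
        by (intro ennreal_leI power_mono) auto
    qed
    finally show ?thesis .
  qed
  have m: "(\<lambda>x. w x - f n x) \<in> borel_measurable M" for n by measurable
  note b2 = sq_int_I_nn_integral[OF m bound]
  have "sq_int M (\<lambda>x. (w x - f (K 0) x) + f (K 0) x)"
    by (intro sq_int_add b2(1) f) auto
  then have wi: "sq_int M w" by simp
  have "(\<lambda>n. l2 M (\<lambda>x. w x - f n x)) \<longlonglongrightarrow> 0"
  proof (rule LIMSEQ_I)
    fix e :: real assume "e > 0"
    then obtain k where k: "(1 / 2 :: real) ^ k < e"
      using real_arch_pow_inv[of e "1 / 2"] by auto
    then have "norm (l2 M (\<lambda>x. w x - f n x) - 0) < e" if "n \<ge> K k" for n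
      using b2(2)[OF that] by simp
    then show "\<exists>no. \<forall>n\<ge>no. norm (l2 M (\<lambda>x. w x - f n x) - 0) < e" by blast
  qed
  with wi show thesis by (rule that) (rule w_def)
qed

section \<open>The boundary measure on the fundamental domain\<close>

abbreviation lift :: "(real \<times> real) set \<Rightarrow> (real \<times> real) set" where
  "lift A \<equiv> A \<inter> fundamental_domain"

lemma lift_bdry: "lift bdry = {0..<2 * pi} \<times> {- pi / 2..<3 * pi / 2}"
  by (simp add: bdry_def fundamental_domain_def)

lemma lift_bdry_plus: "lift bdry_plus = {0..<2 * pi} \<times> {- pi / 2..pi / 2}"
proof -
  have "0 \<le> cos \<alpha> \<longleftrightarrow> \<alpha> \<le> pi / 2" if "- pi / 2 \<le> \<alpha>" "\<alpha> < 3 * pi / 2" for \<alpha>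
  proof
    assume c: "0 \<le> cos \<alpha>"
    show "\<alpha> \<le> pi / 2"
    proof (rule ccontr)
      assume "\<not> \<alpha> \<le> pi / 2"
      then have "cos (\<alpha> - pi) > 0" using that by (intro cos_gt_zero_pi) auto
      then show False using c by simp
    qed
  qed (use that in \<open>auto intro: cos_ge_zero\<close>)
  then show ?thesis
    using pi_gt_zero by (auto simp: bdry_plus_iff_cos fundamental_domain_def)
qed

lemma borel_fd [measurable]: "fundamental_domain \<in> sets borel"
  unfolding fundamental_domain_def borel_prod[symmetric] by measurable

lemma borel_bdry [measurable]: "bdry \<in> sets borel"
  by (simp add: bdry_def)

lemma borel_bdry_plus [measurable]: "bdry_plus \<in> sets borel"
proof -
  have "bdry_plus = {x. 0 \<le> cos (snd x)}" using bdry_plus_iff_cos by auto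
  also have "\<dots> \<in> sets borel"
    by (intro borel_closed closed_Collect_le continuous_intros)
  finally show ?thesis .
qed

lemma space_dSigma [simp]: "space (dSigma \<kappa> A) = lift A"
  by (simp add: dSigma_def space_restrict_space)

lemma measurable_dSigma_iff:
  assumes [measurable]: "A \<in> sets borel"
  shows "(f :: _ \<Rightarrow> complex) \<in> borel_measurable (dSigma \<kappa> A) \<longleftrightarrow>
    (\<lambda>x. if x \<in> lift A then f x else 0) \<in> borel_measurable borel"
proof -
  have "f \<in> borel_measurable (dSigma \<kappa> A) \<longleftrightarrow>
      f \<in> borel_measurable (restrict_space lborel (lift A))"
    by (simp add: dSigma_def cong: measurable_cong_sets)
  also have "\<dots> \<longleftrightarrow> (\<lambda>x. if x \<in> lift A then f x else 0) \<in> borel_measurable lborel"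
    by (rule measurable_restrict_space_iff) auto
  finally show ?thesis by simp
qed

lemma borel_imp_measurable_dSigma:
  assumes "f \<in> borel_measurable borel"
  shows "f \<in> borel_measurable (dSigma \<kappa> A)"
proof -
  have "f \<in> borel_measurable (restrict_space lborel (lift A))"
    by (rule measurable_restrict_space1) (use assms in simp)
  then show ?thesis by (simp add: dSigma_def)
qed

lemma nn_integral_dSigma:
  assumes [measurable]: "A \<in> sets borel" "g \<in> borel_measurable borel"
  shows "(\<integral>\<^sup>+x. g x \<partial>dSigma \<kappa> A) = ennreal (1 / (1 + \<kappa>)) * (\<integral>\<^sup>+x\<in>lift A. g x \<partial>lborel)"
proof -
  have [measurable]: "g \<in> borel_measurable (restrict_space lborel (lift A))"
    by (rule measurable_restrict_space1) simp
  have "(\<integral>\<^sup>+x. g x \<partial>dSigma \<kappa> A)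
      = (\<integral>\<^sup>+x. ennreal (1 / (1 + \<kappa>)) * g x \<partial>restrict_space lborel (lift A))"
    unfolding dSigma_def by (rule nn_integral_density) auto
  also have "\<dots> = ennreal (1 / (1 + \<kappa>)) * (\<integral>\<^sup>+x. g x \<partial>restrict_space lborel (lift A))"
    by (rule nn_integral_cmult) auto
  also have "(\<integral>\<^sup>+x. g x \<partial>restrict_space lborel (lift A))
      = (\<integral>\<^sup>+x\<in>lift A. g x \<partial>lborel)"
    by (rule nn_integral_restrict_space) simp
  finally show ?thesis .
qed

lemma AE_dSigma:
  assumes "-1 < \<kappa>" and [measurable]: "A \<in> sets borel"
  shows "(AE x in dSigma \<kappa> A. P x) \<longleftrightarrow> (AE x in lborel. x \<in> lift A \<longrightarrow> P x)"
proof -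
  have "(AE x in dSigma \<kappa> A. P x) \<longleftrightarrow> (AE x in restrict_space lborel (lift A). P x)"
    unfolding dSigma_def using assms(1) by (subst AE_density) auto
  also have "\<dots> \<longleftrightarrow> (AE x in lborel. x \<in> lift A \<longrightarrow> P x)"
    by (rule AE_restrict_space_iff) simp
  finally show ?thesis .
qed

text \<open>The squared norm without the constant density, as a nonnegative integral, so that
  domains can be moved and split with no integrability conditions.\<close>

abbreviation energy :: "(real \<times> real) set \<Rightarrow> bfun \<Rightarrow> ennreal" where
  "energy D f \<equiv> (\<integral>\<^sup>+x\<in>D. ennreal ((norm (f x))\<^sup>2) \<partial>lborel)"

lemma energy_dSigma:
  assumes "-1 < \<kappa>" and [measurable]: "A \<in> sets borel" "f \<in> borel_measurable borel"
  shows "energy (lift A) f = ennreal (1 + \<kappa>) * (\<integral>\<^sup>+x. ennreal ((norm (f x))\<^sup>2) \<partial>dSigma \<kappa> A)"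
proof -
  have "ennreal (1 + \<kappa>) * ennreal (1 / (1 + \<kappa>)) = 1"
    using assms(1) by (simp add: ennreal_mult[symmetric])
  then show ?thesis by (simp add: nn_integral_dSigma mult.assoc[symmetric])
qed

lemma emeasure_fd: "emeasure lborel fundamental_domain = ennreal (4 * pi\<^sup>2)"
proof -
  have "emeasure lborel fundamental_domain
      = emeasure lborel {0..<2 * pi} * emeasure lborel {- pi / 2..<3 * pi / 2}"
    unfolding fundamental_domain_def lborel_prod[symmetric]
    by (rule lborel.emeasure_pair_measure_Times) auto
  also have "\<dots> = ennreal (2 * pi) * ennreal (2 * pi)" by simp
  finally show ?thesis by (simp add: ennreal_mult[symmetric] power2_eq_square)
qed

lemma finite_measure_dSigma:
  assumes [measurable]: "A \<in> sets borel"
  shows "finite_measure (dSigma \<kappa> A)"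
proof
  have "emeasure (dSigma \<kappa> A) (space (dSigma \<kappa> A)) = (\<integral>\<^sup>+x. 1 \<partial>dSigma \<kappa> A)" by simp
  also have "\<dots> = ennreal (1 / (1 + \<kappa>)) * emeasure lborel (lift A)"
    by (subst nn_integral_dSigma) auto
  also have "\<dots> \<le> ennreal (1 / (1 + \<kappa>)) * emeasure lborel fundamental_domain"
    by (intro mult_left_mono emeasure_mono) auto
  also have "\<dots> < \<infinity>" by (simp add: emeasure_fd ennreal_mult_less_top)
  finally show "emeasure (dSigma \<kappa> A) (space (dSigma \<kappa> A)) \<noteq> \<infinity>" by simp
qed

subsection \<open>Periodic functions\<close>

lemma bdry_plus_shift_iff:
  "(\<beta> + 2 * pi * of_int m, \<alpha> + 2 * pi * of_int n) \<in> bdry_plus \<longleftrightarrow> (\<beta>, \<alpha>) \<in> bdry_plus"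
  by (simp add: bdry_plus_iff_cos cos_add cos_int_2pin sin_int_2pin)

text \<open>Characterizes the full preimages of subsets of the torus.\<close>

definition shift_closed :: "(real \<times> real) set \<Rightarrow> bool" where
  "shift_closed A \<longleftrightarrow> (\<forall>\<beta> \<alpha>. \<forall>m n :: int.
     (\<beta> + 2 * pi * of_int m, \<alpha> + 2 * pi * of_int n) \<in> A \<longleftrightarrow> (\<beta>, \<alpha>) \<in> A)"

lemma shift_closed_bdry [simp]: "shift_closed bdry"
  by (simp add: shift_closed_def bdry_def)

lemma shift_closed_bdry_plus [simp]: "shift_closed bdry_plus"
  by (simp add: shift_closed_def bdry_plus_shift_iff)

text \<open>\<open>periodic_on\<close> speaks of single forward steps starting at points of A.
  Invariance of A under shifts allows the steps to be chained and reversed.\<close>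

lemma periodic_on_shift:
  assumes "periodic_on A u" "shift_closed A" "(\<beta>, \<alpha>) \<in> A"
  shows "u (\<beta> + 2 * pi * of_int m, \<alpha> + 2 * pi * of_int n) = u (\<beta>, \<alpha>)"
proof -
  have A: "(\<beta> + 2 * pi * of_int m, \<alpha> + 2 * pi * of_int n) \<in> A" for m n
    using assms(2,3) by (simp add: shift_closed_def)
  have s1: "u (\<beta> + 2 * pi * of_int (m + 1), \<alpha> + 2 * pi * of_int n)
      = u (\<beta> + 2 * pi * of_int m, \<alpha> + 2 * pi * of_int n)" for m n
    using assms(1) A[of m n] by (auto simp: periodic_on_def algebra_simps dest!: bspec)
  have s2: "u (\<beta> + 2 * pi * of_int m, \<alpha> + 2 * pi * of_int (n + 1))
      = u (\<beta> + 2 * pi * of_int m, \<alpha> + 2 * pi * of_int n)" for m n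
    using assms(1) A[of m n] by (auto simp: periodic_on_def algebra_simps dest!: bspec)
  have "u (\<beta> + 2 * pi * of_int m, \<alpha> + 2 * pi * of_int n) = u (\<beta>, \<alpha> + 2 * pi * of_int n)"
  proof (induction m rule: int_induct[where k=0])
    case (step1 i) then show ?case by (simp only: s1)
  next
    case (step2 i) then show ?case using s1[of "i - 1" n] by simp
  qed simp
  also have "\<dots> = u (\<beta>, \<alpha>)"
  proof (induction n rule: int_induct[where k=0])
    case (step1 i) then show ?case using s2[of 0 i] by simp
  next
    case (step2 i) then show ?case using s2[of 0 "i - 1"] by simp
  qed simp
  finally show ?thesis .
qed

text \<open>Moves a point to its representative in the fundamental domain; the offset pi / 2 is
  there because the window for \<alpha> starts at - pi / 2.\<close>

definition wrap :: "real \<times> real \<Rightarrow> real \<times> real" where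
  "wrap = (\<lambda>(\<beta>, \<alpha>). (\<beta> - 2 * pi * of_int \<lfloor>\<beta> / (2 * pi)\<rfloor>,
      \<alpha> - 2 * pi * of_int \<lfloor>(\<alpha> + pi / 2) / (2 * pi)\<rfloor>))"

lemma wrap_measurable [measurable]: "wrap \<in> borel_measurable borel"
  unfolding wrap_def borel_prod[symmetric] by measurable

lemma wrap_in_fd: "wrap x \<in> fundamental_domain"
proof (cases x)
  case (Pair \<beta> \<alpha>)
  have *: "2 * pi * of_int \<lfloor>t / (2 * pi)\<rfloor> \<le> t" "t < 2 * pi * of_int \<lfloor>t / (2 * pi)\<rfloor> + 2 * pi" for t
    using floor_divide_lower[of "2 * pi" t] floor_divide_upper[of "2 * pi" t] pi_gt_zero
    by (auto simp: algebra_simps)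
  show ?thesis
    using *[of \<beta>] *[of "\<alpha> + pi / 2"] by (auto simp: Pair wrap_def fundamental_domain_def)
qed

lemma wrap_shift:
  "\<exists>m n :: int. wrap x = (fst x + 2 * pi * of_int m, snd x + 2 * pi * of_int n)"
  by (rule exI[of _ "- \<lfloor>fst x / (2 * pi)\<rfloor>"], rule exI[of _ "- \<lfloor>(snd x + pi / 2) / (2 * pi)\<rfloor>"])
     (simp add: wrap_def split_beta)

lemma wrap_mem_iff: "shift_closed A \<Longrightarrow> wrap x \<in> A \<longleftrightarrow> x \<in> A"
  using wrap_shift[of x] by (cases x) (auto simp: shift_closed_def)

lemma periodic_on_wrap: "periodic_on A u \<Longrightarrow> shift_closed A \<Longrightarrow> x \<in> A \<Longrightarrow> u (wrap x) = u x"
  using wrap_shift[of x] periodic_on_shift[of A u "fst x" "snd x"] by auto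

text \<open>Measurability for \<open>dSigma\<close> only sees the fundamental domain. Composition
  with the Borel map \<open>wrap\<close> spreads it to all lifts, which is what makes composition
  with the scattering relations measurable.\<close>

lemma periodic_on_borel:
  assumes "periodic_on A u" "shift_closed A" "A \<in> sets borel" "u \<in> borel_measurable (dSigma \<kappa> A)"
  shows "(\<lambda>x. if x \<in> A then u x else 0) \<in> borel_measurable borel"
proof -
  have "(\<lambda>x. if x \<in> lift A then u x else 0) \<circ> wrap \<in> borel_measurable borel"
    using assms(3,4) by (intro measurable_comp[OF wrap_measurable]) (simp add: measurable_dSigma_iff)
  also have "(\<lambda>x. if x \<in> lift A then u x else 0) \<circ> wrap = (\<lambda>x. if x \<in> A then u x else 0)"
    using wrap_in_fd wrap_mem_iff[OF assms(2)] periodic_on_wrap[OF assms(1,2)] by (auto simp: fun_eq_iff)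
  finally show ?thesis .
qed

subsection \<open>Invariance of Lebesgue measure\<close>

lemma nn_integral_shift_set:
  fixes h :: "real \<Rightarrow> ennreal"
  assumes [measurable]: "h \<in> borel_measurable borel"
  shows "(\<integral>\<^sup>+x\<in>{a..<b}. h (x + c) \<partial>lborel) = (\<integral>\<^sup>+x\<in>{a + c..<b + c}. h x \<partial>lborel)"
proof -
  have "(\<integral>\<^sup>+x\<in>{a + c..<b + c}. h x \<partial>lborel)
      = (\<integral>\<^sup>+x. h (c + 1 * x) * indicator {a + c..<b + c} (c + 1 * x) \<partial>lborel)"
    using nn_integral_real_affine[of "\<lambda>x. h x * indicator {a + c..<b + c} x" 1 c] by simp
  also have "\<dots> = (\<integral>\<^sup>+x\<in>{a..<b}. h (x + c) \<partial>lborel)"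
    by (intro nn_integral_cong) (auto simp: indicator_def add.commute)
  finally show ?thesis by simp
qed

lemma nn_integral_split:
  fixes h :: "real \<Rightarrow> ennreal"
  assumes [measurable]: "h \<in> borel_measurable borel" and "a \<le> b" "b \<le> c"
  shows "(\<integral>\<^sup>+x\<in>{a..<c}. h x \<partial>lborel) = (\<integral>\<^sup>+x\<in>{a..<b}. h x \<partial>lborel) + (\<integral>\<^sup>+x\<in>{b..<c}. h x \<partial>lborel)"
proof -
  have "(\<integral>\<^sup>+x\<in>{a..<c}. h x \<partial>lborel)
      = (\<integral>\<^sup>+x. h x * indicator {a..<b} x + h x * indicator {b..<c} x \<partial>lborel)"
    using assms(2,3) by (intro nn_integral_cong) (auto simp: indicator_def)
  then show ?thesis by (simp add: nn_integral_add)
qed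

text \<open>After reducing c modulo T to lie between 0 and T, the piece that overhangs the interval
  is moved back by one period.\<close>

lemma nn_integral_periodic:
  fixes h :: "real \<Rightarrow> ennreal"
  assumes [measurable]: "h \<in> borel_measurable borel" and per: "\<And>x. h (x + T) = h x" and T: "T > 0"
  shows "(\<integral>\<^sup>+x\<in>{a..<a + T}. h (x + c) \<partial>lborel) = (\<integral>\<^sup>+x\<in>{a..<a + T}. h x \<partial>lborel)"
proof -
  have perk: "h (x + of_int k * T) = h x" for x and k :: int
  proof (induction k rule: int_induct[where k=0])
    case (step1 i) then show ?case using per[of "x + of_int i * T"] by (simp add: algebra_simps)
  next
    case (step2 i) then show ?case using per[of "x + of_int (i - 1) * T"] by (simp add: algebra_simps)
  qed simp
  define c' where "c' = c - of_int \<lfloor>c / T\<rfloor> * T"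
  have c': "0 \<le> c'" "c' \<le> T"
    using T floor_divide_lower[of T c] floor_divide_upper[of T c] by (auto simp: c'_def algebra_simps)
  have "h (x + c) = h (x + c')" for x
    using perk[of "x + c'" "\<lfloor>c / T\<rfloor>"] by (simp add: c'_def)
  then have "(\<integral>\<^sup>+x\<in>{a..<a + T}. h (x + c) \<partial>lborel) = (\<integral>\<^sup>+x\<in>{a + c'..<(a + T) + c'}. h x \<partial>lborel)"
    by (simp add: nn_integral_shift_set)
  also have "\<dots> = (\<integral>\<^sup>+x\<in>{a + c'..<a + T}. h x \<partial>lborel) + (\<integral>\<^sup>+x\<in>{a + T..<(a + T) + c'}. h x \<partial>lborel)"
    using c' by (intro nn_integral_split) auto
  also have "(\<integral>\<^sup>+x\<in>{a + T..<(a + T) + c'}. h x \<partial>lborel) = (\<integral>\<^sup>+x\<in>{a..<a + c'}. h (x + T) \<partial>lborel)"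
    by (simp add: nn_integral_shift_set add_ac)
  also have "\<dots> = (\<integral>\<^sup>+x\<in>{a..<a + c'}. h x \<partial>lborel)" by (simp add: per)
  also have "(\<integral>\<^sup>+x\<in>{a + c'..<a + T}. h x \<partial>lborel) + \<dots> = (\<integral>\<^sup>+x\<in>{a..<a + T}. h x \<partial>lborel)"
    using c' by (subst nn_integral_split[of h a "a + c'" "a + T"]) (auto simp: add.commute)
  finally show ?thesis .
qed

lemma nn_integral_Times_fst:
  fixes F :: "real \<times> real \<Rightarrow> ennreal"
  assumes [measurable]: "F \<in> borel_measurable borel" "X \<in> sets borel" "Y \<in> sets borel"
  shows "(\<integral>\<^sup>+x\<in>X \<times> Y. F x \<partial>lborel) = (\<integral>\<^sup>+\<beta>\<in>X. (\<integral>\<^sup>+\<alpha>\<in>Y. F (\<beta>, \<alpha>) \<partial>lborel) \<partial>lborel)"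
proof -
  have [measurable]: "F \<in> borel_measurable (lborel \<Otimes>\<^sub>M lborel)"
    by (simp add: lborel_prod)
  have "(\<integral>\<^sup>+x\<in>X \<times> Y. F x \<partial>lborel) = (\<integral>\<^sup>+x. F x * indicator (X \<times> Y) x \<partial>(lborel \<Otimes>\<^sub>M lborel))"
    by (simp add: lborel_prod)
  also have "\<dots> = (\<integral>\<^sup>+\<beta>. (\<integral>\<^sup>+\<alpha>. F (\<beta>, \<alpha>) * indicator (X \<times> Y) (\<beta>, \<alpha>) \<partial>lborel) \<partial>lborel)"
    by (rule lborel.nn_integral_fst[symmetric]) measurable
  also have "\<dots> = (\<integral>\<^sup>+\<beta>\<in>X. (\<integral>\<^sup>+\<alpha>\<in>Y. F (\<beta>, \<alpha>) \<partial>lborel) \<partial>lborel)"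
    by (intro nn_integral_cong) (auto simp: indicator_times indicator_def)
  finally show ?thesis .
qed

lemma nn_integral_Times_snd:
  fixes F :: "real \<times> real \<Rightarrow> ennreal"
  assumes [measurable]: "F \<in> borel_measurable borel" "X \<in> sets borel" "Y \<in> sets borel"
  shows "(\<integral>\<^sup>+x\<in>X \<times> Y. F x \<partial>lborel) = (\<integral>\<^sup>+\<alpha>\<in>Y. (\<integral>\<^sup>+\<beta>\<in>X. F (\<beta>, \<alpha>) \<partial>lborel) \<partial>lborel)"
proof -
  have [measurable]: "F \<in> borel_measurable (borel \<Otimes>\<^sub>M borel)" by (simp add: borel_prod)
  have "(\<integral>\<^sup>+\<beta>\<in>X. (\<integral>\<^sup>+\<alpha>\<in>Y. F (\<beta>, \<alpha>) \<partial>lborel) \<partial>lborel)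
      = (\<integral>\<^sup>+\<beta>. (\<integral>\<^sup>+\<alpha>. F (\<beta>, \<alpha>) * indicator X \<beta> * indicator Y \<alpha> \<partial>lborel) \<partial>lborel)"
    by (subst nn_integral_multc[symmetric]) (auto simp: mult_ac)
  also have "\<dots> = (\<integral>\<^sup>+\<alpha>. (\<integral>\<^sup>+\<beta>. F (\<beta>, \<alpha>) * indicator X \<beta> * indicator Y \<alpha> \<partial>lborel) \<partial>lborel)"
    by (rule lborel_pair.Fubini') measurable
  finally show ?thesis by (simp add: nn_integral_Times_fst nn_integral_multc)
qed

text \<open>Integrating over \<beta> first, the shear is at each fixed \<alpha> a rotation, absorbed
  by the full period; what remains is a reflection of \<alpha>. The sets have to correspond only
  almost everywhere, which accommodates half-open intervals.\<close>

lemma nn_integral_shear: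
  fixes F :: "real \<times> real \<Rightarrow> ennreal"
  assumes [measurable]: "F \<in> borel_measurable borel" "c \<in> borel_measurable borel"
      "Y \<in> sets borel" "Y' \<in> sets borel"
    and per: "\<And>\<beta> \<alpha>. F (\<beta> + 2 * pi, \<alpha>) = F (\<beta>, \<alpha>)"
    and Y: "AE y in lborel. r - y \<in> Y \<longleftrightarrow> y \<in> Y'"
  shows "(\<integral>\<^sup>+x\<in>{0..<2 * pi} \<times> Y. F (fst x + c (snd x), r - snd x) \<partial>lborel)
    = (\<integral>\<^sup>+x\<in>{0..<2 * pi} \<times> Y'. F x \<partial>lborel)"
proof -
  have [measurable]: "F \<in> borel_measurable (borel \<Otimes>\<^sub>M borel)" by (simp add: borel_prod)
  have m: "(\<lambda>x. F (fst x + c (snd x), r - snd x)) \<in> borel_measurable borel"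
    unfolding borel_prod[symmetric] by measurable
  have [measurable]: "(\<lambda>\<beta>. F (\<beta>, \<alpha>)) \<in> borel_measurable borel" for \<alpha>
    by measurable
  define G where "G \<alpha> = (\<integral>\<^sup>+\<beta>\<in>{0..<2 * pi}. F (\<beta>, \<alpha>) \<partial>lborel)" for \<alpha>
  have [measurable]: "G \<in> borel_measurable borel"
    unfolding G_def by measurable
  have "(\<integral>\<^sup>+\<beta>\<in>{0..<2 * pi}. F (\<beta> + t, \<alpha>) \<partial>lborel) = G \<alpha>" for t \<alpha>
  proof -
    have "(\<integral>\<^sup>+\<beta>\<in>{0..<0 + 2 * pi}. F (\<beta> + t, \<alpha>) \<partial>lborel) = (\<integral>\<^sup>+\<beta>\<in>{0..<0 + 2 * pi}. F (\<beta>, \<alpha>) \<partial>lborel)"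
      by (rule nn_integral_periodic) (use per in auto)
    then show ?thesis by (simp add: G_def)
  qed
  then have "(\<integral>\<^sup>+x\<in>{0..<2 * pi} \<times> Y. F (fst x + c (snd x), r - snd x) \<partial>lborel)
      = (\<integral>\<^sup>+\<alpha>\<in>Y. G (r - \<alpha>) \<partial>lborel)"
    by (subst nn_integral_Times_snd[OF m]) auto
  also have "\<dots> = (\<integral>\<^sup>+\<alpha>. G (r - (r + -1 * \<alpha>)) * indicator Y (r + -1 * \<alpha>) \<partial>lborel)"
    using nn_integral_real_affine[of "\<lambda>\<alpha>. G (r - \<alpha>) * indicator Y \<alpha>" "-1" r] by simp
  also have "\<dots> = (\<integral>\<^sup>+\<alpha>\<in>Y'. G \<alpha> \<partial>lborel)"
    by (rule nn_integral_cong_AE, use Y in eventually_elim) (auto simp: indicator_def)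
  also have "\<dots> = (\<integral>\<^sup>+x\<in>{0..<2 * pi} \<times> Y'. F x \<partial>lborel)"
    unfolding G_def by (subst nn_integral_Times_snd) auto
  finally show ?thesis .
qed

lemma nn_integral_antipode:
  fixes F :: "real \<times> real \<Rightarrow> ennreal"
  assumes [measurable]: "F \<in> borel_measurable borel"
    and per: "\<And>\<beta> \<alpha>. F (\<beta>, \<alpha> + 2 * pi) = F (\<beta>, \<alpha>)"
  shows "(\<integral>\<^sup>+x\<in>lift bdry. F (fst x, snd x + pi) \<partial>lborel)
    = (\<integral>\<^sup>+x\<in>lift bdry. F x \<partial>lborel)"
proof -
  have [measurable]: "F \<in> borel_measurable (borel \<Otimes>\<^sub>M borel)" by (simp add: borel_prod)
  have m: "(\<lambda>x. F (fst x, snd x + pi)) \<in> borel_measurable borel"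
    unfolding borel_prod[symmetric] by measurable
  have "(\<integral>\<^sup>+\<alpha>\<in>{- pi / 2..<3 * pi / 2}. F (\<beta>, \<alpha> + pi) \<partial>lborel)
      = (\<integral>\<^sup>+\<alpha>\<in>{- pi / 2..<3 * pi / 2}. F (\<beta>, \<alpha>) \<partial>lborel)" for \<beta>
  proof -
    have [measurable]: "(\<lambda>\<alpha>. F (\<beta>, \<alpha>)) \<in> borel_measurable borel" by measurable
    have e: "3 * pi / 2 = - pi / 2 + 2 * pi" by simp
    show ?thesis unfolding e by (rule nn_integral_periodic) (use per in auto)
  qed
  then show ?thesis
    unfolding lift_bdry by (subst (1 2) nn_integral_Times_fst) (use m in auto)
qed

section \<open>The concrete L2 spaces as instances of the general notions\<close>

lemma norm_L2_eq_l2: "norm_L2 \<kappa> A = l2 (dSigma \<kappa> A)"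
  by (simp add: norm_L2_def l2_def fun_eq_iff)

lemma L2_iff: "u \<in> L2 \<kappa> A \<longleftrightarrow> periodic_on A u \<and> sq_int (dSigma \<kappa> A) u"
  by (auto simp: L2_def sq_int_def)

lemma periodic_on_bdry_borel:
  assumes "periodic_on bdry u" "u \<in> borel_measurable (dSigma \<kappa> bdry)"
  shows "u \<in> borel_measurable borel"
  using periodic_on_borel[OF assms(1) shift_closed_bdry _ assms(2)] by (simp add: bdry_def)

lemma L2_bdry_borel: "u \<in> L2 \<kappa> bdry \<Longrightarrow> u \<in> borel_measurable borel"
  by (auto simp: L2_def intro: periodic_on_bdry_borel)

lemma L2_bdry_periodic:
  assumes "u \<in> L2 \<kappa> bdry"
  shows "u (\<beta> + 2 * pi, \<alpha>) = u (\<beta>, \<alpha>)" "u (\<beta>, \<alpha> + 2 * pi) = u (\<beta>, \<alpha>)"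
  using assms by (auto simp: L2_def periodic_on_def bdry_def)

lemma tendsto_0_le_bound:
  fixes f g :: "nat \<Rightarrow> real"
  assumes "\<And>n. 0 \<le> f n" "\<And>n. f n \<le> g n" "g \<longlonglongrightarrow> 0"
  shows "f \<longlonglongrightarrow> 0"
  by (rule tendsto_sandwich[of "\<lambda>_. 0" f sequentially g]) (use assms in auto)

subsection \<open>Fourier series on a fibre\<close>

definition fib :: "real set" where "fib = {- pi / 2..<3 * pi / 2}"

lemma fib_measurable [measurable]: "fib \<in> sets borel"
  by (simp add: fib_def)

lemma lift_bdry_fib: "lift bdry = {0..<2 * pi} \<times> fib"
  by (simp add: lift_bdry fib_def)

abbreviation fibm :: "real measure" where "fibm \<equiv> restrict_space lborel fib"

lemma finite_measure_fibm: "finite_measure fibm"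
proof
  show "emeasure fibm (space fibm) \<noteq> \<infinity>"
    by (simp add: space_restrict_space emeasure_restrict_space fib_def)
qed

lemma borel_imp_measurable_fibm: "f \<in> borel_measurable borel \<Longrightarrow> f \<in> borel_measurable fibm"
  by (intro measurable_restrict_space1) simp

lemma fiber_coeff_eq:
  "of_real (2 * pi) * fiber_coeff u k \<beta> = (LINT \<alpha>|fibm. u (\<beta>, \<alpha>) * cis (- (of_int k * \<alpha>)))"
  unfolding fiber_coeff_def set_lebesgue_integral_def fib_def[symmetric]
  by (subst integral_restrict_space) auto

lemma cis_measurable [measurable]: "cis \<in> borel_measurable borel"
  by (intro borel_measurable_continuous_onI continuous_intros)

lemma cis_int_add_2pi: "cis (of_int k * (x + 2 * pi)) = cis (of_int k * x)"
proof -
  have "of_int k * (x + 2 * pi) = of_int k * x + 2 * pi * of_int k" by (simp add: algebra_simps)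
  then show ?thesis by (simp add: cis_mult[symmetric] del: mult.assoc)
qed

lemma sq_int_cis: "sq_int fibm (\<lambda>\<alpha>. cis (of_int k * \<alpha>))"
  by (rule sq_int_bounded(1)[where C=1]) (auto intro!: finite_measure_fibm borel_imp_measurable_fibm)

lemma has_vector_derivative_cis:
  assumes "(f has_real_derivative f') (at x within S)"
  shows "((\<lambda>x. cis (f x)) has_vector_derivative f' *\<^sub>R (\<i> * cis (f x))) (at x within S)"
proof -
  have "((\<lambda>x. \<i> * of_real (f x)) has_vector_derivative \<i> * of_real f') (at x within S)"
    using assms by (intro has_vector_derivative_mult_right has_vector_derivative_of_real)
  then have "(exp \<circ> (\<lambda>x. \<i> * of_real (f x)) has_vector_derivative (\<i> * of_real f') * exp (\<i> * of_real (f x))) (at x within S)"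
    by (rule field_vector_diff_chain_within) (rule has_field_derivative_at_within, rule DERIV_exp)
  then show ?thesis by (simp add: o_def cis_conv_exp scaleR_conv_of_real mult_ac)
qed

lemma set_lborel_integral_cis:
  assumes "n \<noteq> 0"
  shows "(LINT x:{a..a + 2 * pi}|lborel. cis (of_int n * x)) = 0"
proof -
  let ?F = "\<lambda>x. cis (of_int n * x) / (\<i> * of_int n)"
  have "(?F has_vector_derivative cis (of_int n * x)) (at x within {a..a + 2 * pi})" for x
  proof -
    have "((\<lambda>x. cis (of_int n * x)) has_vector_derivative of_int n *\<^sub>R (\<i> * cis (of_int n * x))) (at x within {a..a + 2 * pi})"
      by (rule has_vector_derivative_cis) (auto intro!: derivative_eq_intros)
    then have "(?F has_vector_derivative of_int n *\<^sub>R (\<i> * cis (of_int n * x)) / (\<i> * of_int n)) (at x within {a..a + 2 * pi})"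
      by (rule has_vector_derivative_divide)
    then show ?thesis using assms by (simp add: scaleR_conv_of_real field_simps)
  qed
  then have "(LINT x|lborel. indicator {a..a + 2 * pi} x *\<^sub>R cis (of_int n * x)) = ?F (a + 2 * pi) - ?F a"
    by (intro integral_FTC_atLeastAtMost continuous_intros) auto
  then show ?thesis by (simp add: set_lebesgue_integral_def cis_int_add_2pi)
qed

lemma lborel_integral_cis:
  "(LINT x|lborel. indicator {a..<a + 2 * pi} x *\<^sub>R cis (of_int n * x)) = (if n = 0 then of_real (2 * pi) else 0)"
proof -
  have "(LINT x|lborel. indicator {a..<a + 2 * pi} x *\<^sub>R cis (of_int n * x))
      = (LINT x:{a..a + 2 * pi}|lborel. cis (of_int n * x))"
    unfolding set_lebesgue_integral_def
  proof (rule integral_cong_AE)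
    show "AE x in lborel. indicator {a..<a + 2 * pi} x *\<^sub>R cis (of_int n * x)
        = indicator {a..a + 2 * pi} x *\<^sub>R cis (of_int n * x)"
      using AE_lborel_singleton[of "a + 2 * pi"] by eventually_elim (auto simp: indicator_def)
  qed measurable
  also have "\<dots> = (if n = 0 then of_real (2 * pi) else 0)"
  proof (cases "n = 0")
    case True
    then show ?thesis
      by (simp add: set_lebesgue_integral_def scaleR_conv_of_real)
  next
    case False
    then show ?thesis using set_lborel_integral_cis[of n a] by simp
  qed
  finally show ?thesis .
qed

lemma integral_fibm_cis:
  "(LINT x|fibm. cis (of_int n * x)) = (if n = 0 then of_real (2 * pi) else 0)"
proof -
  have "fib = {- pi / 2..<- pi / 2 + 2 * pi}" by (simp add: fib_def)
  then have "(LINT x|fibm. cis (of_int n * x)) = (LINT x|lborel. indicator {- pi / 2..<- pi / 2 + 2 * pi} x *\<^sub>R cis (of_int n * x))"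
    by (simp only: integral_restrict_space[of fib lborel] fib_measurable sets_lborel space_lborel space_borel Int_UNIV_right)
  then show ?thesis by (simp only: lborel_integral_cis)
qed

lemma complex_norm_diff_sq:
  "(norm (a - b))\<^sup>2 = (norm a)\<^sup>2 - 2 * Re (a * cnj b) + Re (b * cnj b)"
  unfolding cmod_power2 by (simp add: power2_eq_square algebra_simps)

text \<open>One expansion with two uses: g = 0 gives Parseval for trigonometric polynomials, and
  taking c k to be the Fourier coefficients of g gives Bessel, the left side being
  nonnegative.\<close>

lemma fibre_norm_diff_sq:
  fixes g :: "real \<Rightarrow> complex" and c :: "int \<Rightarrow> complex"
  assumes g: "sq_int fibm g" and K: "finite K"
  shows "(LINT \<alpha>|fibm. (norm (g \<alpha> - (\<Sum>k\<in>K. c k * cis (of_int k * \<alpha>))))\<^sup>2)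
    = (LINT \<alpha>|fibm. (norm (g \<alpha>))\<^sup>2)
      - 2 * Re (\<Sum>k\<in>K. cnj (c k) * (LINT \<alpha>|fibm. g \<alpha> * cis (- (of_int k * \<alpha>))))
      + 2 * pi * (\<Sum>k\<in>K. (norm (c k))\<^sup>2)"
proof -
  interpret finite_measure fibm by (rule finite_measure_fibm)
  note e = sq_int_cis
  define t where "t \<alpha> = (\<Sum>k\<in>K. c k * cis (of_int k * \<alpha>))" for \<alpha>
  have t: "sq_int fibm t" unfolding t_def by (intro sq_int_sum sq_int_cmult e)
  have ge: "integrable fibm (\<lambda>\<alpha>. g \<alpha> * cis (- (of_int k * \<alpha>)))" for k
    using integrable_mult_cnj[OF g e[of k]] by (simp add: cis_cnj)
  have ee: "integrable fibm (\<lambda>\<alpha>. cis (of_int (k - l) * \<alpha>))" for k l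
    using integrable_mult_cnj[OF e[of k] e[of l]] by (simp add: cis_cnj cis_mult left_diff_distrib)
  have gt: "g \<alpha> * cnj (t \<alpha>) = (\<Sum>k\<in>K. cnj (c k) * (g \<alpha> * cis (- (of_int k * \<alpha>))))" for \<alpha>
    by (simp add: t_def cis_cnj sum_distrib_left mult_ac)
  have tt: "t \<alpha> * cnj (t \<alpha>) = (\<Sum>k\<in>K. \<Sum>l\<in>K. c k * cnj (c l) * cis (of_int (k - l) * \<alpha>))" for \<alpha>
    unfolding t_def cnj_sum sum_product
  proof (intro sum.cong refl)
    fix k l
    have "cis (of_int (k - l) * \<alpha>) = cis (of_int k * \<alpha>) * cnj (cis (of_int l * \<alpha>))"
      by (simp add: cis_cnj cis_mult left_diff_distrib)
    then show "c k * cis (of_int k * \<alpha>) * cnj (c l * cis (of_int l * \<alpha>))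
        = c k * cnj (c l) * cis (of_int (k - l) * \<alpha>)" by simp
  qed
  have "(LINT \<alpha>|fibm. (norm (g \<alpha> - t \<alpha>))\<^sup>2)
      = (LINT \<alpha>|fibm. (norm (g \<alpha>))\<^sup>2 - 2 * Re (g \<alpha> * cnj (t \<alpha>)) + Re (t \<alpha> * cnj (t \<alpha>)))"
    by (simp only: complex_norm_diff_sq)
  also have "\<dots> = (LINT \<alpha>|fibm. (norm (g \<alpha>))\<^sup>2) - 2 * Re (LINT \<alpha>|fibm. g \<alpha> * cnj (t \<alpha>))
      + Re (LINT \<alpha>|fibm. t \<alpha> * cnj (t \<alpha>))"
    using integrable_mult_cnj[OF g t] integrable_mult_cnj[OF t t] sq_int_integrable[OF g]
    by (simp only: Bochner_Integration.integral_add Bochner_Integration.integral_diff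
        Bochner_Integration.integrable_diff integrable_mult_right integral_mult_right_zero
        integral_Re integrable_Re)
  also have "(LINT \<alpha>|fibm. g \<alpha> * cnj (t \<alpha>))
      = (\<Sum>k\<in>K. cnj (c k) * (LINT \<alpha>|fibm. g \<alpha> * cis (- (of_int k * \<alpha>))))"
    unfolding gt using ge by (subst Bochner_Integration.integral_sum) auto
  also have "(LINT \<alpha>|fibm. t \<alpha> * cnj (t \<alpha>))
      = (\<Sum>k\<in>K. \<Sum>l\<in>K. c k * cnj (c l) * (LINT \<alpha>|fibm. cis (of_int (k - l) * \<alpha>)))"
    unfolding tt using ee by (subst Bochner_Integration.integral_sum; (subst Bochner_Integration.integral_sum)?) auto
  also have "\<dots> = (\<Sum>k\<in>K. \<Sum>l\<in>K. if k = l then c k * cnj (c l) * of_real (2 * pi) else 0)"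
    by (intro sum.cong refl) (simp add: integral_fibm_cis del: of_int_diff)
  also have "\<dots> = (\<Sum>k\<in>K. c k * cnj (c k) * of_real (2 * pi))"
    using K by (intro sum.cong refl) simp
  also have "\<dots> = of_real (2 * pi * (\<Sum>k\<in>K. (norm (c k))\<^sup>2))"
    unfolding of_real_mult of_real_sum sum_distrib_left
    by (intro sum.cong refl) (simp only: complex_norm_square mult_ac)
  finally show ?thesis by (simp add: t_def)
qed

lemma fibre_parseval:
  assumes "finite K"
  shows "(\<integral>\<^sup>+\<alpha>\<in>fib. ennreal ((norm (\<Sum>k\<in>K. c k * cis (of_int k * \<alpha>)))\<^sup>2) \<partial>lborel)
    = ennreal (2 * pi * (\<Sum>k\<in>K. (norm (c k))\<^sup>2))"
proof -
  note e = sq_int_cis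
  have t: "sq_int fibm (\<lambda>\<alpha>. \<Sum>k\<in>K. c k * cis (of_int k * \<alpha>))" by (intro sq_int_sum sq_int_cmult e)
  have "(\<integral>\<^sup>+\<alpha>\<in>fib. ennreal ((norm (\<Sum>k\<in>K. c k * cis (of_int k * \<alpha>)))\<^sup>2) \<partial>lborel)
      = (\<integral>\<^sup>+\<alpha>. ennreal ((norm (\<Sum>k\<in>K. c k * cis (of_int k * \<alpha>)))\<^sup>2) \<partial>fibm)"
    by (rule nn_integral_restrict_space[symmetric]) simp
  also have "\<dots> = ennreal (LINT \<alpha>|fibm. (norm (\<Sum>k\<in>K. c k * cis (of_int k * \<alpha>)))\<^sup>2)"
    by (simp add: nn_integral_norm_sq[OF t] l2_squared)
  finally show ?thesis using fibre_norm_diff_sq[OF sq_int_zero assms, of c] by simp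
qed

text \<open>Holds on every fibre, also where the right side is infinite and the coefficients may be
  default values, so it can be integrated over \<beta> without exceptional sets.\<close>

lemma fibre_bessel:
  assumes K: "finite K" and g: "(\<lambda>\<alpha>. u (\<beta>, \<alpha>)) \<in> borel_measurable borel"
  shows "ennreal (2 * pi * (\<Sum>k\<in>K. (norm (fiber_coeff u k \<beta>))\<^sup>2))
    \<le> (\<integral>\<^sup>+\<alpha>\<in>fib. ennreal ((norm (u (\<beta>, \<alpha>)))\<^sup>2) \<partial>lborel)"
proof (cases "(\<integral>\<^sup>+\<alpha>\<in>fib. ennreal ((norm (u (\<beta>, \<alpha>)))\<^sup>2) \<partial>lborel) = \<infinity>")
  case False
  have eq: "(\<integral>\<^sup>+\<alpha>\<in>fib. ennreal ((norm (u (\<beta>, \<alpha>)))\<^sup>2) \<partial>lborel) = (\<integral>\<^sup>+\<alpha>. ennreal ((norm (u (\<beta>, \<alpha>)))\<^sup>2) \<partial>fibm)"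
    by (rule nn_integral_restrict_space[symmetric]) simp
  have [measurable]: "(\<lambda>\<alpha>. u (\<beta>, \<alpha>)) \<in> borel_measurable fibm"
    using g by (rule borel_imp_measurable_fibm)
  have sq: "sq_int fibm (\<lambda>\<alpha>. u (\<beta>, \<alpha>))"
    unfolding sq_int_def using False eq by (auto intro!: integrableI_bounded simp: top.not_eq_extremum)
  let ?c = "\<lambda>k. fiber_coeff u k \<beta>"
  have "0 \<le> (LINT \<alpha>|fibm. (norm (u (\<beta>, \<alpha>) - (\<Sum>k\<in>K. ?c k * cis (of_int k * \<alpha>))))\<^sup>2)" by simp
  also have "\<dots> = (l2 fibm (\<lambda>\<alpha>. u (\<beta>, \<alpha>)))\<^sup>2 - 2 * Re (\<Sum>k\<in>K. cnj (?c k) * (of_real (2 * pi) * ?c k))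
      + 2 * pi * (\<Sum>k\<in>K. (norm (?c k))\<^sup>2)"
    unfolding fibre_norm_diff_sq[OF sq K] l2_squared fiber_coeff_eq ..
  also have "(\<Sum>k\<in>K. cnj (?c k) * (of_real (2 * pi) * ?c k)) = of_real (2 * pi * (\<Sum>k\<in>K. (norm (?c k))\<^sup>2))"
    unfolding of_real_mult of_real_sum sum_distrib_left
    by (intro sum.cong refl) (simp only: complex_norm_square mult_ac)
  finally have "2 * pi * (\<Sum>k\<in>K. (norm (?c k))\<^sup>2) \<le> (l2 fibm (\<lambda>\<alpha>. u (\<beta>, \<alpha>)))\<^sup>2" by simp
  then show ?thesis unfolding eq nn_integral_norm_sq[OF sq] by (rule ennreal_leI)
qed simp

subsection \<open>Fourier multipliers on the fibres\<close>

text \<open>A partial sum over any set of modes, not just a symmetric window: the difference of two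
  partial sums is then again of this form.\<close>

definition fpart :: "(int \<Rightarrow> complex) \<Rightarrow> bfun \<Rightarrow> int set \<Rightarrow> real \<times> real \<Rightarrow> complex" where
  "fpart m u K = (\<lambda>(\<beta>, \<alpha>). \<Sum>k\<in>K. m k * fiber_coeff u k \<beta> * cis (of_int k * \<alpha>))"

abbreviation modes :: "nat \<Rightarrow> int set" where "modes N \<equiv> {- int N..int N}"

text \<open>The condition under the choice operator of \<open>fiber_multiplier\<close>, isolated so
  that existence, uniqueness up to null sets and linearity can be proved for it.\<close>

definition mult_lim ::
  "real \<Rightarrow> (int \<Rightarrow> complex) \<Rightarrow> bfun \<Rightarrow> bfun \<Rightarrow> bool" where
  "mult_lim \<kappa> m u w \<longleftrightarrow> w \<in> L2 \<kappa> bdry \<and>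
     (\<lambda>N::nat. l2 (dSigma \<kappa> bdry) (\<lambda>x. w x - fpart m u (modes N) x)) \<longlonglongrightarrow> 0"

lemma fiber_multiplier_eq: "fiber_multiplier \<kappa> m u = (SOME w. mult_lim \<kappa> m u w)"
proof -
  have "(\<lambda>(\<beta>, \<alpha>). w (\<beta>, \<alpha>) - (\<Sum>k = - int N..int N. m k * fiber_coeff u k \<beta> * cis (of_int k * \<alpha>)))
      = (\<lambda>x. w x - fpart m u (modes N) x)" for w N
    by (auto simp: fun_eq_iff fpart_def)
  then show ?thesis
    unfolding fiber_multiplier_def mult_lim_def norm_L2_eq_l2 by simp
qed

lemma fiber_coeff_measurable:
  assumes [measurable]: "u \<in> borel_measurable borel"
  shows "fiber_coeff u k \<in> borel_measurable borel"
proof -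
  have [measurable]: "u \<in> borel_measurable (borel \<Otimes>\<^sub>M borel)" by (simp add: borel_prod)
  show ?thesis unfolding fiber_coeff_def set_lebesgue_integral_def by measurable
qed

lemma fpart_measurable:
  assumes "u \<in> borel_measurable borel"
  shows "fpart m u K \<in> borel_measurable borel"
proof -
  note [measurable] = fiber_coeff_measurable[OF assms]
  show ?thesis unfolding fpart_def borel_prod[symmetric] by measurable
qed

lemma fpart_norm:
  assumes u: "u \<in> borel_measurable borel" and K: "finite K"
  shows "(\<integral>\<^sup>+x. ennreal ((norm (fpart m u K x))\<^sup>2) \<partial>dSigma \<kappa> bdry)
    = ennreal (1 / (1 + \<kappa>)) *
      (\<integral>\<^sup>+\<beta>\<in>{0..<2 * pi}. ennreal (2 * pi * (\<Sum>k\<in>K. (norm (m k * fiber_coeff u k \<beta>))\<^sup>2)) \<partial>lborel)"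
proof -
  note [measurable] = fpart_measurable[OF u]
  show ?thesis
    by (subst nn_integral_dSigma, simp, measurable, unfold lift_bdry_fib, subst nn_integral_Times_fst,
        measurable) (simp add: fpart_def fibre_parseval[OF K])
qed

text \<open>By Parseval on each fibre, the squared norm of the k-th mode over the whole boundary; it
  stays in \<open>ennreal\<close> until Bessel's inequality shows it to be finite.\<close>

definition mode_energy :: "real \<Rightarrow> bfun \<Rightarrow> int \<Rightarrow> ennreal" where
  "mode_energy \<kappa> u k = ennreal (1 / (1 + \<kappa>)) *
     (\<integral>\<^sup>+\<beta>\<in>{0..<2 * pi}. ennreal (2 * pi * (norm (fiber_coeff u k \<beta>))\<^sup>2) \<partial>lborel)"

lemma sum_mode_energy:
  assumes u: "u \<in> borel_measurable borel" and K: "finite K"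
  shows "(\<Sum>k\<in>K. mode_energy \<kappa> u k) = ennreal (1 / (1 + \<kappa>)) *
      (\<integral>\<^sup>+\<beta>\<in>{0..<2 * pi}. ennreal (2 * pi * (\<Sum>k\<in>K. (norm (fiber_coeff u k \<beta>))\<^sup>2)) \<partial>lborel)"
proof -
  note [measurable] = fiber_coeff_measurable[OF u]
  have "ennreal (2 * pi * (\<Sum>k\<in>K. (norm (fiber_coeff u k \<beta>))\<^sup>2)) * indicator {0..<2 * pi} \<beta>
      = (\<Sum>k\<in>K. ennreal (2 * pi * (norm (fiber_coeff u k \<beta>))\<^sup>2) * indicator {0..<2 * pi} \<beta>)" for \<beta>
    by (simp add: sum_distrib_left sum_distrib_right[symmetric])
  then show ?thesis
    unfolding mode_energy_def by (simp add: nn_integral_sum sum_distrib_left)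
qed

lemma sum_mode_energy_le:
  assumes u: "u \<in> L2 \<kappa> bdry" and K: "finite K"
  shows "(\<Sum>k\<in>K. mode_energy \<kappa> u k) \<le> ennreal ((l2 (dSigma \<kappa> bdry) u)\<^sup>2)"
proof -
  note ub [measurable] = L2_bdry_borel[OF u]
  have [measurable]: "u \<in> borel_measurable (borel \<Otimes>\<^sub>M borel)" by (simp add: borel_prod)
  have sq: "sq_int (dSigma \<kappa> bdry) u" using u by (simp add: L2_iff)
  have "(\<Sum>k\<in>K. mode_energy \<kappa> u k) \<le> ennreal (1 / (1 + \<kappa>)) *
      (\<integral>\<^sup>+\<beta>\<in>{0..<2 * pi}. (\<integral>\<^sup>+\<alpha>\<in>fib. ennreal ((norm (u (\<beta>, \<alpha>)))\<^sup>2) \<partial>lborel) \<partial>lborel)"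
    unfolding sum_mode_energy[OF ub K]
    by (intro mult_left_mono nn_integral_mono mult_right_mono fibre_bessel K) auto
  also have "\<dots> = (\<integral>\<^sup>+x. ennreal ((norm (u x))\<^sup>2) \<partial>dSigma \<kappa> bdry)"
    by (subst nn_integral_dSigma, simp, measurable, unfold lift_bdry_fib, subst nn_integral_Times_fst) auto
  finally show ?thesis by (simp add: nn_integral_norm_sq[OF sq])
qed

lemma fpart_sq_int:
  assumes u: "u \<in> L2 \<kappa> bdry" and K: "finite K" and m: "\<And>k. norm (m k) \<le> 1"
  shows "sq_int (dSigma \<kappa> bdry) (fpart m u K)"
    and "ennreal ((l2 (dSigma \<kappa> bdry) (fpart m u K))\<^sup>2) \<le> (\<Sum>k\<in>K. mode_energy \<kappa> u k)"
    and "l2 (dSigma \<kappa> bdry) (fpart m u K) \<le> l2 (dSigma \<kappa> bdry) u"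
proof -
  note ub = L2_bdry_borel[OF u]
  have le: "(\<integral>\<^sup>+x. ennreal ((norm (fpart m u K x))\<^sup>2) \<partial>dSigma \<kappa> bdry) \<le> (\<Sum>k\<in>K. mode_energy \<kappa> u k)"
    unfolding sum_mode_energy[OF ub K] fpart_norm[OF ub K]
  proof (intro mult_left_mono nn_integral_mono mult_right_mono ennreal_leI sum_mono power_mono)
    fix \<beta> k
    show "norm (m k * fiber_coeff u k \<beta>) \<le> norm (fiber_coeff u k \<beta>)"
      unfolding norm_mult by (rule mult_left_le_one_le) (use m in auto)
  qed auto
  note le2 = order_trans[OF le sum_mode_energy_le[OF u K]]
  show sq: "sq_int (dSigma \<kappa> bdry) (fpart m u K)"
    and "l2 (dSigma \<kappa> bdry) (fpart m u K) \<le> l2 (dSigma \<kappa> bdry) u"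
    using sq_int_I_nn_integral[OF borel_imp_measurable_dSigma[OF fpart_measurable[OF ub]] le2] by auto
  show "ennreal ((l2 (dSigma \<kappa> bdry) (fpart m u K))\<^sup>2) \<le> (\<Sum>k\<in>K. mode_energy \<kappa> u k)"
    using le by (simp add: nn_integral_norm_sq[OF sq])
qed

lemma fpart_diff:
  assumes "finite L" "K \<subseteq> L"
  shows "fpart m u L x - fpart m u K x = fpart m u (L - K) x"
  using assms by (cases x) (simp add: fpart_def sum_diff)

text \<open>A symbol bounded by 1 does not increase the energy of any mode, and the total energy is
  bounded by Bessel, so the partial sums are Cauchy. Because the limit is taken pointwise along a
  subsequence, a symbol carried by odd modes yields a limit that is odd at every point.\<close>

lemma mult_lim_exists:
  assumes u: "u \<in> L2 \<kappa> bdry" and m: "\<And>k. norm (m k) \<le> 1"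
  obtains w where "mult_lim \<kappa> m u w"
    "(\<And>k. even k \<Longrightarrow> m k = 0) \<Longrightarrow> \<forall>\<beta> \<alpha>. w (\<beta>, \<alpha> + pi) = - w (\<beta>, \<alpha>)"
proof -
  let ?M = "dSigma \<kappa> bdry"
  define I where "I N = modes N" for N
  define s where "s N = fpart m u (I N)" for N
  have I: "finite (I N)" for N by (simp add: I_def)
  have s: "sq_int ?M (s N)" for N unfolding s_def by (intro fpart_sq_int u m I)
  define B where "B N = enn2real (\<Sum>k\<in>I N. mode_energy \<kappa> u k)" for N
  have fin: "(\<Sum>k\<in>K. mode_energy \<kappa> u k) < \<infinity>" if "finite K" for K
    using le_less_trans[OF sum_mode_energy_le[OF u that]] by simp
  have fin1: "mode_energy \<kappa> u k < \<infinity>" for k using fin[of "{k}"] by simp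
  have B: "B N = (\<Sum>k\<in>I N. enn2real (mode_energy \<kappa> u k))" for N
    unfolding B_def using fin1 by (simp add: enn2real_sum)
  have "incseq B"
    unfolding incseq_def B by (intro allI impI sum_mono2) (auto simp: I_def)
  moreover have "B N \<le> (l2 ?M u)\<^sup>2" for N
    unfolding B_def using sum_mode_energy_le[OF u I] by (intro enn2real_leI) auto
  ultimately have "convergent B"
    unfolding convergent_def by (meson incseq_convergent)
  then have Cauchy: "Cauchy B" by (rule convergent_Cauchy)
  \<comment> \<open>Orthogonality of the modes bounds the squared increment by the increment of the
    bounded increasing sequence \<open>B\<close>, which is Cauchy.\<close>
  have key: "(l2 ?M (\<lambda>x. s b x - s a x))\<^sup>2 \<le> B b - B a" if "a \<le> b" for a b
  proof -
    have sub: "I a \<subseteq> I b" using that by (auto simp: I_def)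
    have "ennreal ((l2 ?M (\<lambda>x. s b x - s a x))\<^sup>2) \<le> (\<Sum>k\<in>I b - I a. mode_energy \<kappa> u k)"
      unfolding s_def fpart_diff[OF I sub] using fpart_sq_int(2)[OF u _ m, of "I b - I a"] I by simp
    also have "\<dots> = ennreal (\<Sum>k\<in>I b - I a. enn2real (mode_energy \<kappa> u k))"
      using fin1 by (subst sum_ennreal[symmetric]) (auto intro!: sum.cong)
    also have "(\<Sum>k\<in>I b - I a. enn2real (mode_energy \<kappa> u k)) = B b - B a"
      unfolding B using sub I by (simp add: sum_diff)
    finally have le: "ennreal ((l2 ?M (\<lambda>x. s b x - s a x))\<^sup>2) \<le> ennreal (B b - B a)" .
    have "B a \<le> B b" unfolding B by (rule sum_mono2) (use sub I in auto)
    then show ?thesis using le by (simp add: ennreal_le_iff)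
  qed
  have cauchy: "\<exists>N. \<forall>a\<ge>N. \<forall>b\<ge>N. l2 ?M (\<lambda>x. s a x - s b x) \<le> e" if e: "e > 0" for e
  proof -
    obtain N where N: "\<And>a b. a \<ge> N \<Longrightarrow> b \<ge> N \<Longrightarrow> norm (B a - B b) < e\<^sup>2"
      using CauchyD[OF Cauchy, of "e\<^sup>2"] e by auto
    have 1: "l2 ?M (\<lambda>x. s a x - s b x) \<le> e" if "a \<ge> N" "b \<ge> N" "b \<le> a" for a b
    proof (rule power2_le_imp_le)
      show "(l2 ?M (\<lambda>x. s a x - s b x))\<^sup>2 \<le> e\<^sup>2"
        using key[OF that(3)] N[OF that(1,2)] by simp
    qed (use e in simp)
    have "l2 ?M (\<lambda>x. s a x - s b x) \<le> e" if "a \<ge> N" "b \<ge> N" for a b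
      using 1[of a b] 1[of b a] that l2_minus_commute[of ?M "s a" "s b"] by (cases "b \<le> a") auto
    then show ?thesis by blast
  qed
  obtain r w where r: "sq_int ?M w" "(\<lambda>n. l2 ?M (\<lambda>x. w x - s n x)) \<longlonglongrightarrow> 0"
    and w_def: "w = (\<lambda>x. if convergent (\<lambda>n. s (r n) x) then lim (\<lambda>n. s (r n) x) else 0)"
    by (rule l2_complete[OF s cauchy])
  have "fiber_coeff u k (\<beta> + 2 * pi) = fiber_coeff u k \<beta>" for k \<beta>
    by (simp add: fiber_coeff_def L2_bdry_periodic[OF u])
  then have "periodic_on bdry w"
    by (simp add: periodic_on_def w_def s_def fpart_def cis_int_add_2pi)
  with r(1) have "w \<in> L2 \<kappa> bdry" by (simp add: L2_iff)
  with r(2) have 1: "mult_lim \<kappa> m u w"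
    by (simp add: mult_lim_def s_def I_def)
  have 2: "\<forall>\<beta> \<alpha>. w (\<beta>, \<alpha> + pi) = - w (\<beta>, \<alpha>)" if odd: "\<And>k. even k \<Longrightarrow> m k = 0"
  proof (intro allI)
    fix \<beta> \<alpha>
    have c: "cis (of_int k * (\<alpha> + pi)) = - cis (of_int k * \<alpha>)" if "odd k" for k
    proof -
      have "cis (of_int k * pi) = (- 1) powi k" by (metis cis_pi cis_power_int)
      then show ?thesis using that by (simp add: distrib_left cis_mult[symmetric] power_int_minus_left)
    qed
    have "m k * f * cis (of_int k * (\<alpha> + pi)) = - (m k * f * cis (of_int k * \<alpha>))" for k f
      using odd[of k] c[of k] by (cases "even k") auto
    then have eq: "s N (\<beta>, \<alpha> + pi) = - s N (\<beta>, \<alpha>)" for N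
      by (simp add: s_def fpart_def sum_negf)
    show "w (\<beta>, \<alpha> + pi) = - w (\<beta>, \<alpha>)"
    proof (cases "convergent (\<lambda>n. s (r n) (\<beta>, \<alpha>))")
      case True
      then have "(\<lambda>n. - s (r n) (\<beta>, \<alpha>)) \<longlonglongrightarrow> - lim (\<lambda>n. s (r n) (\<beta>, \<alpha>))"
        by (intro tendsto_minus) (simp add: convergent_LIMSEQ_iff)
      then show ?thesis
        using True by (simp add: w_def eq limI convergent_minus_iff[symmetric])
    next
      case False
      then show ?thesis by (simp add: w_def eq convergent_minus_iff[symmetric])
    qed
  qed
  show thesis using that[OF 1 2] by blast
qed

lemma mult_lim_unique:
  assumes u: "u \<in> L2 \<kappa> bdry" and m: "\<And>k. norm (m k) \<le> 1"
    and w: "mult_lim \<kappa> m u w" "mult_lim \<kappa> m u w'"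
  shows "eq_L2 \<kappa> bdry w w'"
proof -
  let ?M = "dSigma \<kappa> bdry" and ?s = "\<lambda>N::nat. fpart m u (modes N)"
  have sq: "sq_int ?M w" "sq_int ?M w'" using w by (auto simp: mult_lim_def L2_iff)
  have s: "sq_int ?M (?s N)" for N by (intro fpart_sq_int u m) auto
  have "l2 ?M (\<lambda>x. w x - w' x) \<le> l2 ?M (\<lambda>x. w x - ?s N x) + l2 ?M (\<lambda>x. w' x - ?s N x)" for N
    using l2_diff_triangle[OF sq_int_diff[OF sq(1) s[of N]] sq_int_diff[OF sq(2) s[of N]]] by simp
  moreover have "(\<lambda>N. l2 ?M (\<lambda>x. w x - ?s N x) + l2 ?M (\<lambda>x. w' x - ?s N x)) \<longlonglongrightarrow> 0 + 0"
    using w by (intro tendsto_add) (auto simp: mult_lim_def)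
  ultimately have "l2 ?M (\<lambda>x. w x - w' x) \<le> 0"
    by (intro LIMSEQ_le_const[of _ 0]) auto
  then have "l2 ?M (\<lambda>x. w x - w' x) = 0" by (simp add: antisym)
  then show ?thesis
    unfolding l2_eq_0_iff[OF sq_int_diff[OF sq]] eq_L2_def by simp
qed

lemma mult_lim_bound:
  assumes u: "u \<in> L2 \<kappa> bdry" and m: "\<And>k. norm (m k) \<le> 1" and w: "mult_lim \<kappa> m u w"
  shows "l2 (dSigma \<kappa> bdry) w \<le> l2 (dSigma \<kappa> bdry) u"
proof -
  let ?M = "dSigma \<kappa> bdry" and ?s = "\<lambda>N::nat. fpart m u (modes N)"
  have sq: "sq_int ?M w" using w by (auto simp: mult_lim_def L2_iff)
  have s: "sq_int ?M (?s N)" "l2 ?M (?s N) \<le> l2 ?M u" for N by (intro fpart_sq_int u m; simp)+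
  have "l2 ?M w \<le> l2 ?M (\<lambda>x. w x - ?s N x) + l2 ?M u" for N
    using l2_triangle[OF sq_int_diff[OF sq s(1)[of N]] s(1)[of N]] s(2)[of N] by simp
  moreover have "(\<lambda>N. l2 ?M (\<lambda>x. w x - ?s N x) + l2 ?M u) \<longlonglongrightarrow> 0 + l2 ?M u"
    using w by (intro tendsto_add) (auto simp: mult_lim_def)
  ultimately show ?thesis
    by (intro LIMSEQ_le_const[of _ "l2 ?M u"]) auto
qed

text \<open>Linearity of \<open>fiber_coeff\<close> in u may break on fibres where an integral takes
  its default value. By Tonelli these fibres form a null set of \<beta>.\<close>

lemma AE_fibre_sq_int:
  assumes "-1 < \<kappa>" and u: "u \<in> L2 \<kappa> bdry"
  shows "AE \<beta> in lborel. \<beta> \<in> {0..<2 * pi} \<longrightarrow> sq_int fibm (\<lambda>\<alpha>. u (\<beta>, \<alpha>))"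
proof -
  note [measurable] = L2_bdry_borel[OF u]
  have [measurable]: "u \<in> borel_measurable (borel \<Otimes>\<^sub>M borel)" by (simp add: borel_prod)
  have sq: "sq_int (dSigma \<kappa> bdry) u" using u by (simp add: L2_iff)
  let ?f = "\<lambda>\<beta>. \<integral>\<^sup>+\<alpha>\<in>fib. ennreal ((norm (u (\<beta>, \<alpha>)))\<^sup>2) \<partial>lborel"
  have "ennreal (1 / (1 + \<kappa>)) * (\<integral>\<^sup>+\<beta>\<in>{0..<2 * pi}. ?f \<beta> \<partial>lborel) = ennreal ((l2 (dSigma \<kappa> bdry) u)\<^sup>2)"
    by (subst nn_integral_norm_sq[OF sq, symmetric], subst nn_integral_dSigma, simp, measurable,
        unfold lift_bdry_fib, subst nn_integral_Times_fst) auto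
  then have "(\<integral>\<^sup>+\<beta>\<in>{0..<2 * pi}. ?f \<beta> \<partial>lborel) \<noteq> \<infinity>"
    using assms(1) by (auto simp: ennreal_mult_top)
  then have "AE \<beta> in lborel. ?f \<beta> * indicator {0..<2 * pi} \<beta> \<noteq> \<infinity>"
    by (intro nn_integral_PInf_AE) measurable
  then show ?thesis
  proof (eventually_elim, intro impI)
    fix \<beta> assume fin: "?f \<beta> * indicator {0..<2 * pi} \<beta> \<noteq> \<infinity>" and \<beta>: "\<beta> \<in> {0..<2 * pi}"
    have [measurable]: "(\<lambda>\<alpha>. u (\<beta>, \<alpha>)) \<in> borel_measurable fibm"
      by (rule borel_imp_measurable_fibm) measurable
    have eq: "?f \<beta> = (\<integral>\<^sup>+\<alpha>. ennreal ((norm (u (\<beta>, \<alpha>)))\<^sup>2) \<partial>fibm)"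
      by (rule nn_integral_restrict_space[symmetric]) simp
    show "sq_int fibm (\<lambda>\<alpha>. u (\<beta>, \<alpha>))"
      unfolding sq_int_def using fin \<beta> eq
      by (auto intro!: integrableI_bounded simp: top.not_eq_extremum)
  qed
qed

lemma L2_lincomb: "u \<in> L2 \<kappa> A \<Longrightarrow> v \<in> L2 \<kappa> A \<Longrightarrow> (\<lambda>x. a * u x + b * v x) \<in> L2 \<kappa> A"
  by (fastforce simp: L2_iff periodic_on_def intro!: sq_int_add sq_int_cmult)

lemma fiber_coeff_lincomb:
  assumes u: "sq_int fibm (\<lambda>\<alpha>. u (\<beta>, \<alpha>))" and v: "sq_int fibm (\<lambda>\<alpha>. v (\<beta>, \<alpha>))"
  shows "fiber_coeff (\<lambda>x. a * u x + b * v x) k \<beta> = a * fiber_coeff u k \<beta> + b * fiber_coeff v k \<beta>"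
proof -
  note e = sq_int_cis
  have i: "integrable fibm (\<lambda>\<alpha>. g (\<beta>, \<alpha>) * cis (- (of_int k * \<alpha>)))" if "sq_int fibm (\<lambda>\<alpha>. g (\<beta>, \<alpha>))" for g
    using integrable_mult_cnj[OF that e] by (simp add: cis_cnj)
  have "of_real (2 * pi) * fiber_coeff (\<lambda>x. a * u x + b * v x) k \<beta>
      = (LINT \<alpha>|fibm. a * (u (\<beta>, \<alpha>) * cis (- (of_int k * \<alpha>))) + b * (v (\<beta>, \<alpha>) * cis (- (of_int k * \<alpha>))))"
    unfolding fiber_coeff_eq by (simp add: algebra_simps)
  also have "\<dots> = a * (of_real (2 * pi) * fiber_coeff u k \<beta>) + b * (of_real (2 * pi) * fiber_coeff v k \<beta>)"
    unfolding fiber_coeff_eq using i[OF u] i[OF v] by simp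
  also have "\<dots> = of_real (2 * pi) * (a * fiber_coeff u k \<beta> + b * fiber_coeff v k \<beta>)"
    by (simp add: algebra_simps)
  finally show ?thesis by simp
qed

text \<open>The difference of the two sides vanishes identically on every fibre where u and v are
  both square integrable, so its squared norm, integrated fibre by fibre, is 0.\<close>

lemma fpart_lincomb:
  assumes \<kappa>: "-1 < \<kappa>" and u: "u \<in> L2 \<kappa> bdry" and v: "v \<in> L2 \<kappa> bdry"
    and m: "\<And>k. norm (m k) \<le> 1" and K: "finite K"
  shows "AE x in dSigma \<kappa> bdry.
    fpart m (\<lambda>x. a * u x + b * v x) K x = a * fpart m u K x + b * fpart m v K x"
proof -
  let ?M = "dSigma \<kappa> bdry"
  let ?D = "\<lambda>x. fpart m (\<lambda>x. a * u x + b * v x) K x - (a * fpart m u K x + b * fpart m v K x)"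
  have sq: "sq_int ?M ?D"
    by (intro sq_int_diff sq_int_add sq_int_cmult fpart_sq_int L2_lincomb u v m K)
  have D [measurable]: "?D \<in> borel_measurable borel"
    by (intro borel_measurable_diff borel_measurable_add borel_measurable_times borel_measurable_const
        fpart_measurable L2_bdry_borel[of _ \<kappa>] L2_lincomb u v)
  have "AE \<beta> in lborel. (\<integral>\<^sup>+\<alpha>\<in>fib. ennreal ((norm (?D (\<beta>, \<alpha>)))\<^sup>2) \<partial>lborel) * indicator {0..<2 * pi} \<beta> = 0"
    using AE_fibre_sq_int[OF \<kappa> u] AE_fibre_sq_int[OF \<kappa> v]
  proof eventually_elim
    case (elim \<beta>)
    then have "?D (\<beta>, \<alpha>) = 0" if "\<beta> \<in> {0..<2 * pi}" for \<alpha>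
      using that fiber_coeff_lincomb[of u \<beta> v a b]
      by (simp add: fpart_def sum_distrib_left sum.distrib[symmetric] distrib_left distrib_right mult_ac)
    then show ?case by (auto simp: indicator_def)
  qed
  then have "(\<integral>\<^sup>+\<beta>\<in>{0..<2 * pi}. (\<integral>\<^sup>+\<alpha>\<in>fib. ennreal ((norm (?D (\<beta>, \<alpha>)))\<^sup>2) \<partial>lborel) \<partial>lborel) = (\<integral>\<^sup>+(\<beta>::real). 0 \<partial>lborel)"
    by (rule nn_integral_cong_AE)
  then have "(\<integral>\<^sup>+x. ennreal ((norm (?D x))\<^sup>2) \<partial>?M) = 0"
    by (subst nn_integral_dSigma, simp, measurable, unfold lift_bdry_fib, subst nn_integral_Times_fst)
       (use D in \<open>auto intro!: measurable_compose[OF D]\<close>)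
  then have "l2 ?M ?D = 0" by (simp add: nn_integral_norm_sq[OF sq])
  then show ?thesis unfolding l2_eq_0_iff[OF sq] by simp
qed

lemma mult_lim_lincomb:
  assumes \<kappa>: "-1 < \<kappa>" and u: "u \<in> L2 \<kappa> bdry" and v: "v \<in> L2 \<kappa> bdry"
    and m: "\<And>k. norm (m k) \<le> 1" and w: "mult_lim \<kappa> m u w" and z: "mult_lim \<kappa> m v z"
  shows "mult_lim \<kappa> m (\<lambda>x. a * u x + b * v x) (\<lambda>x. a * w x + b * z x)"
  unfolding mult_lim_def
proof
  show "(\<lambda>x. a * w x + b * z x) \<in> L2 \<kappa> bdry"
    using w z by (auto simp: mult_lim_def intro!: L2_lincomb)
  let ?M = "dSigma \<kappa> bdry" and ?s = "\<lambda>u (N::nat). fpart m u (modes N)"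
  let ?uv = "\<lambda>x. a * u x + b * v x"
  have sq: "sq_int ?M w" "sq_int ?M z" using w z by (auto simp: mult_lim_def L2_iff)
  have s: "sq_int ?M (?s u N)" "sq_int ?M (?s v N)" "sq_int ?M (?s ?uv N)" for N
    by (intro fpart_sq_int u v m L2_lincomb; simp)+
  have "l2 ?M (\<lambda>x. a * w x + b * z x - ?s ?uv N x)
      \<le> norm a * l2 ?M (\<lambda>x. w x - ?s u N x) + norm b * l2 ?M (\<lambda>x. z x - ?s v N x)" for N
  proof -
    have "l2 ?M (\<lambda>x. a * w x + b * z x - ?s ?uv N x)
        = l2 ?M (\<lambda>x. a * (w x - ?s u N x) + b * (z x - ?s v N x))"
    proof (rule l2_cong_AE)
      show "AE x in ?M. a * w x + b * z x - ?s ?uv N x = a * (w x - ?s u N x) + b * (z x - ?s v N x)"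
        using fpart_lincomb[OF \<kappa> u v, where m=m and K="modes N" and a=a and b=b] m
        by (auto simp: algebra_simps elim!: AE_mp)
    qed (intro sq_int_measurable sq_int_diff sq_int_add sq_int_cmult sq s)+
    also have "\<dots> \<le> l2 ?M (\<lambda>x. a * (w x - ?s u N x)) + l2 ?M (\<lambda>x. b * (z x - ?s v N x))"
      by (intro l2_triangle sq_int_cmult sq_int_diff sq s)
    finally show ?thesis by (simp add: l2_cmult)
  qed
  moreover have "(\<lambda>N. norm a * l2 ?M (\<lambda>x. w x - ?s u N x) + norm b * l2 ?M (\<lambda>x. z x - ?s v N x))
      \<longlonglongrightarrow> norm a * 0 + norm b * 0"
    using w z by (intro tendsto_intros) (auto simp: mult_lim_def)
  ultimately show "(\<lambda>N. l2 ?M (\<lambda>x. a * w x + b * z x - ?s ?uv N x)) \<longlonglongrightarrow> 0"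
    by (intro tendsto_0_le_bound[where f="\<lambda>N. l2 ?M (\<lambda>x. a * w x + b * z x - ?s ?uv N x)"]) simp_all
qed

section \<open>The Hilbert transform on odd modes\<close>

definition odd_symbol :: "int \<Rightarrow> complex" where
  "odd_symbol k = (if odd k then hilbert_symbol k else 0)"

lemma norm_odd_symbol: "norm (odd_symbol k) \<le> 1"
  by (auto simp: odd_symbol_def hilbert_symbol_def norm_mult sgn_if)

lemma H_minus_eq: "H_minus \<kappa> u = (SOME w. mult_lim \<kappa> odd_symbol u w)"
  by (simp add: H_minus_def odd_symbol_def[abs_def] fiber_multiplier_eq)

lemma H_minus_lim: "u \<in> L2 \<kappa> bdry \<Longrightarrow> mult_lim \<kappa> odd_symbol u (H_minus \<kappa> u)"
  unfolding H_minus_eq using mult_lim_exists[of u \<kappa> odd_symbol] norm_odd_symbol by (metis someI)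

lemma H_minus_L2: "u \<in> L2 \<kappa> bdry \<Longrightarrow> H_minus \<kappa> u \<in> L2 \<kappa> bdry"
  using H_minus_lim by (auto simp: mult_lim_def)

lemma H_minus_norm: "u \<in> L2 \<kappa> bdry \<Longrightarrow> l2 (dSigma \<kappa> bdry) (H_minus \<kappa> u) \<le> l2 (dSigma \<kappa> bdry) u"
  by (rule mult_lim_bound[where m=odd_symbol]) (simp_all add: norm_odd_symbol H_minus_lim)

lemma H_minus_unique: "u \<in> L2 \<kappa> bdry \<Longrightarrow> mult_lim \<kappa> odd_symbol u w \<Longrightarrow> eq_L2 \<kappa> bdry (H_minus \<kappa> u) w"
  by (rule mult_lim_unique[where m=odd_symbol]) (simp_all add: norm_odd_symbol H_minus_lim)

lemma H_minus_lincomb: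
  assumes "-1 < \<kappa>" "u \<in> L2 \<kappa> bdry" "v \<in> L2 \<kappa> bdry"
  shows "eq_L2 \<kappa> bdry (H_minus \<kappa> (\<lambda>x. a * u x + b * v x)) (\<lambda>x. a * H_minus \<kappa> u x + b * H_minus \<kappa> v x)"
  by (intro H_minus_unique L2_lincomb mult_lim_lincomb H_minus_lim assms) (rule norm_odd_symbol)

text \<open>\<open>H_minus\<close> is an unspecified representative, so oddness is borrowed from the
  limit w that is odd at every point. The difference d of the two is null, and so is its translate
  by pi, because that translation preserves the integral over the fundamental domain.\<close>

lemma H_minus_odd:
  assumes \<kappa>: "-1 < \<kappa>" and u: "u \<in> L2 \<kappa> bdry"
  shows "AE x in dSigma \<kappa> bdry. H_minus \<kappa> u (fst x, snd x + pi) = - H_minus \<kappa> u x"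
proof -
  obtain w where w: "mult_lim \<kappa> odd_symbol u w" and odd: "\<forall>\<beta> \<alpha>. w (\<beta>, \<alpha> + pi) = - w (\<beta>, \<alpha>)"
    using mult_lim_exists[OF u, of odd_symbol] norm_odd_symbol by (metis odd_symbol_def)
  have w2: "w \<in> L2 \<kappa> bdry" using w by (simp add: mult_lim_def)
  note H = H_minus_L2[OF u]
  define d where "d x = H_minus \<kappa> u x - w x" for x
  have "(\<lambda>x. 1 * H_minus \<kappa> u x + (-1) * w x) \<in> L2 \<kappa> bdry"
    using H w2 by (rule L2_lincomb)
  then have d: "d \<in> L2 \<kappa> bdry" by (simp add: d_def[abs_def])
  note db [measurable] = L2_bdry_borel[OF d]
  have [measurable]: "d \<in> borel_measurable (borel \<Otimes>\<^sub>M borel)" by (simp add: borel_prod)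
  have m2: "(\<lambda>x. d (fst x, snd x + pi)) \<in> borel_measurable borel"
    unfolding borel_prod[symmetric] by measurable
  have "eq_L2 \<kappa> bdry (H_minus \<kappa> u) w" by (rule H_minus_unique[OF u w])
  then have ae1: "AE x in lborel. x \<in> lift bdry \<longrightarrow> d x = 0"
    unfolding eq_L2_def AE_dSigma[OF \<kappa> borel_bdry] d_def by simp
  then have "energy (lift bdry) d = (\<integral>\<^sup>+(x::real\<times>real). 0 \<partial>lborel)"
    by (intro nn_integral_cong_AE) (auto simp: indicator_def elim!: AE_mp)
  then have "energy (lift bdry) (\<lambda>x. d (fst x, snd x + pi)) = 0"
    using nn_integral_antipode[of "\<lambda>x. ennreal ((norm (d x))\<^sup>2)"] by (simp add: L2_bdry_periodic[OF d])
  then have "AE x in lborel. ennreal ((norm (d (fst x, snd x + pi)))\<^sup>2) * indicator (lift bdry) x = 0"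
    using m2 by (subst (asm) nn_integral_0_iff_AE) auto
  with ae1 have "AE x in lborel. x \<in> lift bdry \<longrightarrow>
      H_minus \<kappa> u (fst x, snd x + pi) = - H_minus \<kappa> u x"
    by eventually_elim
      (use odd in \<open>auto simp: d_def indicator_def eq_neg_iff_add_eq_0\<close>)
  then show ?thesis unfolding AE_dSigma[OF \<kappa> borel_bdry] .
qed

subsection \<open>Absolutely convergent Fourier series\<close>

text \<open>The analytic Wiener algebra in the variable exp(2i\<alpha>): absolutely summable
  coefficients and no negative powers. Summability makes it closed under products and gives uniform
  convergence.\<close>

definition disk_series :: "(real \<Rightarrow> complex) \<Rightarrow> bool" where
  "disk_series F \<longleftrightarrow> (\<exists>a. summable (\<lambda>n. norm (a n)) \<and> (\<forall>\<alpha>. (\<lambda>n. a n * cis (2 * \<alpha>) ^ n) sums F \<alpha>))"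

lemma disk_series_monomial: "disk_series (\<lambda>\<alpha>. c * cis (2 * \<alpha>) ^ m)"
proof -
  have "(\<lambda>n. (if n = m then c else 0) * cis (2 * \<alpha>) ^ n) sums (c * cis (2 * \<alpha>) ^ m)" for \<alpha>
    using sums_single[of m "\<lambda>n. c * cis (2 * \<alpha>) ^ n"] by (simp add: if_distrib[of "\<lambda>x. x * _"] cong: if_cong)
  moreover have "summable (\<lambda>n. norm (if n = m then c else 0))"
    by (rule summable_finite[of "{m}"]) auto
  ultimately show ?thesis unfolding disk_series_def
    by (intro exI[of _ "\<lambda>n. if n = m then c else 0"]) auto
qed

lemmas disk_series_const = disk_series_monomial[where m=0, unfolded power_0 mult_1_right]
  and disk_series_cis = disk_series_monomial[where m=1 and c=1, unfolded power_one_right mult_1_left]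

lemma disk_series_inverse:
  assumes "\<bar>\<kappa>\<bar> < 1"
  shows "disk_series (\<lambda>\<alpha>. 1 / (1 + of_real \<kappa> * cis (2 * \<alpha>)))"
proof -
  have gs: "(\<lambda>n. (- of_real \<kappa> * cis (2 * \<alpha>)) ^ n) sums (1 / (1 - (- of_real \<kappa> * cis (2 * \<alpha>))))" for \<alpha>
    by (rule geometric_sums) (use assms in \<open>simp add: norm_mult\<close>)
  have "(\<lambda>n. (- of_real \<kappa>) ^ n * cis (2 * \<alpha>) ^ n) sums (1 / (1 + of_real \<kappa> * cis (2 * \<alpha>)))" for \<alpha>
  proof -
    have "1 - (- of_real \<kappa> * cis (2 * \<alpha>)) = 1 + of_real \<kappa> * cis (2 * \<alpha>)" by simp
    then show ?thesis using gs[of \<alpha>] by (simp only: power_mult_distrib)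
  qed
  moreover have "summable (\<lambda>n. norm ((- of_real \<kappa> :: complex) ^ n))"
    using assms by (simp add: norm_power summable_geometric)
  ultimately show ?thesis unfolding disk_series_def by blast
qed

lemma disk_series_add:
  assumes "disk_series F" "disk_series G"
  shows "disk_series (\<lambda>\<alpha>. F \<alpha> + G \<alpha>)"
proof -
  obtain a b where a: "summable (\<lambda>n. norm (a n))" "\<And>\<alpha>. (\<lambda>n. a n * cis (2 * \<alpha>) ^ n) sums F \<alpha>"
    and b: "summable (\<lambda>n. norm (b n))" "\<And>\<alpha>. (\<lambda>n. b n * cis (2 * \<alpha>) ^ n) sums G \<alpha>"
    using assms unfolding disk_series_def by blast
  have "(\<lambda>n. (a n + b n) * cis (2 * \<alpha>) ^ n) sums (F \<alpha> + G \<alpha>)" for \<alpha>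
    using sums_add[OF a(2) b(2)] by (simp add: distrib_right)
  moreover have "summable (\<lambda>n. norm (a n + b n))"
    by (rule summable_comparison_test'[OF summable_add[OF a(1) b(1)]]) (simp add: norm_triangle_ineq)
  ultimately show ?thesis unfolding disk_series_def by (intro exI[of _ "\<lambda>n. a n + b n"]) auto
qed

lemma disk_series_mult:
  assumes "disk_series F" "disk_series G"
  shows "disk_series (\<lambda>\<alpha>. F \<alpha> * G \<alpha>)"
proof -
  obtain a b where a: "summable (\<lambda>n. norm (a n))" "\<And>\<alpha>. (\<lambda>n. a n * cis (2 * \<alpha>) ^ n) sums F \<alpha>"
    and b: "summable (\<lambda>n. norm (b n))" "\<And>\<alpha>. (\<lambda>n. b n * cis (2 * \<alpha>) ^ n) sums G \<alpha>"
    using assms unfolding disk_series_def by blast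
  define c where "c n = (\<Sum>i\<le>n. a i * b (n - i))" for n
  have "(\<lambda>n. c n * cis (2 * \<alpha>) ^ n) sums (F \<alpha> * G \<alpha>)" for \<alpha>
  proof -
    have "(\<lambda>k. \<Sum>i\<le>k. (a i * cis (2 * \<alpha>) ^ i) * (b (k - i) * cis (2 * \<alpha>) ^ (k - i))) sums
        ((\<Sum>k. a k * cis (2 * \<alpha>) ^ k) * (\<Sum>k. b k * cis (2 * \<alpha>) ^ k))"
      by (rule Cauchy_product_sums) (use a(1) b(1) in \<open>simp_all add: norm_mult norm_power\<close>)
    also have "(\<lambda>k. \<Sum>i\<le>k. (a i * cis (2 * \<alpha>) ^ i) * (b (k - i) * cis (2 * \<alpha>) ^ (k - i))) = (\<lambda>n. c n * cis (2 * \<alpha>) ^ n)"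
    proof
      fix k
      have "(a i * cis (2 * \<alpha>) ^ i) * (b (k - i) * cis (2 * \<alpha>) ^ (k - i)) = a i * b (k - i) * cis (2 * \<alpha>) ^ k"
        if "i \<le> k" for i
      proof -
        have "cis (2 * \<alpha>) ^ k = cis (2 * \<alpha>) ^ i * cis (2 * \<alpha>) ^ (k - i)"
          using that by (simp only: power_add[symmetric] le_add_diff_inverse)
        then show ?thesis by simp
      qed
      then show "(\<Sum>i\<le>k. (a i * cis (2 * \<alpha>) ^ i) * (b (k - i) * cis (2 * \<alpha>) ^ (k - i))) = c k * cis (2 * \<alpha>) ^ k"
        unfolding c_def sum_distrib_right by (intro sum.cong) auto
    qed
    also have "(\<Sum>k. a k * cis (2 * \<alpha>) ^ k) = F \<alpha>" using a(2) by (rule sums_unique[symmetric])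
    also have "(\<Sum>k. b k * cis (2 * \<alpha>) ^ k) = G \<alpha>" using b(2) by (rule sums_unique[symmetric])
    finally show ?thesis .
  qed
  moreover have "summable (\<lambda>n. norm (c n))"
  proof (rule summable_comparison_test')
    show "summable (\<lambda>n. \<Sum>i\<le>n. norm (a i) * norm (b (n - i)))"
      by (rule sums_summable[OF Cauchy_product_sums]) (use a(1) b(1) in auto)
    show "norm (norm (c n)) \<le> (\<Sum>i\<le>n. norm (a i) * norm (b (n - i)))" for n
      unfolding c_def by (simp add: norm_mult[symmetric] norm_sum)
  qed
  ultimately show ?thesis unfolding disk_series_def by blast
qed

lemma disk_series_power: "disk_series F \<Longrightarrow> disk_series (\<lambda>\<alpha>. F \<alpha> ^ q)"
  by (induction q) (auto intro: disk_series_const disk_series_mult)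

lemma integral_fibm_series:
  assumes a: "summable (\<lambda>n. norm (a n))" and g: "\<And>\<alpha>. (\<lambda>n. a n * cis (of_int (k n) * \<alpha>)) sums g \<alpha>"
  shows "(\<lambda>n. a n * (if k n = l then of_real (2 * pi) else 0)) sums (LINT \<alpha>|fibm. g \<alpha> * cis (- (of_int l * \<alpha>)))"
proof -
  interpret finite_measure fibm by (rule finite_measure_fibm)
  have e: "integrable fibm (\<lambda>\<alpha>. a n * cis (of_int (k n - l) * \<alpha>))" for n
    by (rule integrable_const_bound[where B="norm (a n)"])
       (auto simp: norm_mult intro!: borel_imp_measurable_fibm)
  have eq: "a n * cis (of_int (k n - l) * \<alpha>) = a n * cis (of_int (k n) * \<alpha>) * cis (- (of_int l * \<alpha>))" for n \<alpha>
    by (simp add: cis_mult left_diff_distrib mult.assoc)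
  have "(\<lambda>n. LINT \<alpha>|fibm. a n * cis (of_int (k n - l) * \<alpha>)) sums
      (LINT \<alpha>|fibm. (\<Sum>n. a n * cis (of_int (k n - l) * \<alpha>)))"
  proof (rule sums_integral[OF e])
    show "AE \<alpha> in fibm. summable (\<lambda>n. norm (a n * cis (of_int (k n - l) * \<alpha>)))"
      using a by (simp add: norm_mult)
    show "summable (\<lambda>n. LINT \<alpha>|fibm. norm (a n * cis (of_int (k n - l) * \<alpha>)))"
      using summable_mult[OF a, of "measure fibm (space fibm)"] by (simp add: norm_mult)
  qed
  moreover have "(\<Sum>n. a n * cis (of_int (k n - l) * \<alpha>)) = g \<alpha> * cis (- (of_int l * \<alpha>))" for \<alpha>
    unfolding eq using sums_mult2[OF g[of \<alpha>], of "cis (- (of_int l * \<alpha>))"] by (rule sums_unique[symmetric])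
  moreover have "(LINT \<alpha>|fibm. a n * cis (of_int (k n - l) * \<alpha>)) = a n * (if k n = l then of_real (2 * pi) else 0)" for n
    by (simp only: integral_mult_right_zero integral_fibm_cis) simp
  ultimately show ?thesis by (simp only:)
qed

text \<open>All frequencies s(2n + 1) are odd and of one sign, so the symbol takes the single value
  -is on them and 0 on no term of the series. The multiplied partial sums are then a constant times
  the partial sums of g, which converge uniformly.\<close>

lemma mult_lim_signed_series:
  fixes s :: int
  assumes a: "summable (\<lambda>n. norm (a n))" and s: "\<bar>s\<bar> = 1"
    and g: "\<And>\<alpha>. (\<lambda>n. a n * cis (of_int (s * (2 * int n + 1)) * \<alpha>)) sums g \<alpha>"
    and L2: "(\<lambda>(\<beta>, \<alpha>). cis (of_int p * \<beta>) * g \<alpha>) \<in> L2 \<kappa> bdry" (is "?u \<in> _")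
  shows "mult_lim \<kappa> odd_symbol ?u (\<lambda>x. - \<i> * of_int s * ?u x)"
  unfolding mult_lim_def
proof
  let ?M = "dSigma \<kappa> bdry"
  show "(\<lambda>x. - \<i> * of_int s * ?u x) \<in> L2 \<kappa> bdry"
    using L2_lincomb[OF L2 L2, of "- \<i> * of_int s" 0] by simp
  define k where "k n = s * (2 * int n + 1)" for n
  have s0: "s \<noteq> 0" and ss: "s = 1 \<or> s = -1" using s by auto
  have inj: "inj k" using s0 by (auto simp: k_def inj_on_def)
  have oddk: "odd_symbol (k n) = - \<i> * of_int s" for n
    using ss by (auto simp: k_def odd_symbol_def hilbert_symbol_def sgn_if)
  define A where "A l = (LINT \<alpha>|fibm. g \<alpha> * cis (- (of_int l * \<alpha>))) / of_real (2 * pi)" for l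
  have sumsA: "(\<lambda>n. a n * (if k n = l then of_real (2 * pi) else 0)) sums (of_real (2 * pi) * A l)" for l
    using integral_fibm_series[OF a g[folded k_def], of l] by (simp add: A_def)
  have Ak: "A (k n) = a n" for n
  proof -
    have "(\<lambda>i. if i = n then a i * of_real (2 * pi) else 0) sums (of_real (2 * pi) * A (k n))"
      using sumsA[of "k n"] injD[OF inj]
      by (simp add: if_distrib[of "\<lambda>x. _ * x"] inj_eq[OF inj] cong: if_cong)
    moreover have "(\<lambda>i. if i = n then a i * of_real (2 * pi) else 0) sums (a n * of_real (2 * pi))"
      by (rule sums_single)
    ultimately show ?thesis using sums_unique2 by fastforce
  qed
  have A0: "A l = 0" if "l \<notin> range k" for l
  proof -
    have "(\<lambda>n. 0) sums (of_real (2 * pi) * A l)"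
    proof -
      have "k n \<noteq> l" for n using that by auto
      then show ?thesis using sumsA[of l] by simp
    qed
    then show ?thesis using sums_unique2[OF _ sums_zero] by fastforce
  qed
  have fc: "fiber_coeff ?u l \<beta> = cis (of_int p * \<beta>) * A l" for l \<beta>
  proof -
    have "of_real (2 * pi) * fiber_coeff ?u l \<beta> = (LINT \<alpha>|fibm. cis (of_int p * \<beta>) * (g \<alpha> * cis (- (of_int l * \<alpha>))))"
      unfolding fiber_coeff_eq by (simp add: mult.assoc)
    also have "\<dots> = of_real (2 * pi) * (cis (of_int p * \<beta>) * A l)"
      by (simp add: A_def)
    finally show ?thesis by simp
  qed
  \<comment> \<open>The number of n with 2n + 1 \<le> N, so that the window \<open>modes N\<close>
    captures exactly the first \<open>h N\<close> terms for either sign s.\<close>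
  define h where "h N = (N + 1) div 2" for N :: nat
  have fp: "fpart odd_symbol ?u (modes N) (\<beta>, \<alpha>)
      = - \<i> * of_int s * cis (of_int p * \<beta>) * (\<Sum>n<h N. a n * cis (of_int (k n) * \<alpha>))" for N \<beta> \<alpha>
  proof -
    have sub: "k ` {..<h N} \<subseteq> modes N"
      using ss by (auto simp: k_def h_def)
    have zero: "A l = 0" if "l \<in> modes N - k ` {..<h N}" for l
    proof (rule A0, rule notI)
      assume "l \<in> range k"
      then obtain n where n: "l = k n" by auto
      then have "int (2 * n + 1) \<le> int N" using that ss by (auto simp: k_def)
      then have "n < h N" by (simp add: h_def)
      then show False using that n by auto
    qed
    have "fpart odd_symbol ?u (modes N) (\<beta>, \<alpha>)
        = (\<Sum>l\<in>k ` {..<h N}. odd_symbol l * (cis (of_int p * \<beta>) * A l) * cis (of_int l * \<alpha>))"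
      unfolding fpart_def fc prod.case by (rule sum.mono_neutral_right) (use sub zero in auto)
    also have "\<dots> = (\<Sum>n<h N. - \<i> * of_int s * (cis (of_int p * \<beta>) * a n) * cis (of_int (k n) * \<alpha>))"
      by (subst sum.reindex) (use inj in \<open>auto simp: oddk Ak intro: inj_on_subset\<close>)
    finally show ?thesis by (simp add: sum_distrib_left mult_ac)
  qed
  \<comment> \<open>The tail of the coefficient norms bounds the error uniformly in x; on a finite
    measure this controls the \<open>l2\<close> norm.\<close>
  define T where "T N = (\<Sum>n. norm (a (n + h N)))" for N
  have bound: "norm (- \<i> * of_int s * ?u x - fpart odd_symbol ?u (modes N) x) \<le> T N" for x N
  proof (cases x)
    case (Pair \<beta> \<alpha>)
    have sm: "summable (\<lambda>n. a n * cis (of_int (k n) * \<alpha>))"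
      using g[of \<alpha>] unfolding k_def by (rule sums_summable)
    have "g \<alpha> - (\<Sum>n<h N. a n * cis (of_int (k n) * \<alpha>)) = (\<Sum>n. a (n + h N) * cis (of_int (k (n + h N)) * \<alpha>))"
      using suminf_minus_initial_segment[OF sm, of "h N"] sums_unique[OF g[of \<alpha>]] by (simp add: k_def)
    moreover have "norm (\<Sum>n. a (n + h N) * cis (of_int (k (n + h N)) * \<alpha>)) \<le> T N"
      unfolding T_def using summable_norm[of "\<lambda>n. a (n + h N) * cis (of_int (k (n + h N)) * \<alpha>)"] a
      by (simp add: norm_mult summable_iff_shift[of "\<lambda>n. norm (a n)"])
    moreover have "- \<i> * of_int s * ?u x - fpart odd_symbol ?u (modes N) x
        = - \<i> * of_int s * cis (of_int p * \<beta>) * (g \<alpha> - (\<Sum>n<h N. a n * cis (of_int (k n) * \<alpha>)))"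
      unfolding Pair fp prod.case by (simp only: right_diff_distrib mult.assoc)
    moreover have "norm (of_int s :: complex) = 1" using ss by auto
    ultimately show ?thesis by (simp add: norm_mult)
  qed
  have T0: "T N \<ge> 0" for N
    unfolding T_def by (intro suminf_nonneg) (use a in \<open>simp_all add: summable_iff_shift[of "\<lambda>n. norm (a n)"]\<close>)
  have meas: "(\<lambda>x. - \<i> * of_int s * ?u x - fpart odd_symbol ?u (modes N) x) \<in> borel_measurable ?M" for N
    by (rule borel_imp_measurable_dSigma)
       (intro borel_measurable_diff borel_measurable_times borel_measurable_const fpart_measurable L2_bdry_borel[OF L2])
  have le: "l2 ?M (\<lambda>x. - \<i> * of_int s * ?u x - fpart odd_symbol ?u (modes N) x)
      \<le> T N * sqrt (measure ?M (space ?M))" for N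
    using sq_int_bounded(2)[OF finite_measure_dSigma meas bound T0] by simp
  have "(\<lambda>m. \<Sum>n. norm (a (n + m))) \<longlonglongrightarrow> 0"
    using a by (rule suminf_exist_split2)
  moreover have "filterlim h at_top sequentially"
    unfolding filterlim_at_top eventually_sequentially
  proof
    fix Z show "\<exists>N. \<forall>n\<ge>N. Z \<le> h n"
      by (rule exI[of _ "2 * Z"]) (auto simp: h_def)
  qed
  ultimately have "T \<longlonglongrightarrow> 0"
    unfolding T_def by (rule filterlim_compose)
  then have lim: "(\<lambda>N. T N * sqrt (measure ?M (space ?M))) \<longlonglongrightarrow> 0"
    by (rule tendsto_mult_left_zero)
  show "(\<lambda>N. l2 ?M (\<lambda>x. - \<i> * of_int s * ?u x - fpart odd_symbol ?u (modes N) x)) \<longlonglongrightarrow> 0"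
    by (rule tendsto_0_le_bound[OF l2_nonneg le lim])
qed

subsection \<open>The fibrewise factor of the basis functions\<close>

definition psi :: "real \<Rightarrow> int \<Rightarrow> real \<Rightarrow> complex" where
  "psi \<kappa> q \<alpha> = of_real (sqrt (deriv (scat \<kappa>) \<alpha>)) * cis (of_int (2 * q + 1) * scat \<kappa> \<alpha>)"

lemma phi'_eq_psi: "phi' \<kappa> p q = (\<lambda>(\<beta>, \<alpha>). cis (of_int p * \<beta>) * psi \<kappa> q \<alpha>)"
  by (auto simp: fun_eq_iff phi'_def psi_def cis_mult[symmetric])

context
  fixes \<kappa> :: real
  assumes k: "- 1 < \<kappa>" "\<kappa> < 1"
begin

lemma re_denominator_pos: "1 + \<kappa> * cos t > 0"
proof -
  have "\<bar>\<kappa> * cos t\<bar> < 1"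
    using k mult_left_mono[OF abs_cos_le_one[of t], of "\<bar>\<kappa>\<bar>"] unfolding abs_mult by linarith
  then show ?thesis by linarith
qed

lemma denominator_nonzero: "1 + of_real \<kappa> * cis t \<noteq> 0"
proof
  assume "1 + of_real \<kappa> * cis t = 0"
  from arg_cong[OF this, of Re] show False using re_denominator_pos[of t] by simp
qed

lemma norm_denominator: "(norm (1 + of_real \<kappa> * cis t))\<^sup>2 = 1 + 2 * \<kappa> * cos t + \<kappa>\<^sup>2"
proof -
  have "(norm (1 + of_real \<kappa> * cis t))\<^sup>2 = (1 + \<kappa> * cos t)\<^sup>2 + (\<kappa> * sin t)\<^sup>2"
    by (simp add: cmod_power2)
  also have "\<dots> = 1 + 2 * \<kappa> * cos t + \<kappa>\<^sup>2 * ((cos t)\<^sup>2 + (sin t)\<^sup>2)"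
    by algebra
  finally show ?thesis by simp
qed

text \<open>\<open>scat_smooth_formula\<close> says that s(\<alpha>) is \<alpha> minus the argument
  of D = 1 + \<kappa> exp(2i\<alpha>); arctan yields this argument because Re D > 0.\<close>

lemma cis_scat:
  "cis (scat \<kappa> \<alpha>) = cis \<alpha> * of_real (norm (1 + of_real \<kappa> * cis (2 * \<alpha>))) / (1 + of_real \<kappa> * cis (2 * \<alpha>))"
proof -
  define D where "D = 1 + complex_of_real \<kappa> * cis (2 * \<alpha>)"
  define x y where "x = 1 + \<kappa> * cos (2 * \<alpha>)" and "y = \<kappa> * sin (2 * \<alpha>)"
  have D: "D = Complex x y" by (simp add: D_def x_def y_def complex_eq_iff)
  have x: "x > 0" unfolding x_def by (rule re_denominator_pos)
  have n: "norm D = sqrt (x\<^sup>2 + y\<^sup>2)" by (simp add: D cmod_def)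
  have sq: "sqrt (1 + (y / x)\<^sup>2) = norm D / x"
  proof -
    have "1 + (y / x)\<^sup>2 = (x\<^sup>2 + y\<^sup>2) / x\<^sup>2" using x by (simp add: power_divide add_divide_distrib)
    then show ?thesis using x by (simp add: n real_sqrt_divide)
  qed
  have "cis (arctan (y / x)) = D / of_real (norm D)"
    using x by (simp add: complex_eq_iff cos_arctan sin_arctan sq D Re_divide_of_real Im_divide_of_real)
  moreover have "scat \<kappa> \<alpha> = \<alpha> - arctan (y / x)"
    unfolding x_def y_def by (rule scat_smooth_formula[OF k])
  ultimately have "cis (scat \<kappa> \<alpha>) = cis \<alpha> / (D / of_real (norm D))"
    by (simp add: cis_divide[symmetric])
  then show ?thesis by (simp add: D_def)
qed

text \<open>The Poisson kernel of the point -\<kappa>, as expected for the derivative of the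
  argument of a Blaschke factor along the circle.\<close>

lemma deriv_scat: "deriv (scat \<kappa>) \<alpha> = (1 - \<kappa>\<^sup>2) / (norm (1 + of_real \<kappa> * cis (2 * \<alpha>)))\<^sup>2"
  using DERIV_imp_deriv[OF scat_has_derivative[OF k]] by (simp add: norm_denominator)

lemma cis_double_scat: "cis (2 * scat \<kappa> \<alpha>) = (cis (2 * \<alpha>) + of_real \<kappa>) / (1 + of_real \<kappa> * cis (2 * \<alpha>))"
proof -
  define D where "D = 1 + complex_of_real \<kappa> * cis (2 * \<alpha>)"
  have D0: "D \<noteq> 0" unfolding D_def by (rule denominator_nonzero)
  have "cis (2 * scat \<kappa> \<alpha>) = (cis (scat \<kappa> \<alpha>))\<^sup>2" by (simp add: power2_eq_square cis_mult)
  also have "\<dots> = (cis \<alpha>)\<^sup>2 * (of_real (norm D))\<^sup>2 / D\<^sup>2"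
    unfolding cis_scat D_def[symmetric] by (simp add: power_mult_distrib power_divide)
  also have "(of_real (norm D))\<^sup>2 = D * cnj D" by (simp only: of_real_power[symmetric] complex_norm_square)
  also have "(cis \<alpha>)\<^sup>2 * (D * cnj D) / D\<^sup>2 = (cis \<alpha>)\<^sup>2 * cnj D / D"
    using D0 by (simp add: power2_eq_square)
  also have "(cis \<alpha>)\<^sup>2 * cnj D = cis (2 * \<alpha>) + of_real \<kappa>"
    by (simp add: D_def power2_eq_square cis_mult cis_cnj distrib_left)
  finally show ?thesis by (simp add: D_def)
qed

text \<open>The factor |D| in \<open>cis_scat\<close> cancels against the 1 / |D| in the square root
  of s'. This cancellation is why the weight makes the basis analytic: only exp(i\<alpha>) and the
  holomorphic 1 / D are left.\<close>

lemma psi_0: "psi \<kappa> 0 \<alpha> = of_real (sqrt (1 - \<kappa>\<^sup>2)) * cis \<alpha> / (1 + of_real \<kappa> * cis (2 * \<alpha>))"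
  using denominator_nonzero[of "2 * \<alpha>"]
  by (simp add: psi_def cis_scat deriv_scat real_sqrt_divide)

lemma psi_add: "psi \<kappa> (q + r) \<alpha> = psi \<kappa> q \<alpha> * cis (2 * of_int r * scat \<kappa> \<alpha>)"
  by (simp add: psi_def mult.assoc cis_mult algebra_simps)

lemma psi_uminus: "psi \<kappa> (- q - 1) \<alpha> = cnj (psi \<kappa> q \<alpha>)"
  by (simp add: psi_def cis_cnj algebra_simps)

lemma psi_series:
  "\<exists>a. summable (\<lambda>n. norm (a n)) \<and> (\<forall>\<alpha>. (\<lambda>n. a n * cis (of_int (2 * int n + 1) * \<alpha>)) sums psi \<kappa> (int q) \<alpha>)"
proof -
  \<comment> \<open>The constant and 1 / (1 + \<kappa>z) come from \<open>psi_0\<close>, the rest is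
    the q-th power of the Blaschke factor. Each factor lies in the algebra since |\<kappa>| < 1 and
    q is a natural number.\<close>
  let ?F = "\<lambda>\<alpha>. of_real (sqrt (1 - \<kappa>\<^sup>2)) * (1 / (1 + of_real \<kappa> * cis (2 * \<alpha>))) *
    ((cis (2 * \<alpha>) + of_real \<kappa>) * (1 / (1 + of_real \<kappa> * cis (2 * \<alpha>)))) ^ q"
  have "disk_series ?F"
    using k by (intro disk_series_mult disk_series_add disk_series_power disk_series_const disk_series_cis
        disk_series_inverse) auto
  then obtain a where a: "summable (\<lambda>n. norm (a n))" "\<And>\<alpha>. (\<lambda>n. a n * cis (2 * \<alpha>) ^ n) sums ?F \<alpha>"
    unfolding disk_series_def by blast
  have psi: "psi \<kappa> (int q) \<alpha> = ?F \<alpha> * cis \<alpha>" for \<alpha>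
  proof -
    have "cis (2 * of_int (int q) * scat \<kappa> \<alpha>) = cis (2 * scat \<kappa> \<alpha>) ^ q"
      using Complex.DeMoivre[of "2 * scat \<kappa> \<alpha>" q] by (simp add: mult_ac)
    then have "psi \<kappa> (int q) \<alpha> = psi \<kappa> 0 \<alpha> * cis (2 * scat \<kappa> \<alpha>) ^ q"
      using psi_add[of 0 "int q" \<alpha>] by simp
    then show ?thesis by (simp add: psi_0 cis_double_scat)
  qed
  have e: "cis (of_int (2 * int n + 1) * \<alpha>) = cis (2 * \<alpha>) ^ n * cis \<alpha>" for n \<alpha>
    unfolding Complex.DeMoivre cis_mult by (simp add: algebra_simps)
  have "(\<lambda>n. a n * cis (of_int (2 * int n + 1) * \<alpha>)) sums psi \<kappa> (int q) \<alpha>" for \<alpha>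
    unfolding psi e using sums_mult2[OF a(2)[of \<alpha>], of "cis \<alpha>"] by (simp add: mult_ac)
  with a(1) show ?thesis by blast
qed

lemma continuous_on_scat: "continuous_on S (scat \<kappa>)"
  using scat_has_derivative[OF k] by (auto intro!: continuous_at_imp_continuous_on DERIV_isCont)

lemma continuous_on_psi: "continuous_on S (psi \<kappa> q)"
proof -
  have "continuous_on S (\<lambda>\<alpha>. of_real (sqrt ((1 - \<kappa>\<^sup>2) / (norm (1 + of_real \<kappa> * cis (2 * \<alpha>)))\<^sup>2))
      * cis (of_int (2 * q + 1) * scat \<kappa> \<alpha>))"
    by (intro continuous_intros continuous_on_scat) (simp add: denominator_nonzero)
  then show ?thesis by (simp add: psi_def[abs_def] deriv_scat)
qed

lemma norm_psi: "norm (psi \<kappa> q \<alpha>) = sqrt (deriv (scat \<kappa>) \<alpha>)" "deriv (scat \<kappa>) \<alpha> > 0"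
proof -
  have "\<kappa>\<^sup>2 < 1" using k by (simp add: abs_square_less_1 abs_less_iff)
  then show "deriv (scat \<kappa>) \<alpha> > 0" using denominator_nonzero[of "2 * \<alpha>"] by (simp add: deriv_scat)
  then show "norm (psi \<kappa> q \<alpha>) = sqrt (deriv (scat \<kappa>) \<alpha>)" by (simp add: psi_def norm_mult)
qed

lemma norm_psi_le: "norm (psi \<kappa> q \<alpha>) \<le> 1 / (1 - \<bar>\<kappa>\<bar>)"
proof -
  have k1: "1 - \<bar>\<kappa>\<bar> > 0" using k by auto
  have "1 - \<bar>\<kappa>\<bar> \<le> norm (1 + of_real \<kappa> * cis (2 * \<alpha>))"
    using norm_diff_ineq[of 1 "of_real \<kappa> * cis (2 * \<alpha>)"] by (simp add: norm_mult)
  then have "(1 - \<bar>\<kappa>\<bar>)\<^sup>2 \<le> (norm (1 + of_real \<kappa> * cis (2 * \<alpha>)))\<^sup>2"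
    using k1 by (intro power_mono) auto
  then have "deriv (scat \<kappa>) \<alpha> \<le> 1 / (1 - \<bar>\<kappa>\<bar>)\<^sup>2"
    unfolding deriv_scat using k1 by (intro frac_le) auto
  then have "sqrt (deriv (scat \<kappa>) \<alpha>) \<le> sqrt ((1 / (1 - \<bar>\<kappa>\<bar>))\<^sup>2)"
    by (intro real_sqrt_le_mono) (simp add: power_divide)
  then show ?thesis using k1 by (simp add: norm_psi)
qed

lemma scat_add_2pi: "scat \<kappa> (\<alpha> + 2 * pi) = scat \<kappa> \<alpha> + 2 * pi"
  using scat_add_pi[of \<kappa> \<alpha>] scat_add_pi[of \<kappa> "\<alpha> + pi"] by (simp add: add.assoc)

lemma phi'_measurable: "phi' \<kappa> p q \<in> borel_measurable borel"
proof -
  have [measurable]: "psi \<kappa> q \<in> borel_measurable borel"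
    by (intro borel_measurable_continuous_onI continuous_on_psi)
  show ?thesis unfolding phi'_eq_psi borel_prod[symmetric] by measurable
qed

lemma phi'_L2:
  assumes [measurable]: "A \<in> sets borel"
  shows "phi' \<kappa> p q \<in> L2 \<kappa> A"
  unfolding L2_iff
proof
  have "psi \<kappa> q (\<alpha> + 2 * pi) = psi \<kappa> q \<alpha>" for \<alpha>
  proof -
    have "deriv (scat \<kappa>) (\<alpha> + 2 * pi) = deriv (scat \<kappa>) \<alpha>"
      using cis_int_add_2pi[of 2 \<alpha>] by (simp add: deriv_scat)
    then show ?thesis by (simp only: psi_def scat_add_2pi cis_int_add_2pi)
  qed
  then show "periodic_on A (phi' \<kappa> p q)"
    by (auto simp: periodic_on_def phi'_eq_psi cis_int_add_2pi)
  show "sq_int (dSigma \<kappa> A) (phi' \<kappa> p q)"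
    by (rule sq_int_bounded(1)[OF finite_measure_dSigma, where C="1 / (1 - \<bar>\<kappa>\<bar>)"])
       (auto simp: phi'_eq_psi norm_mult norm_psi_le
         intro!: borel_imp_measurable_dSigma phi'_measurable[unfolded phi'_eq_psi])
qed

lemma mult_lim_phi':
  "mult_lim \<kappa> odd_symbol (phi' \<kappa> p q) (\<lambda>x. - \<i> * of_int (if q \<ge> 0 then 1 else -1) * phi' \<kappa> p q x)"
proof (cases "q \<ge> 0")
  case True
  then obtain a where a: "summable (\<lambda>n. norm (a n))"
      "\<And>\<alpha>. (\<lambda>n. a n * cis (of_int (2 * int n + 1) * \<alpha>)) sums psi \<kappa> q \<alpha>"
    using psi_series[of "nat q"] by auto
  show ?thesis
    using mult_lim_signed_series[OF a(1), of 1 "psi \<kappa> q" p \<kappa>] a(2) True phi'_L2[OF borel_bdry, of p q]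
    by (simp add: phi'_eq_psi)
next
  case False
  then obtain a where a: "summable (\<lambda>n. norm (a n))"
      "\<And>\<alpha>. (\<lambda>n. a n * cis (of_int (2 * int n + 1) * \<alpha>)) sums psi \<kappa> (- q - 1) \<alpha>"
    using psi_series[of "nat (- q - 1)"] by auto
  have "(\<lambda>n. cnj (a n) * cis (of_int (- 1 * (2 * int n + 1)) * \<alpha>)) sums psi \<kappa> q \<alpha>" for \<alpha>
  proof -
    have "cnj (cis (of_int (2 * int n + 1) * \<alpha>)) = cis (of_int (- 1 * (2 * int n + 1)) * \<alpha>)" for n
      by (simp add: cis_cnj algebra_simps)
    then show ?thesis
      using sums_cnj[THEN iffD2, OF a(2)[of \<alpha>]] psi_uminus[of q \<alpha>] by (simp only: complex_cnj_mult complex_cnj_cnj)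
  qed
  then show ?thesis
    using mult_lim_signed_series[of "\<lambda>n. cnj (a n)" "-1" "psi \<kappa> q" p \<kappa>] a(1) False phi'_L2[OF borel_bdry, of p q]
    by (simp add: phi'_eq_psi)
qed

end

subsection \<open>Finite linear combinations\<close>

text \<open>Membership in the linear span, with the finite index set and the coefficients in the
  shape that \<open>complete_orthogonal_system\<close> asks for.\<close>

definition lin_comb :: "'i set \<Rightarrow> ('i \<Rightarrow> 'a \<Rightarrow> complex) \<Rightarrow> ('a \<Rightarrow> complex) \<Rightarrow> bool" where
  "lin_comb I e f \<longleftrightarrow> (\<exists>F c. finite F \<and> F \<subseteq> I \<and> f = (\<lambda>x. \<Sum>i\<in>F. c i * e i x))"

lemma lin_comb_base: "i \<in> I \<Longrightarrow> lin_comb I e (e i)"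
  unfolding lin_comb_def by (intro exI[of _ "{i}"] exI[of _ "\<lambda>_. 1"]) auto

lemma lin_comb_zero: "lin_comb I e (\<lambda>x. 0)"
  unfolding lin_comb_def by (intro exI[of _ "{}"]) auto

lemma lin_comb_add:
  assumes "lin_comb I e f" "lin_comb I e g"
  shows "lin_comb I e (\<lambda>x. f x + g x)"
proof -
  obtain F c where F: "finite F" "F \<subseteq> I" "f = (\<lambda>x. \<Sum>i\<in>F. c i * e i x)"
    using assms(1) unfolding lin_comb_def by blast
  obtain G d where G: "finite G" "G \<subseteq> I" "g = (\<lambda>x. \<Sum>i\<in>G. d i * e i x)"
    using assms(2) unfolding lin_comb_def by blast
  let ?c = "\<lambda>i. (if i \<in> F then c i else 0) + (if i \<in> G then d i else 0)"
  have f: "f x = (\<Sum>i\<in>F \<union> G. (if i \<in> F then c i else 0) * e i x)" for x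
    unfolding F(3) using F(1) G(1) by (intro sum.mono_neutral_cong_left) auto
  have g: "g x = (\<Sum>i\<in>F \<union> G. (if i \<in> G then d i else 0) * e i x)" for x
    unfolding G(3) using F(1) G(1) by (intro sum.mono_neutral_cong_left) auto
  have "(\<lambda>x. f x + g x) = (\<lambda>x. \<Sum>i\<in>F \<union> G. ?c i * e i x)"
    unfolding f g by (simp add: sum.distrib[symmetric] distrib_right)
  then show ?thesis unfolding lin_comb_def
    using F(1,2) G(1,2) by (intro exI[of _ "F \<union> G"] exI[of _ ?c]) auto
qed

lemma lin_comb_cmult: "lin_comb I e f \<Longrightarrow> lin_comb I e (\<lambda>x. a * f x)"
proof -
  assume "lin_comb I e f"
  then obtain F c where F: "finite F" "F \<subseteq> I" "f = (\<lambda>x. \<Sum>i\<in>F. c i * e i x)"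
    unfolding lin_comb_def by blast
  then have "(\<lambda>x. a * f x) = (\<lambda>x. \<Sum>i\<in>F. (a * c i) * e i x)"
    by (simp add: sum_distrib_left mult.assoc)
  with F(1,2) show ?thesis unfolding lin_comb_def by (intro exI[of _ F] exI[of _ "\<lambda>i. a * c i"]) auto
qed

lemma lin_comb_diff: "lin_comb I e f \<Longrightarrow> lin_comb I e g \<Longrightarrow> lin_comb I e (\<lambda>x. f x - g x)"
  using lin_comb_add[OF _ lin_comb_cmult[of I e g "-1"], of f] by simp

lemma lin_comb_sum: "(\<And>j. j \<in> J \<Longrightarrow> lin_comb I e (f j)) \<Longrightarrow> lin_comb I e (\<lambda>x. \<Sum>j\<in>J. f j x)"
  by (induction J rule: infinite_finite_induct) (auto intro: lin_comb_zero lin_comb_add)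

text \<open>The span of a family closed under products is an algebra, which is how polynomials in
  the torus coordinates will stay inside the span.\<close>

lemma lin_comb_times:
  assumes "lin_comb UNIV e f" "lin_comb UNIV e g" and e: "\<And>i j. \<exists>k. \<forall>x. e i x * e j x = e k x"
  shows "lin_comb UNIV e (\<lambda>x. f x * g x)"
proof -
  obtain F c where F: "f = (\<lambda>x. \<Sum>i\<in>F. c i * e i x)"
    using assms(1) unfolding lin_comb_def by blast
  obtain G d where G: "g = (\<lambda>x. \<Sum>i\<in>G. d i * e i x)"
    using assms(2) unfolding lin_comb_def by blast
  have "lin_comb UNIV e (\<lambda>x. e i x * e j x)" for i j
    using e[of i j] lin_comb_base[of _ UNIV e] by (metis (no_types, lifting) UNIV_I ext)
  then have "lin_comb UNIV e (\<lambda>x. \<Sum>i\<in>F. \<Sum>j\<in>G. (c i * d j) * (e i x * e j x))"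
    by (intro lin_comb_sum lin_comb_cmult)
  also have "(\<lambda>x. \<Sum>i\<in>F. \<Sum>j\<in>G. (c i * d j) * (e i x * e j x)) = (\<lambda>x. f x * g x)"
    unfolding F G sum_product by (simp add: mult_ac)
  finally show ?thesis .
qed

subsection \<open>Approximation by continuous functions\<close>

lemma l2_dominated_convergence:
  assumes f: "\<And>n. f n \<in> borel_measurable M" "g \<in> borel_measurable M" and w: "integrable M (\<lambda>x. (w x)\<^sup>2)"
    and lim: "AE x in M. (\<lambda>n. f n x) \<longlonglongrightarrow> g x" and bd: "\<And>n. AE x in M. norm (f n x - g x) \<le> w x"
  shows "(\<lambda>n. l2 M (\<lambda>x. f n x - g x)) \<longlonglongrightarrow> 0"
proof -
  note [measurable] = f
  have "(\<lambda>n. LINT x|M. (norm (f n x - g x))\<^sup>2) \<longlonglongrightarrow> (LINT x|M. 0)"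
  proof (rule integral_dominated_convergence[OF _ _ w])
    show "AE x in M. (\<lambda>n. (norm (f n x - g x))\<^sup>2) \<longlonglongrightarrow> 0"
      using lim
    proof eventually_elim
      case (elim x)
      then have "(\<lambda>n. (norm (f n x - g x))\<^sup>2) \<longlonglongrightarrow> (norm (g x - g x))\<^sup>2" by (intro tendsto_intros)
      then show ?case by simp
    qed
    show "AE x in M. norm ((norm (f n x - g x))\<^sup>2) \<le> (w x)\<^sup>2" for n
      using bd[of n] by eventually_elim (auto intro: power_mono)
  qed auto
  then have "(\<lambda>n. sqrt (LINT x|M. (norm (f n x - g x))\<^sup>2)) \<longlonglongrightarrow> sqrt 0"
    by (intro tendsto_real_sqrt) simp
  then show ?thesis by (simp add: l2_def)
qed

text \<open>
  Approximants are cut off at the boundary of the rectangle by means of \<open>inner_dist\<close>: a continuous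
  function vanishing there descends to the torus, where the Stone--Weierstrass theorem applies.
\<close>

definition clip :: "real \<Rightarrow> complex \<Rightarrow> complex" where
  "clip m z = of_real (m / max m (norm z)) * z"

lemma norm_clip:
  assumes "m > 0"
  shows "norm (clip m z) \<le> m" "norm (clip m z) \<le> norm z"
proof -
  have p: "max m (norm z) > 0" using assms by auto
  have n: "norm (clip m z) = m / max m (norm z) * norm z"
    using assms p unfolding clip_def norm_mult norm_of_real by simp
  have "m / max m (norm z) * norm z = m * (norm z / max m (norm z))" by simp
  also have "\<dots> \<le> m * 1" using assms p by (intro mult_left_mono) auto
  finally show "norm (clip m z) \<le> m" unfolding n by simp
  have "m / max m (norm z) * norm z \<le> 1 * norm z" using assms p by (intro mult_right_mono) auto
  then show "norm (clip m z) \<le> norm z" unfolding n by simp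
qed

lemma continuous_on_clip [continuous_intros]:
  assumes "m > 0" "continuous_on S f"
  shows "continuous_on S (\<lambda>x. clip m (f x))"
proof -
  have "max m (norm (f x)) \<noteq> 0" for x using assms(1) by (auto simp: max_def)
  then show ?thesis unfolding clip_def by (intro continuous_intros assms(2)) auto
qed

lemma clip_measurable: "m > 0 \<Longrightarrow> clip m \<in> borel_measurable borel"
  by (intro borel_measurable_continuous_onI continuous_on_clip continuous_on_id)

lemma clip_eq: "norm z \<le> m \<Longrightarrow> m > 0 \<Longrightarrow> clip m z = z"
  by (simp add: clip_def max_def)

definition inner_dist :: "real \<times> real \<Rightarrow> real" where
  "inner_dist x = max 0 (min (min (fst x) (2 * pi - fst x)) (min (snd x + pi / 2) (pi / 2 - snd x)))"

lemma continuous_on_inner_dist [continuous_intros]: "continuous_on S inner_dist"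
  unfolding inner_dist_def[abs_def] by (intro continuous_intros)

lemma inner_dist_nonneg: "inner_dist x \<ge> 0"
  by (simp add: inner_dist_def)

lemma inner_dist_pos_iff:
  "inner_dist x > 0 \<longleftrightarrow> fst x \<in> {0<..<2 * pi} \<and> snd x \<in> {- pi / 2<..<pi / 2}"
  unfolding inner_dist_def less_max_iff_disj min_less_iff_conj by simp linarith

lemma inner_dist_eq_0_iff:
  "inner_dist x = 0 \<longleftrightarrow> fst x \<notin> {0<..<2 * pi} \<or> snd x \<notin> {- pi / 2<..<pi / 2}"
  using inner_dist_pos_iff[of x] inner_dist_nonneg[of x] by (auto simp: less_le)

lemma AE_fst_neq: "AE x in (lborel :: (real \<times> real) measure). fst x \<noteq> c"
  and AE_snd_neq: "AE x in (lborel :: (real \<times> real) measure). snd x \<noteq> c"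
proof -
  have "emeasure lborel (A \<times> B) = emeasure lborel A * emeasure lborel B"
    if "A \<in> sets borel" "B \<in> sets borel" for A B :: "real set"
    unfolding lborel_prod[symmetric] by (rule lborel.emeasure_pair_measure_Times) (use that in auto)
  then have "{c} \<times> UNIV \<in> null_sets (lborel :: (real \<times> real) measure)"
      "UNIV \<times> {c} \<in> null_sets (lborel :: (real \<times> real) measure)"
    by (auto simp: null_sets_def borel_prod[symmetric])
  then show "AE x in (lborel :: (real \<times> real) measure). fst x \<noteq> c"
      "AE x in (lborel :: (real \<times> real) measure). snd x \<noteq> c"
    by (auto dest!: AE_not_in elim!: AE_mp)
qed

lemma AE_inner_dist_pos:
  assumes "-1 < \<kappa>"
  shows "AE x in dSigma \<kappa> bdry_plus. inner_dist x > 0"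
proof -
  have "AE x in (lborel :: (real \<times> real) measure). x \<in> lift bdry_plus \<longrightarrow> inner_dist x > 0"
    using AE_fst_neq[of 0] AE_snd_neq[of "- pi / 2"] AE_snd_neq[of "pi / 2"]
    by eventually_elim (auto simp: lift_bdry_plus inner_dist_pos_iff)
  then show ?thesis unfolding AE_dSigma[OF assms borel_bdry_plus] .
qed

text \<open>\<open>measurable_on\<close> gives continuous g n converging almost everywhere, but
  without any bound. Clipping at a level m restores domination and costs little in norm once m is
  large; the factor min 1 (n * \<open>inner_dist\<close>) vanishes on the edges and is eventually 1
  at each interior point. The two errors take \<epsilon> / 2 each.\<close>

lemma continuous_approximation:
  assumes \<kappa>: "-1 < \<kappa>" and f: "sq_int (dSigma \<kappa> bdry_plus) f" and \<epsilon>: "\<epsilon> > 0"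
  obtains h where "continuous_on UNIV h" "\<And>x. inner_dist x = 0 \<Longrightarrow> h x = 0"
    "sq_int (dSigma \<kappa> bdry_plus) h" "l2 (dSigma \<kappa> bdry_plus) (\<lambda>x. f x - h x) < \<epsilon>"
proof -
  let ?M = "dSigma \<kappa> bdry_plus"
  note fin = finite_measure_dSigma[OF borel_bdry_plus, of \<kappa>]
  interpret finite_measure ?M by (rule fin)
  note [measurable] = sq_int_measurable[OF f] clip_measurable
  define f0 where "f0 x = (if x \<in> lift bdry_plus then f x else 0)" for x
  have f0: "f0 \<in> borel_measurable borel"
    unfolding f0_def using sq_int_measurable[OF f] by (simp add: measurable_dSigma_iff)
  then have "f0 \<in> borel_measurable lebesgue" by (intro measurable_completion) simp
  then have "f0 measurable_on UNIV"
    by (intro lebesgue_measurable_imp_measurable_on) auto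
  then obtain N g where N: "negligible N" and g: "\<And>n. continuous_on UNIV (g n)"
      "\<And>x. x \<notin> N \<Longrightarrow> (\<lambda>n. g n x) \<longlonglongrightarrow> f0 x"
    unfolding measurable_on_def by auto
  have "AE x in lebesgue. x \<notin> N"
    using N by (intro AE_not_in) (simp add: negligible_iff_null_sets)
  then have "AE x in lborel. x \<notin> N" by (simp add: AE_completion_iff)
  then have AEg: "AE x in ?M. (\<lambda>n. g n x) \<longlonglongrightarrow> f x"
    unfolding AE_dSigma[OF \<kappa> borel_bdry_plus] 
  proof eventually_elim
    case (elim x)
    then show ?case using g(2)[of x] by (auto simp: f0_def)
  qed
  have "(\<lambda>n. l2 ?M (\<lambda>x. clip (real (Suc n)) (f x) - f x)) \<longlonglongrightarrow> 0"
  proof (rule l2_dominated_convergence)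
    show "integrable ?M (\<lambda>x. (2 * norm (f x))\<^sup>2)"
      using sq_int_integrable[OF f] by (simp add: power_mult_distrib)
    show "AE x in ?M. norm (clip (real (Suc n)) (f x) - f x) \<le> 2 * norm (f x)" for n
    proof (intro AE_I2)
      fix x
      have "norm (clip (real (Suc n)) (f x)) \<le> norm (f x)" by (rule norm_clip) simp
      then show "norm (clip (real (Suc n)) (f x) - f x) \<le> 2 * norm (f x)"
        using norm_triangle_ineq4[of "clip (real (Suc n)) (f x)" "f x"] by linarith
    qed
    show "AE x in ?M. (\<lambda>n. clip (real (Suc n)) (f x)) \<longlonglongrightarrow> f x"
    proof (intro AE_I2 tendsto_eventually)
      fix x
      obtain n0 :: nat where "norm (f x) \<le> real n0" using real_arch_simple by blast
      then show "\<forall>\<^sub>F n in sequentially. clip (real (Suc n)) (f x) = f x"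
        unfolding eventually_sequentially by (intro exI[of _ n0] allI impI clip_eq) auto
    qed
  qed (auto intro!: measurable_compose[OF sq_int_measurable[OF f] clip_measurable] sq_int_measurable[OF f])
  then obtain n1 where n1: "l2 ?M (\<lambda>x. clip (real (Suc n1)) (f x) - f x) < \<epsilon> / 2"
    using \<epsilon> unfolding LIMSEQ_def dist_real_def by (metis half_gt_zero order_refl abs_of_nonneg diff_zero l2_nonneg)
  define m where "m = real (Suc n1)"
  have m: "m > 0" by (simp add: m_def)
  define h where "h n x = of_real (min 1 (real n * inner_dist x)) * clip m (g n x)" for n x
  have h_cont: "continuous_on UNIV (h n)" for n
    unfolding h_def by (intro continuous_intros m g(1))
  have hm: "h n \<in> borel_measurable ?M" for n
    by (intro borel_imp_measurable_dSigma borel_measurable_continuous_onI h_cont)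
  have fm: "(\<lambda>x. clip m (f x)) \<in> borel_measurable ?M"
    by (rule measurable_compose[OF sq_int_measurable[OF f] clip_measurable[OF m]])
  have h_bd: "norm (h n x) \<le> m" for n x
  proof -
    have "\<bar>min 1 (real n * inner_dist x)\<bar> \<le> 1" using inner_dist_nonneg[of x] by auto
    then have "\<bar>min 1 (real n * inner_dist x)\<bar> * norm (clip m (g n x)) \<le> 1 * m"
      using m by (intro mult_mono norm_clip) auto
    then show ?thesis by (simp only: h_def norm_mult norm_of_real)
  qed
  have "(\<lambda>n. l2 ?M (\<lambda>x. h n x - clip m (f x))) \<longlonglongrightarrow> 0"
  proof (rule l2_dominated_convergence[OF hm fm])
    show "integrable ?M (\<lambda>x. (2 * m)\<^sup>2)" by simp
    show "AE x in ?M. norm (h n x - clip m (f x)) \<le> 2 * m" for n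
    proof (intro AE_I2)
      fix x
      show "norm (h n x - clip m (f x)) \<le> 2 * m"
        using norm_triangle_ineq4[of "h n x" "clip m (f x)"] h_bd[of n x] norm_clip(1)[OF m, of "f x"] by linarith
    qed
    show "AE x in ?M. (\<lambda>n. h n x) \<longlonglongrightarrow> clip m (f x)"
      using AEg AE_inner_dist_pos[OF \<kappa>]
    proof eventually_elim
      case (elim x)
      have "continuous_on UNIV (clip m)" by (intro continuous_on_clip m continuous_on_id)
      then have 1: "(\<lambda>n. clip m (g n x)) \<longlonglongrightarrow> clip m (f x)"
        using elim(1) by (rule continuous_on_tendsto_compose) auto
      obtain n0 where n0: "1 < real n0 * inner_dist x" using elim(2) reals_Archimedean3 by blast
      have "\<forall>\<^sub>F n in sequentially. clip m (g n x) = h n x"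
        unfolding eventually_sequentially
      proof (intro exI[of _ n0] allI impI)
        fix n assume "n0 \<le> n"
        then have "real n0 * inner_dist x \<le> real n * inner_dist x"
          using inner_dist_nonneg by (intro mult_right_mono) auto
        then have "min 1 (real n * inner_dist x) = 1" using n0 by auto
        then show "clip m (g n x) = h n x" by (simp add: h_def)
      qed
      then show ?case by (rule Lim_transform_eventually[OF 1])
    qed
  qed
  then obtain n where n: "l2 ?M (\<lambda>x. h n x - clip m (f x)) < \<epsilon> / 2"
    using \<epsilon> unfolding LIMSEQ_def dist_real_def by (metis half_gt_zero order_refl abs_of_nonneg diff_zero l2_nonneg)
  have hs: "sq_int ?M (h n)" by (rule sq_int_bounded(1)[OF fin hm h_bd])
  have cs: "sq_int ?M (\<lambda>x. clip m (f x))"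
    by (rule sq_int_bounded(1)[OF fin fm norm_clip(1)[OF m]])
  have "l2 ?M (\<lambda>x. f x - h n x) = l2 ?M (\<lambda>x. (h n x - clip m (f x)) + (clip m (f x) - f x))"
    by (subst l2_minus_commute) simp
  also have "\<dots> \<le> l2 ?M (\<lambda>x. h n x - clip m (f x)) + l2 ?M (\<lambda>x. clip m (f x) - f x)"
    by (intro l2_triangle sq_int_diff hs cs f)
  also have "\<dots> < \<epsilon>" using n n1 by (simp add: m_def)
  finally show thesis
    using that[OF h_cont _ hs] by (simp add: h_def)
qed

subsection \<open>Completeness of the exponential basis\<close>

context
  fixes \<kappa> :: real
  assumes k: "- 1 < \<kappa>" "\<kappa> < 1"
begin

lemma scat_strict_mono: "a < b \<Longrightarrow> scat \<kappa> a < scat \<kappa> b"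
  by (rule DERIV_pos_imp_increasing)
     (use scat_has_derivative[OF k] norm_psi(2)[OF k] DERIV_imp_deriv[OF scat_has_derivative[OF k]] in metis)+

lemma scat_le_iff: "scat \<kappa> a \<le> scat \<kappa> b \<longleftrightarrow> a \<le> b"
  using scat_strict_mono[of a b] scat_strict_mono[of b a] by (cases a b rule: linorder_cases) auto

lemma scat_eq_iff: "scat \<kappa> a = scat \<kappa> b \<longleftrightarrow> a = b"
  using scat_le_iff[of a b] scat_le_iff[of b a] by auto

lemma scat_half_pi: "scat \<kappa> (pi / 2) = pi / 2" "scat \<kappa> (- pi / 2) = - pi / 2"
  by (simp_all add: scat_def)

text \<open>The Laurent monomials \<open>z^p * w^q\<close> on the torus, pulled back by
  \<open>torus_map\<close>.\<close>

definition etrig :: "int \<times> int \<Rightarrow> real \<times> real \<Rightarrow> complex" where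
  "etrig = (\<lambda>(p, q) (\<beta>, \<alpha>). cis (of_int p * \<beta> + 2 * of_int q * scat \<kappa> \<alpha>))"

definition torus_map :: "real \<times> real \<Rightarrow> complex \<times> complex" where
  "torus_map = (\<lambda>(\<beta>, \<alpha>). (cis \<beta>, cis (2 * scat \<kappa> \<alpha>)))"

lemma etrig_times: "\<exists>k. \<forall>x. etrig i x * etrig j x = etrig k x"
  by (rule exI[of _ "(fst i + fst j, snd i + snd j)"])
     (auto simp: etrig_def split_beta cis_mult algebra_simps)

lemma phi'_eq_etrig: "phi' \<kappa> p q x = psi \<kappa> 0 (snd x) * etrig (p, q) x"
  using psi_add[OF k, of 0 q "snd x"] by (simp add: phi'_eq_psi etrig_def split_beta cis_mult[symmetric])

lemma lin_comb_trig:
  "lin_comb UNIV etrig (\<lambda>x. of_real (Re (cis (of_int a * fst x + 2 * of_int b * scat \<kappa> (snd x)))))"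
  "lin_comb UNIV etrig (\<lambda>x. of_real (Im (cis (of_int a * fst x + 2 * of_int b * scat \<kappa> (snd x)))))"
proof -
  let ?z = "\<lambda>x. cis (of_int a * fst x + 2 * of_int b * scat \<kappa> (snd x))"
  have "of_int (- a) * fst x + 2 * of_int (- b) * scat \<kappa> (snd x)
      = - (of_int a * fst x + 2 * of_int b * scat \<kappa> (snd x))" for x by simp
  then have e: "etrig (a, b) x = ?z x" "etrig (- a, - b) x = cnj (?z x)" for x
    unfolding etrig_def split_beta fst_conv snd_conv cis_cnj by (simp_all only:)
  have "lin_comb UNIV etrig (\<lambda>x. 1 / 2 * (etrig (a, b) x + etrig (- a, - b) x))"
    by (intro lin_comb_cmult lin_comb_add lin_comb_base) auto
  moreover have "1 / 2 * (etrig (a, b) x + etrig (- a, - b) x) = of_real (Re (?z x))" for x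
    unfolding e complex_add_cnj by simp
  ultimately show "lin_comb UNIV etrig (\<lambda>x. of_real (Re (?z x)))" by simp
  have "lin_comb UNIV etrig (\<lambda>x. 1 / (2 * \<i>) * (etrig (a, b) x - etrig (- a, - b) x))"
    by (intro lin_comb_cmult lin_comb_diff lin_comb_base) auto
  moreover have "1 / (2 * \<i>) * (etrig (a, b) x - etrig (- a, - b) x) = of_real (Im (?z x))" for x
    unfolding e complex_diff_cnj by (simp add: complex_eq_iff)
  ultimately show "lin_comb UNIV etrig (\<lambda>x. of_real (Im (?z x)))" by simp
qed

text \<open>Polynomials here are real ones in the four real coordinates of the two complex
  variables. A linear form is a combination of real and imaginary parts of the two coordinate
  monomials, and products remain in the span by \<open>etrig_times\<close>.\<close>

lemma lin_comb_polynomial: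
  assumes "real_polynomial_function r"
  shows "lin_comb UNIV etrig (\<lambda>x. of_real (r (torus_map x)))"
  using assms
proof induction
  case (linear f)
  interpret f: bounded_linear f by fact
  have f: "f (z, w) = f (1, 0) * Re z + f (\<i>, 0) * Im z + f (0, 1) * Re w + f (0, \<i>) * Im w" for z w
  proof -
    have "(z, w) = Re z *\<^sub>R (1, 0) + Im z *\<^sub>R (\<i>, 0) + Re w *\<^sub>R (0, 1) + Im w *\<^sub>R (0, \<i>)"
      by (simp add: complex_eq_iff)
    then have "f (z, w) = f (Re z *\<^sub>R (1, 0) + Im z *\<^sub>R (\<i>, 0) + Re w *\<^sub>R (0, 1) + Im w *\<^sub>R (0, \<i>))"
      by simp
    then show ?thesis by (simp only: f.add f.scaleR real_scaleR_def mult.commute)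
  qed
  have z: "lin_comb UNIV etrig (\<lambda>x. of_real (Re (cis (fst x))))" "lin_comb UNIV etrig (\<lambda>x. of_real (Im (cis (fst x))))"
    using lin_comb_trig[of 1 0] by simp_all
  have w: "lin_comb UNIV etrig (\<lambda>x. of_real (Re (cis (2 * scat \<kappa> (snd x)))))"
      "lin_comb UNIV etrig (\<lambda>x. of_real (Im (cis (2 * scat \<kappa> (snd x)))))"
    using lin_comb_trig[of 0 1] by simp_all
  have "lin_comb UNIV etrig (\<lambda>x. of_real (f (1, 0)) * of_real (Re (cis (fst x))) + of_real (f (\<i>, 0)) * of_real (Im (cis (fst x)))
      + of_real (f (0, 1)) * of_real (Re (cis (2 * scat \<kappa> (snd x)))) + of_real (f (0, \<i>)) * of_real (Im (cis (2 * scat \<kappa> (snd x)))))"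
    by (rule lin_comb_add lin_comb_cmult z w)+
  moreover have "f (torus_map x) = f (1, 0) * Re (cis (fst x)) + f (\<i>, 0) * Im (cis (fst x))
      + f (0, 1) * Re (cis (2 * scat \<kappa> (snd x))) + f (0, \<i>) * Im (cis (2 * scat \<kappa> (snd x)))" for x
    unfolding torus_map_def split_beta by (rule f)
  ultimately show ?case by (simp only: of_real_add of_real_mult)
next
  case (const c)
  have "etrig (0, 0) x = 1" for x by (simp add: etrig_def split_beta)
  then show ?case using lin_comb_cmult[OF lin_comb_base[of "(0, 0)" UNIV etrig], of "of_real c"] by simp
next
  case (add f g)
  then show ?case using lin_comb_add[OF add.IH] by simp
next
  case (mult f g)
  then show ?case using lin_comb_times[OF mult.IH etrig_times] by simp
qed

lemma cis_eq_imp: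
  assumes "cis a = cis b" "a \<in> {c..c + 2 * pi}" "b \<in> {c..c + 2 * pi}" "a \<noteq> b"
  shows "a \<notin> {c<..<c + 2 * pi}" "b \<notin> {c<..<c + 2 * pi}"
proof -
  have "sin a = sin b \<and> cos a = cos b" using assms(1) by (simp add: complex_eq_iff)
  then obtain n :: int where n: "a = b + 2 * pi * of_int n" using sin_cos_eq_iff by blast
  with assms(2-4) have "n \<noteq> 0" "\<bar>2 * pi * of_int n\<bar> \<le> 2 * pi" by auto
  then have "\<bar>of_int n :: real\<bar> \<le> 1" by (simp add: abs_mult)
  with \<open>n \<noteq> 0\<close> have "n = 1 \<or> n = -1" by auto
  then show "a \<notin> {c<..<c + 2 * pi}" "b \<notin> {c<..<c + 2 * pi}" using n assms(2,3) by auto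
qed

text \<open>\<open>scat\<close> is increasing and fixes - pi / 2 and pi / 2, so 2s runs around the
  circle exactly once as \<alpha> crosses the closed interval. Only edge points of the rectangle can
  therefore be identified.\<close>

lemma torus_map_eq_imp:
  assumes "torus_map x = torus_map y" "x \<in> {0..2 * pi} \<times> {- pi / 2..pi / 2}"
    "y \<in> {0..2 * pi} \<times> {- pi / 2..pi / 2}" "x \<noteq> y"
  shows "inner_dist x = 0" "inner_dist y = 0"
proof -
  have e: "cis (fst x) = cis (fst y)" "cis (2 * scat \<kappa> (snd x)) = cis (2 * scat \<kappa> (snd y))"
    using assms(1) by (auto simp: torus_map_def split_beta)
  have s: "2 * scat \<kappa> a \<in> {- pi..- pi + 2 * pi}" if "a \<in> {- pi / 2..pi / 2}" for a
    using scat_le_iff[of a "pi / 2"] scat_le_iff[of "- pi / 2" a] that scat_half_pi by auto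
  have s': "2 * scat \<kappa> a \<in> {- pi<..<- pi + 2 * pi}" if "a \<in> {- pi / 2<..<pi / 2}" for a
    using scat_strict_mono[of a "pi / 2"] scat_strict_mono[of "- pi / 2" a] that scat_half_pi by auto
  consider "fst x \<noteq> fst y" | "snd x \<noteq> snd y" using assms(4) by (auto simp: prod_eq_iff)
  then have "inner_dist x = 0 \<and> inner_dist y = 0"
  proof cases
    case 1
    then show ?thesis
      using cis_eq_imp[OF e(1), of 0] assms(2,3) by (auto simp: inner_dist_eq_0_iff)
  next
    case 2
    then have "2 * scat \<kappa> (snd x) \<noteq> 2 * scat \<kappa> (snd y)" by (simp add: scat_eq_iff)
    then have "snd x \<notin> {- pi / 2<..<pi / 2}" "snd y \<notin> {- pi / 2<..<pi / 2}"
      using cis_eq_imp[OF e(2), of "- pi"] s[of "snd x"] s[of "snd y"] s'[of "snd x"] s'[of "snd y"] assms(2,3)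
      by (auto simp: mem_Times_iff)
    then show ?thesis unfolding inner_dist_eq_0_iff by blast
  qed
  then show "inner_dist x = 0" "inner_dist y = 0" by auto
qed

lemma continuous_on_torus_map: "continuous_on S torus_map"
  unfolding torus_map_def split_beta
  by (intro continuous_intros continuous_on_compose2[OF continuous_on_scat[OF k, of UNIV]]) auto

lemma psi_nonzero: "psi \<kappa> q \<alpha> \<noteq> 0"
  using norm_psi(1)[OF k, of q \<alpha>] norm_psi(2)[OF k, of \<alpha>] by auto

lemma uniform_approximation:
  assumes h: "continuous_on UNIV h" "\<And>x. inner_dist x = 0 \<Longrightarrow> h x = 0" and \<delta>: "\<delta> > 0"
  obtains t where "lin_comb UNIV (\<lambda>(p, q). phi' \<kappa> p q) t"
    "\<And>x. x \<in> {0..2 * pi} \<times> {- pi / 2..pi / 2} \<Longrightarrow> norm (h x - t x) \<le> \<delta>"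
proof -
  define K where "K = {0..2 * pi} \<times> {- pi / 2..pi / 2 :: real}"
  have K: "compact K" unfolding K_def by (intro compact_Times compact_Icc)
  define H where "H x = h x / psi \<kappa> 0 (snd x)" for x
  have Hc: "continuous_on S H" for S
    unfolding H_def using psi_nonzero
    by (intro continuous_intros continuous_on_compose2[OF continuous_on_psi[OF k, of UNIV]]
        continuous_on_subset[OF h(1)]) auto
  define G where "G t = H (SOME x. x \<in> K \<and> torus_map x = t)" for t
  have GH: "G (torus_map x) = H x" if x: "x \<in> K" for x
  proof -
    let ?y = "SOME y. y \<in> K \<and> torus_map y = torus_map x"
    have y: "?y \<in> K \<and> torus_map ?y = torus_map x" by (rule someI[of _ x]) (use x in simp)
    show ?thesis
    proof (cases "?y = x")
      case False
      then have "inner_dist ?y = 0" "inner_dist x = 0"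
        using torus_map_eq_imp[of ?y x] y x by (auto simp: K_def)
      then show ?thesis by (simp add: G_def H_def h(2))
    qed (simp add: G_def)
  qed
  have Kt: "compact (torus_map ` K)" using K by (intro compact_continuous_image continuous_on_torus_map)
  \<comment> \<open>\<open>torus_map\<close> acts on the compact \<open>K\<close> as a closed map:
    closed subsets have compact images, so preimages of closed sets under \<open>G\<close> are
    closed.\<close>
  have "continuous_on (torus_map ` K) G"
    unfolding continuous_on_closed_vimage[OF compact_imp_closed[OF Kt]]
  proof (intro allI impI)
    fix B :: "complex set" assume B: "closed B"
    have "G -` B \<inter> torus_map ` K = torus_map ` (K \<inter> H -` B)" using GH by auto
    moreover have "compact (K \<inter> H -` B)"
      using B K Hc[of UNIV] by (intro compact_Int_closed) (auto intro: continuous_closed_vimage simp: continuous_on_eq_continuous_at)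
    ultimately show "closed (G -` B \<inter> torus_map ` K)"
      by (simp add: compact_imp_closed compact_continuous_image continuous_on_torus_map)
  qed
  \<comment> \<open>The modulus of \<open>psi \<kappa> 0\<close> is at most 1 / (1 - |\<kappa>|), so
    this error becomes \<delta> after multiplying back.\<close>
  moreover define e where "e = \<delta> * (1 - \<bar>\<kappa>\<bar>)"
  have k1: "1 - \<bar>\<kappa>\<bar> > 0" using k by auto
  then have "e > 0" using \<delta> by (simp add: e_def)
  ultimately obtain g where g: "polynomial_function g" "\<And>t. t \<in> torus_map ` K \<Longrightarrow> norm (G t - g t) < e"
    using Stone_Weierstrass_polynomial_function[OF Kt, of G e] by metis
  have "real_polynomial_function (Re \<circ> g)" "real_polynomial_function (Im \<circ> g)"
    using g(1) bounded_linear_Re bounded_linear_Im unfolding polynomial_function_def by blast+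
  then have "lin_comb UNIV etrig (\<lambda>x. of_real (Re (g (torus_map x))) + \<i> * of_real (Im (g (torus_map x))))"
    using lin_comb_polynomial[of "Re \<circ> g"] lin_comb_polynomial[of "Im \<circ> g"]
    by (intro lin_comb_add lin_comb_cmult) simp_all
  then have "lin_comb UNIV etrig (\<lambda>x. g (torus_map x))" by (simp add: complex_eq[symmetric])
  then obtain F c where F: "finite F" "(\<lambda>x. g (torus_map x)) = (\<lambda>x. \<Sum>i\<in>F. c i * etrig i x)"
    unfolding lin_comb_def by blast
  define t where "t x = psi \<kappa> 0 (snd x) * g (torus_map x)" for x
  have "t = (\<lambda>x. \<Sum>i\<in>F. c i * (case i of (p, q) \<Rightarrow> phi' \<kappa> p q) x)"
    unfolding t_def fun_cong[OF F(2)] by (auto simp: fun_eq_iff sum_distrib_left split_beta phi'_eq_etrig mult_ac)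
  then have t: "lin_comb UNIV (\<lambda>(p, q). phi' \<kappa> p q) t"
    unfolding lin_comb_def using F(1) by blast
  have "norm (h x - t x) \<le> \<delta>" if x: "x \<in> K" for x
  proof -
    have "h x - t x = psi \<kappa> 0 (snd x) * (G (torus_map x) - g (torus_map x))"
      using psi_nonzero by (simp add: GH[OF x] H_def t_def right_diff_distrib)
    then have "norm (h x - t x) \<le> 1 / (1 - \<bar>\<kappa>\<bar>) * e"
      using g(2)[of "torus_map x"] x norm_psi_le[OF k, of 0 "snd x"] k1
      unfolding norm_mult by (simp only: norm_mult) (intro mult_mono, auto)
    then show ?thesis using k1 by (simp add: e_def)
  qed
  then show thesis using that[OF t] by (simp add: K_def)
qed

lemma phi'_dense:
  assumes f: "f \<in> L2 \<kappa> bdry_plus" and \<epsilon>: "\<epsilon> > 0"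
  obtains t where "lin_comb UNIV (\<lambda>(p, q). phi' \<kappa> p q) t" "l2 (dSigma \<kappa> bdry_plus) (\<lambda>x. f x - t x) < \<epsilon>"
proof -
  let ?M = "dSigma \<kappa> bdry_plus"
  note fin = finite_measure_dSigma[OF borel_bdry_plus, of \<kappa>]
  have f2: "sq_int ?M f" using f by (simp add: L2_iff)
  obtain h where h: "continuous_on UNIV h" "\<And>x. inner_dist x = 0 \<Longrightarrow> h x = 0" "sq_int ?M h"
      "l2 ?M (\<lambda>x. f x - h x) < \<epsilon> / 2"
    using continuous_approximation[OF k(1) f2, of "\<epsilon> / 2"] \<epsilon> by auto
  define m where "m = sqrt (measure ?M (space ?M))"
  have m: "m \<ge> 0" by (simp add: m_def)
  \<comment> \<open>The number m is the norm of the constant 1; adding 1 keeps the denominator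
    positive and makes \<delta> * m < \<epsilon> / 2 strict.\<close>
  define \<delta> where "\<delta> = \<epsilon> / (2 * (m + 1))"
  have \<delta>: "\<delta> > 0" using \<epsilon> m by (simp add: \<delta>_def)
  obtain t where t: "lin_comb UNIV (\<lambda>(p, q). phi' \<kappa> p q) t"
      "\<And>x. x \<in> {0..2 * pi} \<times> {- pi / 2..pi / 2} \<Longrightarrow> norm (h x - t x) \<le> \<delta>"
    using uniform_approximation[OF h(1,2) \<delta>] by metis
  have ts: "sq_int ?M t"
    using t(1) phi'_L2[OF k borel_bdry_plus] unfolding lin_comb_def L2_iff
    by (auto intro!: sq_int_sum sq_int_cmult simp: split_beta)
  have ht: "norm (h x - t x) \<le> \<delta>" if "x \<in> space ?M" for x
    using that t(2) by (auto simp: lift_bdry_plus)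
  have "l2 ?M (\<lambda>x. h x - t x) \<le> \<delta> * m"
    unfolding m_def using \<delta>
    by (intro sq_int_bounded(2)[OF fin _ ht] sq_int_measurable sq_int_diff h(3) ts) auto
  also have "\<delta> * m < \<epsilon> / 2"
    using \<epsilon> m by (simp add: \<delta>_def field_simps)
  finally have "l2 ?M (\<lambda>x. (f x - h x) + (h x - t x)) < \<epsilon>"
    using l2_triangle[OF sq_int_diff[OF f2 h(3)] sq_int_diff[OF h(3) ts]] h(4) by linarith
  then show thesis using that[OF t(1)] by simp
qed

end

subsection \<open>Orthogonality\<close>

lemma integral_dSigma:
  fixes f :: "real \<times> real \<Rightarrow> complex"
  assumes "-1 < \<kappa>" and [measurable]: "A \<in> sets borel" "f \<in> borel_measurable borel"
  shows "(LINT x|dSigma \<kappa> A. f x) = of_real (1 / (1 + \<kappa>)) * (LINT x|lborel. indicator (lift A) x *\<^sub>R f x)"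
proof -
  have [measurable]: "f \<in> borel_measurable (restrict_space lborel (lift A))"
    by (rule measurable_restrict_space1) simp
  have "(LINT x|dSigma \<kappa> A. f x) = (LINT x|restrict_space lborel (lift A). (1 / (1 + \<kappa>)) *\<^sub>R f x)"
    unfolding dSigma_def using assms(1) by (intro integral_density) auto
  also have "\<dots> = of_real (1 / (1 + \<kappa>)) * (LINT x|restrict_space lborel (lift A). f x)"
    by (simp add: scaleR_conv_of_real)
  also have "(LINT x|restrict_space lborel (lift A). f x)
      = (LINT x|lborel. indicator (lift A) x *\<^sub>R f x)"
    by (rule integral_restrict_space) simp
  finally show ?thesis .
qed

lemma lborel_integral_product:
  fixes f g :: "real \<Rightarrow> complex"
  assumes f: "integrable lborel f" and g: "integrable lborel g"
  shows "(LINT x|lborel. f (fst x) * g (snd x)) = (LINT x|lborel. f x) * (LINT x|lborel. g x)"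
proof -
  have [measurable]: "f \<in> borel_measurable borel" "g \<in> borel_measurable borel"
    using f g by auto
  have "integrable (lborel \<Otimes>\<^sub>M lborel) (\<lambda>x. f (fst x) * g (snd x))"
    by (rule lborel_pair.Fubini_integrable) (use f g in \<open>auto simp: norm_mult\<close>)
  then have "(LINT x|lborel. (LINT y|lborel. f x * g y)) = (LINT x|(lborel \<Otimes>\<^sub>M lborel). f (fst x) * g (snd x))"
    using lborel_pair.integral_fst'[of "\<lambda>x. f (fst x) * g (snd x)"] by simp
  then show ?thesis using f g by (simp add: lborel_prod)
qed

lemma bounded_operator_mono:
  assumes B: "bounded_operator \<kappa> X Y T" and X: "X' \<subseteq> X" and Y: "Y \<subseteq> Y'"
  shows "bounded_operator \<kappa> X' Y' T"
proof -
  note B' = B[unfolded bounded_operator_def]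
  show ?thesis
    unfolding bounded_operator_def
  proof (intro conjI)
    show "\<forall>u\<in>X'. T u \<in> Y'" using B' X Y by blast
    show "\<forall>u\<in>X'. \<forall>v\<in>X'. eq_L2 \<kappa> bdry_plus u v \<longrightarrow> eq_L2 \<kappa> bdry_plus (T u) (T v)"
      using B'[THEN conjunct2, THEN conjunct1] X by blast
    show "\<forall>u\<in>X'. \<forall>v\<in>X'. \<forall>a b. eq_L2 \<kappa> bdry_plus (T (\<lambda>x. a * u x + b * v x)) (\<lambda>x. a * T u x + b * T v x)"
      using B'[THEN conjunct2, THEN conjunct2, THEN conjunct1] X by (meson subsetD)
    show "\<exists>C. \<forall>u\<in>X'. norm_L2 \<kappa> bdry_plus (T u) \<le> C * norm_L2 \<kappa> bdry_plus u"
      using B'[THEN conjunct2, THEN conjunct2, THEN conjunct2] X by (meson subsetD)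
  qed
qed

section \<open>One framework for both signs of extension and symmetry\<close>

definition A_signed :: "real \<Rightarrow> complex \<Rightarrow> bfun \<Rightarrow> bfun" where
  "A_signed \<kappa> s u = (\<lambda>x. if x \<in> bdry_plus then u x else s * u (scattering \<kappa> x))"

lemma A_plus_eq_A_signed: "A_plus \<kappa> = A_signed \<kappa> 1"
  by (simp add: A_plus_def A_signed_def fun_eq_iff)

lemma A_minus_eq_A_signed: "A_minus \<kappa> = A_signed \<kappa> (- 1)"
  by (simp add: A_minus_def A_signed_def fun_eq_iff)

text \<open>The common sign of the fibre frequencies of \<open>phi' p q\<close>. Unlike
  \<open>sgn\<close> it is 1 at q = 0, because the exponent 2q + 1 is positive there.\<close>

definition sgn_mode :: "int \<Rightarrow> complex" where
  "sgn_mode q = (if q \<ge> 0 then 1 else - 1)"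

definition sym_phi :: "real \<Rightarrow> complex \<Rightarrow> int \<Rightarrow> int \<Rightarrow> real \<times> real \<Rightarrow> complex" where
  "sym_phi \<kappa> s p q = (\<lambda>x. phi' \<kappa> p q x + s * (- 1) powi p * phi' \<kappa> p (p - q - 1) x)"

text \<open>The sign s of the antipodal symmetry goes with the extension
  \<open>A_signed \<kappa> (- s)\<close>: s = -1 is the setting of \<open>P_minus\<close> on
  \<open>V_minus\<close>, s = 1 that of \<open>C_minus\<close> on \<open>V_plus\<close>.\<close>

definition V_sym :: "real \<Rightarrow> complex \<Rightarrow> bfun set" where
  "V_sym \<kappa> s = {u \<in> L2 \<kappa> bdry_plus. eq_L2 \<kappa> bdry_plus (u \<circ> antipodal_scattering \<kappa>) (\<lambda>x. s * u x)}"

lemma V_plus_eq: "V_plus \<kappa> = V_sym \<kappa> 1"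
  by (simp add: V_plus_def V_sym_def)

lemma V_minus_eq: "V_minus \<kappa> = V_sym \<kappa> (- 1)"
  by (simp add: V_minus_def V_sym_def)

lemma powi_neg_one_sq: "(- 1) powi p * (- 1) powi p = (1 :: complex)"
  by (simp add: power_int_minus_left)

context
  fixes \<kappa> :: real
  assumes k: "- 1 < \<kappa>" "\<kappa> < 1"
begin

lemma u'_eq_sym: "u' \<kappa> p q = sym_phi \<kappa> 1 p q"
  by (simp add: u'_eq[OF k] sym_phi_def)

lemma v'_eq_sym: "v' \<kappa> p q = sym_phi \<kappa> (- 1) p q"
  by (simp add: v'_eq[OF k] sym_phi_def)

text \<open>The weight s' is the Jacobian of the substitution by s(\<alpha>), which maps the
  interval onto itself. For nonzero m the antiderivative has equal values at the two ends, since
  exp(2imt) has period pi in t.\<close>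

lemma integral_deriv_scat_cis:
  "set_integrable lborel {- pi / 2..pi / 2} (\<lambda>\<alpha>. of_real (deriv (scat \<kappa>) \<alpha>) * cis (of_int (2 * m) * scat \<kappa> \<alpha>))"
  "(LINT \<alpha>:{- pi / 2..pi / 2}|lborel. of_real (deriv (scat \<kappa>) \<alpha>) * cis (of_int (2 * m) * scat \<kappa> \<alpha>))
    = (if m = 0 then of_real pi else 0)"
proof -
  let ?f = "\<lambda>\<alpha>. of_real (deriv (scat \<kappa>) \<alpha>) * cis (of_int (2 * m) * scat \<kappa> \<alpha>)"
  let ?F = "\<lambda>\<alpha>. if m = 0 then of_real (scat \<kappa> \<alpha>) else cis (of_int (2 * m) * scat \<kappa> \<alpha>) / (\<i> * of_int (2 * m))"
  have d: "(scat \<kappa> has_real_derivative deriv (scat \<kappa>) \<alpha>) (at \<alpha> within S)" for \<alpha> S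
    using DERIV_imp_deriv[OF scat_has_derivative[OF k, of \<alpha>]] scat_has_derivative[OF k, of \<alpha>]
    by (simp add: has_field_derivative_at_within)
  have c: "continuous_on {- pi / 2..pi / 2} ?f"
    unfolding deriv_scat[OF k]
    by (intro continuous_intros continuous_on_scat[OF k]) (simp add: denominator_nonzero[OF k])
  then show "set_integrable lborel {- pi / 2..pi / 2} ?f"
    by (rule borel_integrable_atLeastAtMost')
  have F: "(?F has_vector_derivative ?f \<alpha>) (at \<alpha> within {- pi / 2..pi / 2})" for \<alpha>
  proof (cases "m = 0")
    case True
    then show ?thesis using has_vector_derivative_of_real[OF d] by simp
  next
    case False
    have "((\<lambda>\<alpha>. of_int (2 * m) * scat \<kappa> \<alpha>) has_real_derivative of_int (2 * m) * deriv (scat \<kappa>) \<alpha>) (at \<alpha> within {- pi / 2..pi / 2})"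
      by (intro DERIV_cmult d)
    from has_vector_derivative_divide[OF has_vector_derivative_cis[OF this], of "\<i> * of_int (2 * m)"]
    show ?thesis using False by (simp add: scaleR_conv_of_real field_simps)
  qed
  have "(LINT \<alpha>|lborel. indicator {- pi / 2..pi / 2} \<alpha> *\<^sub>R ?f \<alpha>) = ?F (pi / 2) - ?F (- pi / 2)"
    by (rule integral_FTC_atLeastAtMost[OF _ F c]) simp
  moreover have "cis (of_int (2 * m) * (- pi / 2)) = cis (of_int (2 * m) * (pi / 2))"
  proof -
    have "of_int (2 * m) * (- pi / 2) = of_int m * (- pi)" "of_int (2 * m) * (pi / 2) = of_int m * (- pi + 2 * pi)"
      by simp_all
    then show ?thesis by (simp only: cis_int_add_2pi)
  qed
  ultimately show "(LINT \<alpha>:{- pi / 2..pi / 2}|lborel. ?f \<alpha>) = (if m = 0 then of_real pi else 0)"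
    unfolding set_lebesgue_integral_def by (simp only: scat_half_pi[OF k]) simp
qed

lemma inner_phi':
  "inner_L2 \<kappa> bdry_plus (phi' \<kappa> p q) (phi' \<kappa> p' q')
    = (if p = p' \<and> q = q' then of_real (2 * pi\<^sup>2 / (1 + \<kappa>)) else 0)"
proof -
  let ?f = "\<lambda>\<beta>. indicator {0..<2 * pi} \<beta> *\<^sub>R cis (of_int (p - p') * \<beta>)"
  let ?g = "\<lambda>\<alpha>. indicator {- pi / 2..pi / 2} \<alpha> *\<^sub>R (of_real (deriv (scat \<kappa>) \<alpha>) * cis (of_int (2 * (q - q')) * scat \<kappa> \<alpha>))"
  have fi: "integrable lborel ?f"
    by (rule integrableI_bounded_set_indicator[where B=1]) auto
  have gi: "integrable lborel ?g"
    using integral_deriv_scat_cis(1) by (simp only: set_integrable_def)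
  have m: "(\<lambda>x. phi' \<kappa> p q x * cnj (phi' \<kappa> p' q' x)) \<in> borel_measurable borel"
    using phi'_measurable[OF k]
    by (intro borel_measurable_times borel_measurable_continuous_on[of cnj]) (auto intro: continuous_intros)
  have "phi' \<kappa> p q (\<beta>, \<alpha>) * cnj (phi' \<kappa> p' q' (\<beta>, \<alpha>))
      = cis (of_int (p - p') * \<beta>) * (of_real (deriv (scat \<kappa>) \<alpha>) * cis (of_int (2 * (q - q')) * scat \<kappa> \<alpha>))" for \<beta> \<alpha>
  proof -
    have 1: "cis (of_int p * \<beta>) * cnj (cis (of_int p' * \<beta>)) = cis (of_int (p - p') * \<beta>)"
      by (simp add: cis_cnj cis_mult left_diff_distrib)
    have 2: "cis (of_int (2 * q + 1) * scat \<kappa> \<alpha>) * cnj (cis (of_int (2 * q' + 1) * scat \<kappa> \<alpha>))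
        = cis (of_int (2 * (q - q')) * scat \<kappa> \<alpha>)"
      by (simp add: cis_cnj cis_mult left_diff_distrib[symmetric])
    have 3: "of_real (sqrt (deriv (scat \<kappa>) \<alpha>)) * of_real (sqrt (deriv (scat \<kappa>) \<alpha>)) = complex_of_real (deriv (scat \<kappa>) \<alpha>)"
      using norm_psi(2)[OF k, of \<alpha>] by (simp add: of_real_mult[symmetric] del: of_real_mult)
    have "phi' \<kappa> p q (\<beta>, \<alpha>) * cnj (phi' \<kappa> p' q' (\<beta>, \<alpha>))
        = (cis (of_int p * \<beta>) * cnj (cis (of_int p' * \<beta>))) *
          ((of_real (sqrt (deriv (scat \<kappa>) \<alpha>)) * of_real (sqrt (deriv (scat \<kappa>) \<alpha>))) *
           (cis (of_int (2 * q + 1) * scat \<kappa> \<alpha>) * cnj (cis (of_int (2 * q' + 1) * scat \<kappa> \<alpha>))))"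
      by (simp only: phi'_eq_psi psi_def prod.case complex_cnj_mult complex_cnj_complex_of_real mult_ac)
    then show ?thesis by (simp only: 1 2 3)
  qed
  then have "indicator (lift bdry_plus) x *\<^sub>R (phi' \<kappa> p q x * cnj (phi' \<kappa> p' q' x)) = ?f (fst x) * ?g (snd x)" for x
    by (cases x) (simp only: lift_bdry_plus indicator_times fst_conv snd_conv, simp add: scaleR_conv_of_real mult_ac)
  then have "inner_L2 \<kappa> bdry_plus (phi' \<kappa> p q) (phi' \<kappa> p' q')
      = of_real (1 / (1 + \<kappa>)) * (LINT x|lborel. ?f (fst x) * ?g (snd x))"
    unfolding inner_L2_def by (subst integral_dSigma[OF k(1) borel_bdry_plus m]) simp
  also have "(LINT x|lborel. ?f (fst x) * ?g (snd x)) = (LINT \<beta>|lborel. ?f \<beta>) * (LINT \<alpha>|lborel. ?g \<alpha>)"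
    by (rule lborel_integral_product[OF fi gi])
  also have "(LINT \<beta>|lborel. ?f \<beta>) = (if p = p' then of_real (2 * pi) else 0)"
    using lborel_integral_cis[of 0 "p - p'"] by simp
  also have "(LINT \<alpha>|lborel. ?g \<alpha>) = (if q = q' then of_real pi else 0)"
    using integral_deriv_scat_cis(2)[of "q - q'"] by (simp add: set_lebesgue_integral_def)
  finally show ?thesis by (simp add: power2_eq_square)
qed

lemma inner_lincomb:
  assumes "u \<in> L2 \<kappa> bdry_plus" "v \<in> L2 \<kappa> bdry_plus" "w \<in> L2 \<kappa> bdry_plus" "z \<in> L2 \<kappa> bdry_plus"
  shows "inner_L2 \<kappa> bdry_plus (\<lambda>x. u x + a * v x) (\<lambda>x. w x + b * z x)
    = inner_L2 \<kappa> bdry_plus u w + cnj b * inner_L2 \<kappa> bdry_plus u z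
      + a * inner_L2 \<kappa> bdry_plus v w + a * cnj b * inner_L2 \<kappa> bdry_plus v z"
proof -
  let ?M = "dSigma \<kappa> bdry_plus"
  have i: "integrable ?M (\<lambda>x. f x * cnj (g x))" if "f \<in> L2 \<kappa> bdry_plus" "g \<in> L2 \<kappa> bdry_plus" for f g
    using that by (intro integrable_mult_cnj) (auto simp: L2_iff)
  have "(u x + a * v x) * cnj (w x + b * z x) = u x * cnj (w x) + cnj b * (u x * cnj (z x))
      + a * (v x * cnj (w x)) + a * cnj b * (v x * cnj (z x))" for x
    by (simp add: algebra_simps)
  then show ?thesis
    unfolding inner_L2_def using i[OF assms(1,3)] i[OF assms(1,4)] i[OF assms(2,3)] i[OF assms(2,4)]
    by simp
qed

text \<open>The condition p \<le> 2q + 1 says p - q - 1 \<le> q, so it selects one member from each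
  pair exchanged by the reflection of q, and distinct indices share no exponential. On the line p =
  2q + 1 the two exponentials coincide, p is odd, and the symmetrization is (1 - s) times
  \<open>phi'\<close>: zero for s = 1, doubled for s = -1.\<close>

lemma inner_sym_phi:
  assumes "p \<le> 2 * q + 1" "p' \<le> 2 * q' + 1" "s = 1 \<or> s = - 1"
  shows "inner_L2 \<kappa> bdry_plus (sym_phi \<kappa> s p q) (sym_phi \<kappa> s p' q')
    = (if p = p' \<and> q = q' then of_real (4 * pi\<^sup>2 / (1 + \<kappa>)) * (if p = 2 * q + 1 then 1 - s else 1) else 0)"
proof -
  have cs: "cnj s = s" "s * s = 1" and c: "cnj ((- 1) powi p) = (- 1) powi p" for p
    using assms(3) by (auto simp: power_int_minus_left)
  show ?thesis
  proof (cases "p = p'")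
    case False
    then show ?thesis
      unfolding sym_phi_def by (subst inner_lincomb) (auto simp: inner_phi' intro: phi'_L2[OF k])
  next
    case True
    have "\<not> (q = p - q' - 1 \<and> p \<noteq> 2 * q + 1)" "\<not> (q \<noteq> q' \<and> q = p - q' - 1)"
      "\<not> (q \<noteq> q' \<and> p - q - 1 = q')"
      using assms(1,2) True by linarith+
    moreover have "(- 1 :: complex) powi p = - 1" if "p - 1 = 2 * q'"
    proof -
      have "odd p" using that by presburger
      then show ?thesis by (simp add: power_int_minus_left)
    qed
    ultimately show ?thesis
      unfolding sym_phi_def True[symmetric] using assms(3)
      by (subst inner_lincomb)
         (auto simp: inner_phi' c powi_neg_one_sq cs mult.assoc intro: phi'_L2[OF k])
  qed
qed

subsection \<open>Pullbacks under the scattering relations\<close>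

lemma scat_measurable [measurable]: "scat \<kappa> \<in> borel_measurable borel"
  by (intro borel_measurable_continuous_onI continuous_on_scat[OF k])

text \<open>Both scattering relations in one form, so that periodicity and preservation of energy
  are shown once.\<close>

definition skew :: "real \<Rightarrow> real \<times> real \<Rightarrow> real \<times> real" where
  "skew r = (\<lambda>(\<beta>, \<alpha>). (\<beta> + pi + 2 * scat \<kappa> \<alpha>, r - \<alpha>))"

lemma scattering_eq_skew: "scattering \<kappa> = skew pi"
  by (simp add: scattering_def skew_def)

lemma antipodal_scattering_eq_skew: "antipodal_scattering \<kappa> = skew 0"
  by (simp add: antipodal_scattering_def skew_def)

lemma skew_measurable: "skew r \<in> borel_measurable borel"
  unfolding skew_def borel_prod[symmetric] by measurable

lemma energy_skew:
  assumes "g \<in> borel_measurable borel" "Y \<in> sets borel" "Y' \<in> sets borel"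
    and per: "\<And>\<beta> \<alpha>. g (\<beta> + 2 * pi, \<alpha>) = g (\<beta>, \<alpha>)"
    and Y: "AE y in lborel. r - y \<in> Y \<longleftrightarrow> y \<in> Y'"
  shows "energy ({0..<2 * pi} \<times> Y) (\<lambda>x. g (skew r x)) = energy ({0..<2 * pi} \<times> Y') g"
proof -
  note [measurable] = assms(1-3)
  show ?thesis
    using nn_integral_shear[of "\<lambda>x. ennreal ((norm (g x))\<^sup>2)" "\<lambda>\<alpha>. pi + 2 * scat \<kappa> \<alpha>" Y Y' r] per Y
    by (simp add: skew_def split_beta add.assoc)
qed

lemma antipodal_in_bdry_plus: "antipodal_scattering \<kappa> x \<in> bdry_plus \<longleftrightarrow> x \<in> bdry_plus"
  by (cases x) (simp add: antipodal_scattering_def bdry_plus_iff_cos)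

lemma scattering_in_bdry_plus: "x \<notin> bdry_plus \<Longrightarrow> scattering \<kappa> x \<in> bdry_plus"
  by (cases x) (simp add: scattering_def bdry_plus_iff_cos)

lemma periodic_skew:
  assumes "periodic_on A u" "shift_closed A" "\<And>x. x \<in> B \<Longrightarrow> skew r x \<in> A"
  shows "periodic_on B (\<lambda>x. u (skew r x))"
  unfolding periodic_on_def
proof (clarify, intro conjI)
  fix \<beta> \<alpha> assume "(\<beta>, \<alpha>) \<in> B"
  then have "skew r (\<beta>, \<alpha>) \<in> A" by (rule assms(3))
  then have A: "(\<beta> + pi + 2 * scat \<kappa> \<alpha>, r - \<alpha>) \<in> A" by (simp add: skew_def)
  have "skew r (\<beta> + 2 * pi, \<alpha>) = (\<beta> + pi + 2 * scat \<kappa> \<alpha> + 2 * pi * of_int 1, r - \<alpha> + 2 * pi * of_int 0)"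
    "skew r (\<beta>, \<alpha> + 2 * pi) = (\<beta> + pi + 2 * scat \<kappa> \<alpha> + 2 * pi * of_int 2, r - \<alpha> + 2 * pi * of_int (- 1))"
    unfolding skew_def prod.case scat_add_2pi[OF k] by simp_all
  then show "u (skew r (\<beta> + 2 * pi, \<alpha>)) = u (skew r (\<beta>, \<alpha>))"
      "u (skew r (\<beta>, \<alpha> + 2 * pi)) = u (skew r (\<beta>, \<alpha>))"
    by (simp_all only: periodic_on_shift[OF assms(1,2) A]) (simp_all add: skew_def)
qed

text \<open>Values off \<open>bdry_plus\<close> are arbitrary and possibly not measurable. Setting
  them to 0 gives a Borel function on the plane, to which the invariance results apply.\<close>

definition cut :: "bfun \<Rightarrow> real \<times> real \<Rightarrow> complex" where
  "cut u x = (if x \<in> bdry_plus then u x else 0)"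

lemma cut_measurable: "u \<in> L2 \<kappa> bdry_plus \<Longrightarrow> cut u \<in> borel_measurable borel"
  unfolding cut_def[abs_def] L2_iff using periodic_on_borel[of bdry_plus u \<kappa>] by (auto simp: sq_int_measurable)

lemma cut_periodic: "u \<in> L2 \<kappa> bdry_plus \<Longrightarrow> cut u (\<beta> + 2 * pi, \<alpha>) = cut u (\<beta>, \<alpha>)"
  by (auto simp: cut_def L2_def periodic_on_def bdry_plus_iff_cos)

lemma energy_cut:
  assumes "u \<in> L2 \<kappa> bdry_plus"
  shows "energy (lift bdry_plus) (cut u)
    = ennreal (1 + \<kappa>) * ennreal ((l2 (dSigma \<kappa> bdry_plus) u)\<^sup>2)"
proof -
  have sq: "sq_int (dSigma \<kappa> bdry_plus) u" using assms by (simp add: L2_iff)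
  have "(\<integral>\<^sup>+x. ennreal ((norm (cut u x))\<^sup>2) \<partial>dSigma \<kappa> bdry_plus) = ennreal ((l2 (dSigma \<kappa> bdry_plus) u)\<^sup>2)"
    unfolding nn_integral_norm_sq[OF sq, symmetric] by (intro nn_integral_cong) (simp add: cut_def)
  then show ?thesis
    by (simp only: energy_dSigma[OF k(1) borel_bdry_plus cut_measurable[OF assms]])
qed

lemma energy_bdry:
  assumes "w \<in> L2 \<kappa> bdry"
  shows "energy (lift bdry) w = ennreal (1 + \<kappa>) * ennreal ((l2 (dSigma \<kappa> bdry) w)\<^sup>2)"
  using assms by (simp only: energy_dSigma[OF k(1) borel_bdry L2_bdry_borel[OF assms]]
      nn_integral_norm_sq L2_iff)

lemma scale_cancel: "ennreal (1 / (1 + \<kappa>)) * (ennreal (1 + \<kappa>) * x) = x"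
  using k by (simp add: mult.assoc[symmetric] ennreal_mult[symmetric])

text \<open>Apart from controlling norms, the inequality carries almost-everywhere identities across
  the pullback, since a function of norm 0 goes to a function of norm 0.\<close>

lemma antipodal_pullback:
  assumes u: "u \<in> L2 \<kappa> bdry_plus"
  shows "(\<lambda>x. u (antipodal_scattering \<kappa> x)) \<in> L2 \<kappa> bdry_plus"
    and "l2 (dSigma \<kappa> bdry_plus) (\<lambda>x. u (antipodal_scattering \<kappa> x)) \<le> l2 (dSigma \<kappa> bdry_plus) u"
proof -
  let ?M = "dSigma \<kappa> bdry_plus" and ?S = "antipodal_scattering \<kappa>"
  note [measurable] = cut_measurable[OF u] skew_measurable[of 0, folded antipodal_scattering_eq_skew]
  have m: "(\<lambda>x. cut u (?S x)) \<in> borel_measurable borel" by measurable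
  have c: "cut u (?S x) = u (?S x)" if "x \<in> space ?M" for x
    using that antipodal_in_bdry_plus[of x] by (simp add: cut_def)
  have mu: "(\<lambda>x. u (?S x)) \<in> borel_measurable ?M"
    using borel_imp_measurable_dSigma[OF m] c by (subst measurable_cong[of ?M _ "\<lambda>x. cut u (?S x)"]) auto
  have "(\<integral>\<^sup>+x. ennreal ((norm (u (?S x)))\<^sup>2) \<partial>?M) = (\<integral>\<^sup>+x. ennreal ((norm (cut u (?S x)))\<^sup>2) \<partial>?M)"
    using c by (intro nn_integral_cong) simp
  also have "\<dots> = ennreal (1 / (1 + \<kappa>)) * energy (lift bdry_plus) (\<lambda>x. cut u (?S x))"
    by (rule nn_integral_dSigma) measurable
  also have "energy (lift bdry_plus) (\<lambda>x. cut u (?S x))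
      = energy (lift bdry_plus) (cut u)"
    unfolding lift_bdry_plus antipodal_scattering_eq_skew
    by (rule energy_skew) (auto simp: cut_periodic[OF u])
  also have "ennreal (1 / (1 + \<kappa>)) * \<dots> = ennreal ((l2 ?M u)\<^sup>2)"
    unfolding energy_cut[OF u] scale_cancel ..
  finally have "(\<integral>\<^sup>+x. ennreal ((norm (u (?S x)))\<^sup>2) \<partial>?M) \<le> ennreal ((l2 ?M u)\<^sup>2)" by simp
  from sq_int_I_nn_integral[OF mu this]
  show "l2 ?M (\<lambda>x. u (?S x)) \<le> l2 ?M u" "(\<lambda>x. u (?S x)) \<in> L2 \<kappa> bdry_plus"
    using u periodic_skew[of bdry_plus u bdry_plus 0, folded antipodal_scattering_eq_skew] antipodal_in_bdry_plus
    by (auto simp: L2_iff)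
qed

lemma L2_bdry_subset: "w \<in> L2 \<kappa> bdry \<Longrightarrow> w \<in> L2 \<kappa> bdry_plus"
  and l2_bdry_plus_le: "w \<in> L2 \<kappa> bdry \<Longrightarrow> l2 (dSigma \<kappa> bdry_plus) w \<le> l2 (dSigma \<kappa> bdry) w"
proof -
  assume w: "w \<in> L2 \<kappa> bdry"
  note [measurable] = L2_bdry_borel[OF w]
  have "(\<integral>\<^sup>+x. ennreal ((norm (w x))\<^sup>2) \<partial>dSigma \<kappa> bdry_plus)
      = ennreal (1 / (1 + \<kappa>)) * energy (lift bdry_plus) w"
    by (rule nn_integral_dSigma) measurable
  also have "\<dots> \<le> ennreal (1 / (1 + \<kappa>)) * energy (lift bdry) w"
    by (intro mult_left_mono nn_integral_mono) (auto simp: indicator_def bdry_def)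
  also have "\<dots> = ennreal ((l2 (dSigma \<kappa> bdry) w)\<^sup>2)"
    unfolding energy_bdry[OF w] scale_cancel ..
  finally have "(\<integral>\<^sup>+x. ennreal ((norm (w x))\<^sup>2) \<partial>dSigma \<kappa> bdry_plus) \<le> ennreal ((l2 (dSigma \<kappa> bdry) w)\<^sup>2)" .
  from sq_int_I_nn_integral[OF borel_imp_measurable_dSigma[OF L2_bdry_borel[OF w]] this]
  show "l2 (dSigma \<kappa> bdry_plus) w \<le> l2 (dSigma \<kappa> bdry) w" "w \<in> L2 \<kappa> bdry_plus"
    using w by (auto simp: L2_iff periodic_on_def bdry_def)
qed

text \<open>The reflection of \<alpha> at pi / 2 carries the inward half of the fundamental domain
  to the outward half, so only that half of the energy of w is counted.\<close>

lemma scattering_pullback: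
  assumes w: "w \<in> L2 \<kappa> bdry"
  shows "(\<lambda>x. w (scattering \<kappa> x)) \<in> L2 \<kappa> bdry_plus"
    and "l2 (dSigma \<kappa> bdry_plus) (\<lambda>x. w (scattering \<kappa> x)) \<le> l2 (dSigma \<kappa> bdry) w"
proof -
  let ?M = "dSigma \<kappa> bdry_plus" and ?S = "scattering \<kappa>"
  note [measurable] = L2_bdry_borel[OF w]
  note [measurable] = skew_measurable[of pi, folded scattering_eq_skew]
  have m: "(\<lambda>x. w (?S x)) \<in> borel_measurable borel" by measurable
  have "(\<integral>\<^sup>+x. ennreal ((norm (w (?S x)))\<^sup>2) \<partial>?M)
      = ennreal (1 / (1 + \<kappa>)) * energy (lift bdry_plus) (\<lambda>x. w (?S x))"
    by (rule nn_integral_dSigma) measurable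
  also have "energy (lift bdry_plus) (\<lambda>x. w (?S x))
      = energy ({0..<2 * pi} \<times> {pi / 2..<3 * pi / 2}) w"
    unfolding lift_bdry_plus scattering_eq_skew
  proof (rule energy_skew)
    \<comment> \<open>The reflected interval is closed while the fundamental domain is half-open;
      the discrepancy is the single point 3 * pi / 2.\<close>
    show "AE y in lborel. pi - y \<in> {- pi / 2..pi / 2} \<longleftrightarrow> y \<in> {pi / 2..<3 * pi / 2}"
      using AE_lborel_singleton[of "3 * pi / 2"] by eventually_elim auto
  qed (auto simp: L2_bdry_periodic[OF w])
  also have "ennreal (1 / (1 + \<kappa>)) * \<dots>
      \<le> ennreal (1 / (1 + \<kappa>)) * energy (lift bdry) w"
    unfolding lift_bdry by (intro mult_left_mono nn_integral_mono) (auto simp: indicator_def)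
  also have "\<dots> = ennreal ((l2 (dSigma \<kappa> bdry) w)\<^sup>2)"
    unfolding energy_bdry[OF w] scale_cancel ..
  finally have "(\<integral>\<^sup>+x. ennreal ((norm (w (?S x)))\<^sup>2) \<partial>?M) \<le> ennreal ((l2 (dSigma \<kappa> bdry) w)\<^sup>2)" .
  from sq_int_I_nn_integral[OF borel_imp_measurable_dSigma[OF m] this]
  show "l2 ?M (\<lambda>x. w (?S x)) \<le> l2 (dSigma \<kappa> bdry) w" "(\<lambda>x. w (?S x)) \<in> L2 \<kappa> bdry_plus"
    using periodic_skew[OF _ shift_closed_bdry, of w bdry_plus pi, folded scattering_eq_skew] w
    by (auto simp: L2_iff) (simp_all add: bdry_def)
qed

lemma A_minus_adj_L2:
  assumes w: "w \<in> L2 \<kappa> bdry"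
  shows "A_minus_adj \<kappa> w \<in> L2 \<kappa> bdry_plus"
    and "l2 (dSigma \<kappa> bdry_plus) (A_minus_adj \<kappa> w) \<le> 2 * l2 (dSigma \<kappa> bdry) w"
proof -
  note s = scattering_pullback[OF w] and b = L2_bdry_subset[OF w] l2_bdry_plus_le[OF w]
  show "A_minus_adj \<kappa> w \<in> L2 \<kappa> bdry_plus"
    using L2_lincomb[OF b(1) s(1), of 1 "- 1"] by (simp add: A_minus_adj_def)
  have "l2 (dSigma \<kappa> bdry_plus) (\<lambda>x. w x - w (scattering \<kappa> x))
      \<le> l2 (dSigma \<kappa> bdry_plus) w + l2 (dSigma \<kappa> bdry_plus) (\<lambda>x. w (scattering \<kappa> x))"
    using s(1) b(1) by (intro l2_diff_triangle) (auto simp: L2_iff)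
  then show "l2 (dSigma \<kappa> bdry_plus) (A_minus_adj \<kappa> w) \<le> 2 * l2 (dSigma \<kappa> bdry) w"
    unfolding A_minus_adj_def using s(2) b(2) by linarith
qed

text \<open>The energy of the extension splits into that of u and that of u pulled back from the
  outward half, each at most that of u. The sum 2 is rounded up to 4 so that the constant for the
  norm is 2.\<close>

lemma A_signed_L2:
  assumes u: "u \<in> L2 \<kappa> bdry_plus" and s: "norm s = 1"
  shows "A_signed \<kappa> s u \<in> L2 \<kappa> bdry" and "l2 (dSigma \<kappa> bdry) (A_signed \<kappa> s u) \<le> 2 * l2 (dSigma \<kappa> bdry_plus) u"
proof -
  let ?M = "dSigma \<kappa> bdry" and ?S = "scattering \<kappa>"
  note cm [measurable] = cut_measurable[OF u]
  note [measurable] = skew_measurable[of pi, folded scattering_eq_skew]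
  \<comment> \<open>These sets partition the fundamental domain: points with \<alpha> = pi / 2
    belong to \<open>bdry_plus\<close> and hence to \<open>A\<close>, which makes \<open>B\<close>
    open there.\<close>
  define A B where "A = {0..<2 * pi} \<times> {- pi / 2..pi / 2}" and "B = {0..<2 * pi} \<times> {pi / 2<..<3 * pi / 2}"
  have box [measurable]: "A \<in> sets (borel :: (real \<times> real) measure)"
      "B \<in> sets (borel :: (real \<times> real) measure)"
    unfolding A_def B_def borel_prod[symmetric] by measurable
  define e where "e = A_signed \<kappa> s u"
  have e: "e x = cut u x + (if x \<in> bdry_plus then 0 else s * cut u (?S x))" for x
    using scattering_in_bdry_plus[of x] by (simp add: e_def A_signed_def cut_def)
  have em [measurable]: "e \<in> borel_measurable borel" unfolding e by measurable
  define I where "I = ennreal (1 + \<kappa>) * ennreal ((l2 (dSigma \<kappa> bdry_plus) u)\<^sup>2)"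
  have I: "energy A (cut u) = I"
    using energy_cut[OF u] by (simp add: lift_bdry_plus I_def A_def)
  define J where "J = energy B (\<lambda>x. cut u (?S x))"
  have "J = energy ({0..<2 * pi} \<times> {- pi / 2<..<pi / 2}) (cut u)"
    unfolding J_def B_def scattering_eq_skew by (rule energy_skew) (auto simp: cut_periodic[OF u])
  also have "\<dots> \<le> energy A (cut u)"
    by (intro nn_integral_mono) (auto simp: indicator_def A_def)
  finally have JI: "J \<le> I" unfolding I .
  have "(\<integral>\<^sup>+x. ennreal ((norm (e x))\<^sup>2) \<partial>?M)
      = ennreal (1 / (1 + \<kappa>)) * energy (lift bdry) e"
    by (rule nn_integral_dSigma) measurable
  also have "energy (lift bdry) e
      = (\<integral>\<^sup>+x. ennreal ((norm (cut u x))\<^sup>2) * indicator A x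
          + ennreal ((norm (cut u (?S x)))\<^sup>2) * indicator B x \<partial>lborel)"
  proof (intro nn_integral_cong)
    fix x
    have "x \<in> lift bdry \<longleftrightarrow> x \<in> A \<or> x \<in> B"
      unfolding lift_bdry A_def B_def using pi_gt_zero by auto
    moreover have A: "x \<in> A \<longrightarrow> x \<in> bdry_plus" and B: "x \<in> B \<longrightarrow> x \<notin> bdry_plus"
    proof -
      show "x \<in> A \<longrightarrow> x \<in> bdry_plus" unfolding A_def using lift_bdry_plus by blast
      have "x \<in> B \<Longrightarrow> x \<in> fundamental_domain" using pi_gt_zero by (auto simp: B_def fundamental_domain_def)
      moreover have "x \<in> B \<Longrightarrow> x \<notin> A" by (auto simp: A_def B_def)
      ultimately show "x \<in> B \<longrightarrow> x \<notin> bdry_plus" unfolding A_def using lift_bdry_plus by blast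
    qed
    ultimately show "ennreal ((norm (e x))\<^sup>2) * indicator (lift bdry) x
      = ennreal ((norm (cut u x))\<^sup>2) * indicator A x
          + ennreal ((norm (cut u (?S x)))\<^sup>2) * indicator B x"
      using s
      by (cases "x \<in> A"; cases "x \<in> B") (auto simp: e indicator_def norm_mult cut_def)
  qed
  also have "\<dots> = I + J"
    unfolding I[symmetric] J_def by (rule nn_integral_add) (use box in measurable)
  also have "ennreal (1 / (1 + \<kappa>)) * (I + J) \<le> ennreal (1 / (1 + \<kappa>)) * (I + I)"
    by (intro mult_left_mono add_left_mono JI) simp
  also have "ennreal (1 / (1 + \<kappa>)) * (I + I) = 2 * ennreal ((l2 (dSigma \<kappa> bdry_plus) u)\<^sup>2)"
    by (simp add: I_def distrib_left scale_cancel mult_2)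
  also have "\<dots> \<le> ennreal ((2 * l2 (dSigma \<kappa> bdry_plus) u)\<^sup>2)"
    by (simp add: power_mult_distrib ennreal_mult mult_right_mono)
  finally have le: "(\<integral>\<^sup>+x. ennreal ((norm (e x))\<^sup>2) \<partial>?M) \<le> ennreal ((2 * l2 (dSigma \<kappa> bdry_plus) u)\<^sup>2)" .
  have "periodic_on (- bdry_plus) (\<lambda>x. u (?S x))"
    by (rule periodic_skew[of bdry_plus, of _ _ pi, folded scattering_eq_skew]) (use u scattering_in_bdry_plus in \<open>auto simp: L2_iff\<close>)
  moreover have "periodic_on bdry_plus u" using u by (simp add: L2_iff)
  ultimately have "periodic_on bdry e"
    by (auto simp: periodic_on_def e_def A_signed_def bdry_plus_iff_cos)
  with sq_int_I_nn_integral[OF borel_imp_measurable_dSigma[OF em] le]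
  show "A_signed \<kappa> s u \<in> L2 \<kappa> bdry" "l2 ?M (A_signed \<kappa> s u) \<le> 2 * l2 (dSigma \<kappa> bdry_plus) u"
    by (auto simp: L2_iff e_def)
qed

subsection \<open>The operators\<close>

lemma sym_phi_L2: "A \<in> sets borel \<Longrightarrow> sym_phi \<kappa> s p q \<in> L2 \<kappa> A"
  unfolding sym_phi_def
  using L2_lincomb[OF phi'_L2[OF k, of A p q] phi'_L2[OF k, of A p "p - q - 1"], of 1 "s * (- 1) powi p"] by simp

lemma powi_cancel: "(- 1) powi p * ((- 1) powi p * z) = (z :: complex)"
  by (simp add: mult.assoc[symmetric] powi_neg_one_sq)

lemma sym_phi_antipodal:
  assumes "s * s = 1"
  shows "sym_phi \<kappa> s p q (antipodal_scattering \<kappa> x) = s * sym_phi \<kappa> s p q x"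
  using assms
  by (simp add: sym_phi_def phi'_antipodal_scattering[OF k] distrib_left powi_cancel mult.left_commute)
     (simp add: mult.assoc[symmetric])

text \<open>The map q \<mapsto> p - q - 1 is an involution and (-1)^p squares to 1, so reflected
  indices give proportional functions and half of the lattice spans everything.\<close>

lemma sym_phi_reflect:
  assumes "s * s = 1"
  shows "sym_phi \<kappa> s p (p - q - 1) x = s * (- 1) powi p * sym_phi \<kappa> s p q x"
proof -
  have "s * (- 1) powi p * (s * (- 1) powi p * z) = (s * s) * ((- 1) powi p * ((- 1) powi p * z))" for z :: complex
    by (simp only: mult_ac)
  then have "s * (- 1) powi p * (s * (- 1) powi p * z) = z" for z :: complex
    by (simp only: assms powi_cancel mult_1_left)
  then show ?thesis by (simp add: sym_phi_def distrib_left)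
qed

lemma sym_phi_in_V:
  assumes "s * s = 1"
  shows "sym_phi \<kappa> s p q \<in> V_sym \<kappa> s"
  using assms by (simp add: V_sym_def sym_phi_L2 eq_L2_def sym_phi_antipodal)

text \<open>Symmetrizing turns each \<open>phi'\<close> into half of a \<open>sym_phi\<close>.
  Indices outside I are brought inside by reflection, except on the line p = 2q + 1 with s = 1,
  where the symmetrization vanishes.\<close>

lemma lin_comb_symmetrize:
  assumes s: "s = 1 \<or> s = - 1" and I: "I = {(p, q). p \<le> 2 * q + 1 \<and> (p = 2 * q + 1 \<longrightarrow> s = - 1)}"
    and t: "lin_comb UNIV (\<lambda>(p, q). phi' \<kappa> p q) t"
  shows "lin_comb I (\<lambda>(p, q). sym_phi \<kappa> s p q) (\<lambda>x. 1 / 2 * (t x + s * t (antipodal_scattering \<kappa> x)))"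
proof -
  have ss: "s * s = 1" using s by auto
  let ?e = "\<lambda>(p, q). sym_phi \<kappa> s p q"
  obtain F c where F: "finite F" "t = (\<lambda>x. \<Sum>i\<in>F. c i * (case i of (p, q) \<Rightarrow> phi' \<kappa> p q) x)"
    using t unfolding lin_comb_def by blast
  have base: "lin_comb I ?e (sym_phi \<kappa> s p q)" if "p \<le> 2 * q + 1" for p q
  proof (cases "(p, q) \<in> I")
    case True
    then show ?thesis using lin_comb_base[of "(p, q)" I ?e] by simp
  next
    case False
    then have 1: "p = 2 * q + 1" "s = 1" using that s by (auto simp: I)
    then have "p - q - 1 = q" "(- 1 :: complex) powi p = - 1" by (simp_all add: power_int_minus_left)
    then have "sym_phi \<kappa> s p q = (\<lambda>x. 0)" unfolding sym_phi_def 1(2) by (simp only:) simp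
    then show ?thesis by (simp add: lin_comb_zero)
  qed
  have all: "lin_comb I ?e (sym_phi \<kappa> s p q)" for p q
  proof (cases "p \<le> 2 * q + 1")
    case False
    then have "lin_comb I ?e (sym_phi \<kappa> s p (p - q - 1))" by (intro base) simp
    then have "lin_comb I ?e (\<lambda>x. s * (- 1) powi p * sym_phi \<kappa> s p (p - q - 1) x)" by (rule lin_comb_cmult)
    moreover have "s * (- 1) powi p * sym_phi \<kappa> s p (p - q - 1) x = sym_phi \<kappa> s p q x" for x
      using sym_phi_reflect[OF ss, of p "p - q - 1" x] by simp
    ultimately show ?thesis by simp
  qed (rule base)
  have "t x + s * t (antipodal_scattering \<kappa> x) = (\<Sum>i\<in>F. c i * (case i of (p, q) \<Rightarrow> sym_phi \<kappa> s p q) x)" for x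
    unfolding F(2) sum_distrib_left sum.distrib[symmetric]
    by (intro sum.cong refl)
       (auto simp: sym_phi_def phi'_antipodal_scattering[OF k] algebra_simps split: prod.split)
  moreover have "lin_comb I ?e (\<lambda>x. 1 / 2 * (\<Sum>i\<in>F. c i * (case i of (p, q) \<Rightarrow> sym_phi \<kappa> s p q) x))"
    by (intro lin_comb_cmult lin_comb_sum) (auto simp: all split: prod.split)
  ultimately show ?thesis by simp
qed

text \<open>An approximant t of f from the span of all \<open>phi'\<close> is symmetrized. The map
  averaging a function with s times its antipodal pullback fixes f almost everywhere and does not
  increase norms, so the error stays below \<epsilon>.\<close>

lemma complete_orthogonal_sym_phi:
  assumes s: "s = 1 \<or> s = - 1" and I: "I = {(p, q). p \<le> 2 * q + 1 \<and> (p = 2 * q + 1 \<longrightarrow> s = - 1)}"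
  shows "complete_orthogonal_system \<kappa> (V_sym \<kappa> s) I (\<lambda>(p, q). sym_phi \<kappa> s p q)"
  unfolding complete_orthogonal_system_def
proof (intro conjI ballI allI impI)
  have ss: "s * s = 1" and ns: "norm s = 1" using s by auto
  let ?M = "dSigma \<kappa> bdry_plus" and ?S = "antipodal_scattering \<kappa>"
  have k0: "complex_of_real (4 * pi\<^sup>2 / (1 + \<kappa>)) \<noteq> 0"
    unfolding of_real_eq_0_iff using k by simp
  {
    fix i assume i: "i \<in> I"
    obtain p q where pq: "i = (p, q)" by (cases i)
    show "(case i of (p, q) \<Rightarrow> sym_phi \<kappa> s p q) \<in> V_sym \<kappa> s"
      by (simp add: pq sym_phi_in_V[OF ss])
    have "inner_L2 \<kappa> bdry_plus (sym_phi \<kappa> s p q) (sym_phi \<kappa> s p q)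
        = of_real (4 * pi\<^sup>2 / (1 + \<kappa>)) * (if p = 2 * q + 1 then 1 - s else 1)"
      using i s by (subst inner_sym_phi) (auto simp: I pq)
    moreover have "(if p = 2 * q + 1 then 1 - s else 1) \<noteq> 0"
      using i by (auto simp: I pq)
    ultimately have "inner_L2 \<kappa> bdry_plus (sym_phi \<kappa> s p q) (sym_phi \<kappa> s p q) \<noteq> 0"
      using k0 by (metis mult_eq_0_iff)
    moreover have "inner_L2 \<kappa> bdry_plus (sym_phi \<kappa> s p q) (sym_phi \<kappa> s p q)
        = of_real ((norm_L2 \<kappa> bdry_plus (sym_phi \<kappa> s p q))\<^sup>2)"
      unfolding norm_L2_eq_l2 l2_squared inner_L2_def integral_complex_of_real[symmetric]
      by (simp only: complex_norm_square)
    ultimately show "norm_L2 \<kappa> bdry_plus (case i of (p, q) \<Rightarrow> sym_phi \<kappa> s p q) \<noteq> 0"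
      by (auto simp: pq)
  }
  {
    fix i j assume i: "i \<in> I" and j: "j \<in> I" and ij: "i \<noteq> j"
    obtain p q p' q' where pq: "i = (p, q)" "j = (p', q')" by (cases i; cases j)
    show "inner_L2 \<kappa> bdry_plus (case i of (p, q) \<Rightarrow> sym_phi \<kappa> s p q) (case j of (p, q) \<Rightarrow> sym_phi \<kappa> s p q) = 0"
      using i j ij s by (auto simp: pq I inner_sym_phi)
  }
  {
    fix f and \<epsilon> :: real assume f: "f \<in> V_sym \<kappa> s" and \<epsilon>: "\<epsilon> > 0"
    then have f2: "f \<in> L2 \<kappa> bdry_plus" by (simp add: V_sym_def)
    obtain t where t: "lin_comb UNIV (\<lambda>(p, q). phi' \<kappa> p q) t" "l2 ?M (\<lambda>x. f x - t x) < \<epsilon>"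
      using phi'_dense[OF k f2 \<epsilon>] by metis
    have "t \<in> L2 \<kappa> bdry_plus"
      using t(1) phi'_L2[OF k borel_bdry_plus] unfolding lin_comb_def L2_iff periodic_on_def
      by (auto intro!: sq_int_sum sq_int_cmult sum.cong simp: split_beta) fastforce+
    then have d: "(\<lambda>x. f x - t x) \<in> L2 \<kappa> bdry_plus"
      using L2_lincomb[OF f2, of t 1 "- 1"] by simp
    note dS = antipodal_pullback[OF d]
    define h where "h x = 1 / 2 * (t x + s * t (?S x))" for x
    have "AE x in ?M. (f \<circ> ?S) x = s * f x" using f by (simp add: V_sym_def eq_L2_def)
    then have "AE x in ?M. f x - h x = 1 / 2 * (f x - t x) + s / 2 * (f (?S x) - t (?S x))"
    proof eventually_elim
      fix x assume "(f \<circ> ?S) x = s * f x"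
      then have "s * f (?S x) = f x" using ss by (simp add: mult.assoc[symmetric])
      then show "f x - h x = 1 / 2 * (f x - t x) + s / 2 * (f (?S x) - t (?S x))"
        by (simp add: h_def right_diff_distrib add_divide_distrib diff_divide_distrib)
    qed
    moreover have m: "sq_int ?M (\<lambda>x. 1 / 2 * (f x - t x) + s / 2 * (f (?S x) - t (?S x)))"
      using d dS(1) by (intro sq_int_add sq_int_cmult) (auto simp: L2_iff)
    moreover obtain F c where F: "finite F" "F \<subseteq> I" "h = (\<lambda>x. \<Sum>i\<in>F. c i * (case i of (p, q) \<Rightarrow> sym_phi \<kappa> s p q) x)"
      using lin_comb_symmetrize[OF s I t(1)] unfolding lin_comb_def h_def[abs_def] by blast
    moreover have "sq_int ?M h"
      unfolding F(3) using sym_phi_L2[OF borel_bdry_plus, of s]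
      by (auto intro!: sq_int_sum sq_int_cmult simp: split_beta L2_iff)
    ultimately have "l2 ?M (\<lambda>x. f x - h x) = l2 ?M (\<lambda>x. 1 / 2 * (f x - t x) + s / 2 * (f (?S x) - t (?S x)))"
      using f2 by (intro l2_cong_AE sq_int_measurable sq_int_diff) (auto simp: L2_iff)
    also have "\<dots> \<le> l2 ?M (\<lambda>x. 1 / 2 * (f x - t x)) + l2 ?M (\<lambda>x. s / 2 * (f (?S x) - t (?S x)))"
      using d dS(1) by (intro l2_triangle sq_int_cmult) (auto simp: L2_iff)
    also have "\<dots> = 1 / 2 * l2 ?M (\<lambda>x. f x - t x) + 1 / 2 * l2 ?M (\<lambda>x. f (?S x) - t (?S x))"
      unfolding l2_cmult using ns by (simp add: norm_divide)
    also have "\<dots> < \<epsilon>" using dS(2) t(2) by linarith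
    finally show "\<exists>F c. finite F \<and> F \<subseteq> I \<and>
        norm_L2 \<kappa> bdry_plus (\<lambda>x. f x - (\<Sum>i\<in>F. c i * (case i of (p, q) \<Rightarrow> sym_phi \<kappa> s p q) x)) < \<epsilon>"
      using F unfolding norm_L2_eq_l2 by blast
  }
qed

text \<open>
  Let S, S' be the scattering and antipodal scattering relations and a(\<beta>, \<alpha>) = (\<beta>, \<alpha> + \<pi>). Modulo
  2\<pi>, a S' = S and S S' = a. So w a = -w implies w S' = -w S and w S S' = -w.
\<close>

lemma A_minus_adj_in_V_plus:
  assumes w: "w \<in> L2 \<kappa> bdry" and odd: "AE x in dSigma \<kappa> bdry. w (fst x, snd x + pi) = - w x"
  shows "A_minus_adj \<kappa> w \<in> V_plus \<kappa>"
proof -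
  let ?S = "scattering \<kappa>" and ?SA = "antipodal_scattering \<kappa>"
  note wb [measurable] = L2_bdry_borel[OF w]
  have [measurable]: "w \<in> borel_measurable (borel \<Otimes>\<^sub>M borel)" by (simp add: borel_prod)
  define d where "d x = w (fst x, snd x + pi) + w x" for x
  have d0: "AE x in lborel. x \<in> lift bdry \<longrightarrow> d x = 0"
    using odd unfolding AE_dSigma[OF k(1) borel_bdry] d_def by (auto elim!: AE_mp)
  have dm: "d \<in> borel_measurable borel"
    unfolding d_def borel_prod[symmetric] by measurable
  have "(\<beta>, \<alpha> + 2 * pi + pi) = (\<beta>, (\<alpha> + pi) + 2 * pi)" for \<beta> \<alpha> :: real by simp
  then have "periodic_on bdry d"
    unfolding periodic_on_def d_def split_beta fst_conv snd_conv by (simp only: L2_bdry_periodic[OF w] simp_thms ball_triv)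
  moreover have dae: "AE x in dSigma \<kappa> bdry. 0 = d x"
    using d0 unfolding AE_dSigma[OF k(1) borel_bdry] by (auto elim!: AE_mp)
  have "sq_int (dSigma \<kappa> bdry) d"
    by (rule sq_int_cong_AE[OF sq_int_zero borel_imp_measurable_dSigma[OF dm] dae])
  ultimately have d: "d \<in> L2 \<kappa> bdry" by (simp add: L2_iff)
  have d1: "AE x in dSigma \<kappa> bdry_plus. d x = 0"
    using d0 unfolding AE_dSigma[OF k(1) borel_bdry_plus] by (auto simp: bdry_def elim!: AE_mp)
  have d_plus: "d \<in> L2 \<kappa> bdry_plus" by (rule L2_bdry_subset[OF d])
  have "l2 (dSigma \<kappa> bdry_plus) d = 0"
    using d1 d_plus by (subst l2_eq_0_iff) (auto simp: L2_iff)
  then have "l2 (dSigma \<kappa> bdry_plus) (\<lambda>x. d (?SA x)) = 0"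
    using antipodal_pullback(2)[OF d_plus] by (simp add: antisym)
  then have d2: "AE x in dSigma \<kappa> bdry_plus. d (?SA x) = 0"
    using antipodal_pullback(1)[OF d_plus] by (subst (asm) l2_eq_0_iff) (auto simp: L2_iff)
  have "AE x in dSigma \<kappa> bdry_plus. (A_minus_adj \<kappa> w \<circ> ?SA) x = 1 * A_minus_adj \<kappa> w x"
    using d1 d2
  proof eventually_elim
    case (elim x)
    obtain \<beta> \<alpha> where x: "x = (\<beta>, \<alpha>)" by (cases x)
    have "?S (?SA x) = (\<beta> + 2 * pi, \<alpha> + pi)"
      by (simp add: x scattering_def antipodal_scattering_def scat_uminus[OF k])
    then have "w (?S (?SA x)) = w (\<beta>, \<alpha> + pi)" using L2_bdry_periodic(1)[OF w] by simp
    then have 1: "w (?S (?SA x)) = - w x" using elim(1) by (simp add: d_def x eq_neg_iff_add_eq_0)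
    have "(fst (?SA x), snd (?SA x) + pi) = ?S x"
      by (simp add: x scattering_def antipodal_scattering_def)
    then have 2: "w (?S x) = - w (?SA x)" using elim(2) by (simp add: d_def eq_neg_iff_add_eq_0)
    show ?case by (simp add: A_minus_adj_def 1 2)
  qed
  then show ?thesis
    using A_minus_adj_L2(1)[OF w] by (simp add: V_plus_eq V_sym_def eq_L2_def)
qed

text \<open>The common form of \<open>P_minus\<close> and \<open>C_minus\<close>, which differ in
  the prefactor a and in the sign s of the extension.\<close>

definition hilbert_conj :: "complex \<Rightarrow> complex \<Rightarrow> bfun \<Rightarrow> real \<times> real \<Rightarrow> complex" where
  "hilbert_conj a s u = (\<lambda>x. a * A_minus_adj \<kappa> (H_minus \<kappa> (A_signed \<kappa> s u)) x)"

lemma L2_cmult: "u \<in> L2 \<kappa> A \<Longrightarrow> (\<lambda>x. c * u x) \<in> L2 \<kappa> A"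
  using L2_lincomb[of u \<kappa> A u c 0] by simp

lemma L2_diff: "u \<in> L2 \<kappa> A \<Longrightarrow> v \<in> L2 \<kappa> A \<Longrightarrow> (\<lambda>x. u x - v x) \<in> L2 \<kappa> A"
  using L2_lincomb[of u \<kappa> A v 1 "- 1"] by simp

text \<open>Changing w on a null set could show up after restriction or after the scattering
  pullback; the norm bound applied to the null function w - z excludes this.\<close>

lemma A_minus_adj_cong:
  assumes "w \<in> L2 \<kappa> bdry" "z \<in> L2 \<kappa> bdry" "eq_L2 \<kappa> bdry w z"
  shows "eq_L2 \<kappa> bdry_plus (A_minus_adj \<kappa> w) (A_minus_adj \<kappa> z)"
proof -
  have d: "(\<lambda>x. w x - z x) \<in> L2 \<kappa> bdry" by (rule L2_diff[OF assms(1,2)])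
  have "l2 (dSigma \<kappa> bdry) (\<lambda>x. w x - z x) = 0"
    using d assms(3) by (subst l2_eq_0_iff) (auto simp: L2_iff eq_L2_def)
  then have "l2 (dSigma \<kappa> bdry_plus) (A_minus_adj \<kappa> (\<lambda>x. w x - z x)) = 0"
    using A_minus_adj_L2(2)[OF d] by (simp add: antisym)
  then have "AE x in dSigma \<kappa> bdry_plus. A_minus_adj \<kappa> (\<lambda>x. w x - z x) x = 0"
    using A_minus_adj_L2(1)[OF d] by (subst (asm) l2_eq_0_iff) (auto simp: L2_iff)
  then show ?thesis
    unfolding eq_L2_def by eventually_elim (simp add: A_minus_adj_def algebra_simps)
qed

text \<open>The range is \<open>V_plus\<close> for either sign s, because it depends only on the
  antipodal oddness of the output of \<open>H_minus\<close>.\<close>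

lemma bounded_operator_hilbert_conj:
  assumes s: "norm s = 1"
  shows "bounded_operator \<kappa> (L2 \<kappa> bdry_plus) (V_plus \<kappa>) (hilbert_conj a s)"
proof -
  let ?T = "hilbert_conj a s"
  let ?n = "l2 (dSigma \<kappa> bdry_plus)"
  have E: "A_signed \<kappa> s u \<in> L2 \<kappa> bdry" if "u \<in> L2 \<kappa> bdry_plus" for u
    by (rule A_signed_L2(1)[OF that s])
  have H: "H_minus \<kappa> (A_signed \<kappa> s u) \<in> L2 \<kappa> bdry" if "u \<in> L2 \<kappa> bdry_plus" for u
    by (rule H_minus_L2[OF E[OF that]])
  have V: "?T u \<in> V_plus \<kappa>" if u: "u \<in> L2 \<kappa> bdry_plus" for u
  proof -
    have "A_minus_adj \<kappa> (H_minus \<kappa> (A_signed \<kappa> s u)) \<in> V_plus \<kappa>"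
      by (intro A_minus_adj_in_V_plus H u H_minus_odd[OF k(1) E[OF u]])
    then show ?thesis
      unfolding V_plus_def hilbert_conj_def by (auto simp: eq_L2_def intro: L2_cmult elim!: AE_mp)
  qed
  have T2: "?T u \<in> L2 \<kappa> bdry_plus" if "u \<in> L2 \<kappa> bdry_plus" for u
    using V[OF that] by (simp add: V_plus_def)
  have lin: "eq_L2 \<kappa> bdry_plus (?T (\<lambda>x. c * u x + b * v x)) (\<lambda>x. c * ?T u x + b * ?T v x)"
    if u: "u \<in> L2 \<kappa> bdry_plus" and v: "v \<in> L2 \<kappa> bdry_plus" for u v c b
  proof -
    have A: "A_signed \<kappa> s (\<lambda>x. c * u x + b * v x) = (\<lambda>x. c * A_signed \<kappa> s u x + b * A_signed \<kappa> s v x)"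
      by (auto simp: A_signed_def fun_eq_iff algebra_simps)
    have "eq_L2 \<kappa> bdry_plus (A_minus_adj \<kappa> (H_minus \<kappa> (A_signed \<kappa> s (\<lambda>x. c * u x + b * v x))))
        (A_minus_adj \<kappa> (\<lambda>x. c * H_minus \<kappa> (A_signed \<kappa> s u) x + b * H_minus \<kappa> (A_signed \<kappa> s v) x))"
      by (intro A_minus_adj_cong H L2_lincomb u v) (unfold A, intro H_minus_lincomb k E u v)
    moreover have "A_minus_adj \<kappa> (\<lambda>x. c * H_minus \<kappa> (A_signed \<kappa> s u) x + b * H_minus \<kappa> (A_signed \<kappa> s v) x) x
        = c * A_minus_adj \<kappa> (H_minus \<kappa> (A_signed \<kappa> s u)) x + b * A_minus_adj \<kappa> (H_minus \<kappa> (A_signed \<kappa> s v)) x" for x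
      by (simp add: A_minus_adj_def algebra_simps)
    ultimately show ?thesis
      unfolding eq_L2_def hilbert_conj_def by (auto simp: distrib_left mult.left_commute elim!: AE_mp)
  qed
  have bd: "?n (?T u) \<le> (4 * norm a) * ?n u" if u: "u \<in> L2 \<kappa> bdry_plus" for u
  proof -
    \<comment> \<open>A factor 2 from \<open>A_minus_adj\<close>, 1 from \<open>H_minus\<close> and
      2 from \<open>A_signed\<close>.\<close>
    have "?n (A_minus_adj \<kappa> (H_minus \<kappa> (A_signed \<kappa> s u))) \<le> 4 * ?n u"
      using A_minus_adj_L2(2)[OF H[OF u]] H_minus_norm[OF E[OF u]] A_signed_L2(2)[OF u s] by linarith
    then have "norm a * ?n (A_minus_adj \<kappa> (H_minus \<kappa> (A_signed \<kappa> s u))) \<le> norm a * (4 * ?n u)"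
      by (intro mult_left_mono) auto
    then show ?thesis unfolding hilbert_conj_def l2_cmult by simp
  qed
  \<comment> \<open>Linearity and the bound, applied to the null function u - v, give independence
    of the representative.\<close>
  have cong: "eq_L2 \<kappa> bdry_plus (?T u) (?T v)"
    if u: "u \<in> L2 \<kappa> bdry_plus" and v: "v \<in> L2 \<kappa> bdry_plus" and eq: "eq_L2 \<kappa> bdry_plus u v" for u v
  proof -
    have d: "(\<lambda>x. 1 * u x + (- 1) * v x) \<in> L2 \<kappa> bdry_plus" by (rule L2_lincomb[OF u v])
    have "?n (\<lambda>x. 1 * u x + (- 1) * v x) = 0"
      using d eq by (subst l2_eq_0_iff) (auto simp: L2_iff eq_L2_def)
    then have "?n (?T (\<lambda>x. 1 * u x + (- 1) * v x)) \<le> 0"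
      using bd[OF d] by simp
    then have "?n (?T (\<lambda>x. 1 * u x + (- 1) * v x)) = 0"
      by (simp only: antisym l2_nonneg)
    then have "AE x in dSigma \<kappa> bdry_plus. ?T (\<lambda>x. 1 * u x + (- 1) * v x) x = 0"
      using T2[OF d] by (subst (asm) l2_eq_0_iff) (auto simp: L2_iff)
    with lin[OF u v, of 1 "- 1"] show ?thesis
      unfolding eq_L2_def by eventually_elim simp
  qed
  show ?thesis
    unfolding bounded_operator_def norm_L2_eq_l2
    using V lin cong bd by (intro conjI exI[of _ "4 * norm a"] ballI allI impI) auto
qed

text \<open>Here s(pi - \<alpha>) = pi - s(\<alpha>), whereas the antipodal relation has
  s(-\<alpha>) = -s(\<alpha>); the extra pi contributes exp(i(2q + 1)pi) = -1, the sign by which the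
  two pullbacks differ.\<close>

lemma phi'_scattering: "phi' \<kappa> p q (scattering \<kappa> x) = - ((- 1) powi p * phi' \<kappa> p (p - q - 1) x)"
proof (cases x)
  case (Pair \<beta> \<alpha>)
  have s: "scat \<kappa> (pi - \<alpha>) = pi - scat \<kappa> \<alpha>"
    using scat_add_pi[of \<kappa> "- \<alpha>"] by (simp add: scat_uminus[OF k])
  have "cos (2 * (pi - \<alpha>)) = cos (2 * \<alpha>)" by (simp add: right_diff_distrib cos_diff)
  then have d: "deriv (scat \<kappa>) (pi - \<alpha>) = deriv (scat \<kappa>) \<alpha>"
    unfolding deriv_scat[OF k] norm_denominator[OF k] by simp
  have c: "cis (of_int p * pi) = (- 1) powi p" by (metis cis_pi cis_power_int)
  have c': "cis (of_int (2 * q + 1) * pi) = - 1"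
  proof -
    have "of_int (2 * q + 1) * pi = of_int q * (0 + 2 * pi) + pi" by (simp add: algebra_simps)
    then show ?thesis by (simp only: cis_mult[symmetric] cis_int_add_2pi) simp
  qed
  have "of_int p * (\<beta> + pi + 2 * scat \<kappa> \<alpha>) + of_int (2 * q + 1) * (pi - scat \<kappa> \<alpha>)
      = of_int p * pi + (of_int (2 * q + 1) * pi + (of_int p * \<beta> + of_int (2 * (p - q - 1) + 1) * scat \<kappa> \<alpha>))"
    by (simp add: algebra_simps)
  then have "cis (of_int p * (\<beta> + pi + 2 * scat \<kappa> \<alpha>) + of_int (2 * q + 1) * (pi - scat \<kappa> \<alpha>))
      = (- 1) powi p * (- 1 * cis (of_int p * \<beta> + of_int (2 * (p - q - 1) + 1) * scat \<kappa> \<alpha>))"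
    by (simp only: cis_mult[symmetric] c c')
  then show ?thesis by (simp add: Pair phi'_def scattering_def d s)
qed

lemma A_signed_sym_phi:
  assumes "s * s = 1"
  shows "A_signed \<kappa> (- s) (sym_phi \<kappa> s p q) = sym_phi \<kappa> s p q"
proof -
  have "sym_phi \<kappa> s p q (scattering \<kappa> x) = - (s * sym_phi \<kappa> s p q x)" for x
    using assms by (simp add: sym_phi_def phi'_scattering distrib_left powi_cancel mult.left_commute)
      (simp add: mult.assoc[symmetric])
  then show ?thesis using assms by (simp add: A_signed_def fun_eq_iff mult.assoc[symmetric])
qed

text \<open>Both modes of \<open>sym_phi\<close> are mapped to multiples of the same
  \<open>u' p q\<close>, the reflected one with an extra (-1)^p that cancels its coefficient. The
  signs of the two modes thus add with relative weight s, and this single coefficient contains the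
  case distinctions of both parts.\<close>

lemma hilbert_conj_sym_phi:
  assumes "s * s = 1"
  shows "eq_L2 \<kappa> bdry_plus (hilbert_conj a (- s) (sym_phi \<kappa> s p q))
    (\<lambda>x. - \<i> * a * (sgn_mode q + s * sgn_mode (p - q - 1)) * u' \<kappa> p q x)"
proof -
  let ?r = "p - q - 1" and ?c = "(- 1) powi p :: complex"
  have m: "mult_lim \<kappa> odd_symbol (phi' \<kappa> p q) (\<lambda>x. - \<i> * sgn_mode q * phi' \<kappa> p q x)" for q
    using mult_lim_phi'[OF k, of p q] by (simp add: sgn_mode_def split: if_splits)
  define w where "w x = 1 * (- \<i> * sgn_mode q * phi' \<kappa> p q x) + s * ?c * (- \<i> * sgn_mode ?r * phi' \<kappa> p ?r x)" for x
  have "mult_lim \<kappa> odd_symbol (\<lambda>x. 1 * phi' \<kappa> p q x + s * ?c * phi' \<kappa> p ?r x) w"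
    unfolding w_def[abs_def]
    by (intro mult_lim_lincomb m phi'_L2 k borel_bdry) (rule norm_odd_symbol)
  then have lim: "mult_lim \<kappa> odd_symbol (sym_phi \<kappa> s p q) w" by (simp add: sym_phi_def)
  have L2: "sym_phi \<kappa> s p q \<in> L2 \<kappa> bdry" by (rule sym_phi_L2[OF borel_bdry])
  have w2: "w \<in> L2 \<kappa> bdry" using lim by (simp add: mult_lim_def)
  have "eq_L2 \<kappa> bdry_plus (A_minus_adj \<kappa> (H_minus \<kappa> (sym_phi \<kappa> s p q))) (A_minus_adj \<kappa> w)"
    by (intro A_minus_adj_cong H_minus_L2 L2 w2 H_minus_unique lim)
  moreover have "A_minus_adj \<kappa> w x = - \<i> * (sgn_mode q + s * sgn_mode ?r) * u' \<kappa> p q x" for x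
  proof -
    have 1: "A_minus_adj \<kappa> (phi' \<kappa> p q) x = u' \<kappa> p q x"
      by (simp add: A_minus_adj_def u'_eq[OF k] phi'_scattering)
    have 2: "A_minus_adj \<kappa> (phi' \<kappa> p ?r) x = ?c * u' \<kappa> p q x"
      by (simp add: A_minus_adj_def u'_eq[OF k] phi'_scattering distrib_left powi_cancel)
    have "A_minus_adj \<kappa> w x = - \<i> * sgn_mode q * A_minus_adj \<kappa> (phi' \<kappa> p q) x
        + s * ?c * (- \<i> * sgn_mode ?r) * A_minus_adj \<kappa> (phi' \<kappa> p ?r) x"
      by (simp add: A_minus_adj_def w_def algebra_simps)
    also have "\<dots> = - \<i> * sgn_mode q * u' \<kappa> p q x + s * (- \<i> * sgn_mode ?r) * (?c * (?c * u' \<kappa> p q x))"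
      unfolding 1 2 by (simp only: mult_ac)
    finally show ?thesis unfolding powi_cancel by (simp add: algebra_simps)
  qed
  ultimately show ?thesis
    unfolding hilbert_conj_def A_signed_sym_phi[OF assms] eq_L2_def
    by (auto elim!: AE_mp)
qed

lemma P_minus_eq: "P_minus \<kappa> = hilbert_conj 1 1"
  by (simp add: fun_eq_iff P_minus_def hilbert_conj_def A_plus_eq_A_signed)

lemma C_minus_eq: "C_minus \<kappa> = hilbert_conj (1 / 2) (- 1)"
  by (simp add: fun_eq_iff C_minus_def hilbert_conj_def A_minus_eq_A_signed)

end

theorem theorem9:
  fixes \<kappa> :: real
  assumes "- 1 < \<kappa>" and "\<kappa> < 1"
  shows
    "bounded_operator \<kappa> (L2 \<kappa> bdry_plus) (L2 \<kappa> bdry_plus) (P_minus \<kappa>) \<and>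
     bounded_operator \<kappa> (L2 \<kappa> bdry_plus) (L2 \<kappa> bdry_plus) (C_minus \<kappa>) \<and>
     complete_orthogonal_system \<kappa> (V_minus \<kappa>) {(p, q). p \<le> 2 * q + 1} (\<lambda>(p, q). v' \<kappa> p q) \<and>
     complete_orthogonal_system \<kappa> (V_plus \<kappa>) {(p, q). p < 2 * q + 1} (\<lambda>(p, q). u' \<kappa> p q) \<and>
     bounded_operator \<kappa> (V_minus \<kappa>) (V_plus \<kappa>) (P_minus \<kappa>) \<and>
     (\<forall>p q :: int. p \<le> 2 * q + 1 \<longrightarrow>
        eq_L2 \<kappa> bdry_plus (P_minus \<kappa> (v' \<kappa> p q))
          (if real_of_int q > - 1 / 2 \<and> real_of_int p < real_of_int q + 1 / 2
           then (\<lambda>x. - 2 * \<i> * u' \<kappa> p q x)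
           else (\<lambda>x. 0))) \<and>
     bounded_operator \<kappa> (V_plus \<kappa>) (V_plus \<kappa>) (C_minus \<kappa>) \<and>
     (\<forall>p q :: int. p < 2 * q + 1 \<longrightarrow>
        eq_L2 \<kappa> bdry_plus (C_minus \<kappa> (u' \<kappa> p q))
          (if real_of_int q < - 1 / 2 \<and> real_of_int p < real_of_int q + 1 / 2
           then (\<lambda>x. \<i> * u' \<kappa> p q x)
           else if real_of_int q > - 1 / 2 \<and> real_of_int p > real_of_int q + 1 / 2
           then (\<lambda>x. - \<i> * u' \<kappa> p q x)
           else (\<lambda>x. 0)))"
proof -
  note k = assms
  have P: "bounded_operator \<kappa> (L2 \<kappa> bdry_plus) (V_plus \<kappa>) (P_minus \<kappa>)"
    unfolding P_minus_eq[OF k] by (rule bounded_operator_hilbert_conj[OF k]) simp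
  have C: "bounded_operator \<kappa> (L2 \<kappa> bdry_plus) (V_plus \<kappa>) (C_minus \<kappa>)"
    unfolding C_minus_eq[OF k] by (rule bounded_operator_hilbert_conj[OF k]) simp
  have V: "V_plus \<kappa> \<subseteq> L2 \<kappa> bdry_plus" "V_minus \<kappa> \<subseteq> L2 \<kappa> bdry_plus"
    by (auto simp: V_plus_def V_minus_def)
  \<comment> \<open>For integers the half-integer thresholds are the signs of q and of p - q - 1:
    the inequality p < q + 1/2 means p - q - 1 < 0.\<close>
  have half: "real_of_int q > - 1 / 2 \<longleftrightarrow> 0 \<le> q" "real_of_int q < - 1 / 2 \<longleftrightarrow> q < 0"
    "real_of_int p < real_of_int q + 1 / 2 \<longleftrightarrow> p \<le> q" "real_of_int p > real_of_int q + 1 / 2 \<longleftrightarrow> q < p" for p q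
    by linarith+
  show ?thesis
  proof (intro conjI allI impI)
    show "complete_orthogonal_system \<kappa> (V_minus \<kappa>) {(p, q). p \<le> 2 * q + 1} (\<lambda>(p, q). v' \<kappa> p q)"
      unfolding V_minus_eq v'_eq_sym[OF k] by (rule complete_orthogonal_sym_phi[OF k]) auto
    show "complete_orthogonal_system \<kappa> (V_plus \<kappa>) {(p, q). p < 2 * q + 1} (\<lambda>(p, q). u' \<kappa> p q)"
      unfolding V_plus_eq u'_eq_sym[OF k] by (rule complete_orthogonal_sym_phi[OF k]) auto
  next
    fix p q :: int assume pq: "p \<le> 2 * q + 1"
    \<comment> \<open>A difference of signs survives only when they disagree. Since p - q - 1 \<le>
      q, the sole possibility is q \<ge> 0 with p - q - 1 < 0.\<close>
    have "- \<i> * 1 * (sgn_mode q + (- 1) * sgn_mode (p - q - 1)) = (if 0 \<le> q \<and> p \<le> q then - 2 * \<i> else 0)"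
      using pq by (auto simp: sgn_mode_def)
    then show "eq_L2 \<kappa> bdry_plus (P_minus \<kappa> (v' \<kappa> p q))
        (if real_of_int q > - 1 / 2 \<and> real_of_int p < real_of_int q + 1 / 2
         then (\<lambda>x. - 2 * \<i> * u' \<kappa> p q x) else (\<lambda>x. 0))"
      using hilbert_conj_sym_phi[OF k, of "- 1" 1 p q]
      unfolding half P_minus_eq[OF k] v'_eq_sym[OF k] by (auto split: if_splits)
  next
    fix p q :: int assume pq: "p < 2 * q + 1"
    \<comment> \<open>A sum of signs survives only when they agree; the factor 1/2 turns it into a
      single sign, negative for two negative modes.\<close>
    have "- \<i> * (1 / 2) * (sgn_mode q + 1 * sgn_mode (p - q - 1))
        = (if q < 0 \<and> p \<le> q then \<i> else if 0 \<le> q \<and> q < p then - \<i> else 0)"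
      by (auto simp: sgn_mode_def)
    then show "eq_L2 \<kappa> bdry_plus (C_minus \<kappa> (u' \<kappa> p q))
          (if real_of_int q < - 1 / 2 \<and> real_of_int p < real_of_int q + 1 / 2
           then (\<lambda>x. \<i> * u' \<kappa> p q x)
           else if real_of_int q > - 1 / 2 \<and> real_of_int p > real_of_int q + 1 / 2
           then (\<lambda>x. - \<i> * u' \<kappa> p q x)
           else (\<lambda>x. 0))"
      using hilbert_conj_sym_phi[OF k, of 1 "1 / 2" p q]
      unfolding half C_minus_eq[OF k] u'_eq_sym[OF k, symmetric] by (auto split: if_splits)
  qed (use P C V in \<open>auto intro: bounded_operator_mono\<close>)
qed

end
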